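(* Let $H$ be a graph with maximum degree $\Delta(H)\geq 4$. In the $H$-subdivision game on $K_n$, {\tt CleverBreaker} has a winning strategy against {\tt CleverMaker} for bias $b=\frac{2n}{\Delta(H)-1}$, while for every fixed $\epsilon>0$, {\tt RandomMaker} wins with probability tending to $1$ as $n\to\infty$ against {\tt CleverBreaker} for bias $b=\frac{(1-\epsilon)n}{\Delta(H)-1}$. In particular, $\frac{n}{\Delta(H)-1}$ is a threshold both for the {\tt CleverMaker}–{\tt CleverBreaker} game and for the {\tt RandomMaker}–{\tt CleverBreaker} game.
   Context: A $(1:b)$ biased Maker–Breaker game on $K_n$ is played on the board $E(K_n)$: in each round Maker claims one unclaimed edge and then Breaker claims $b$ unclaimed edges (fewer if fewer remain), until all edges are claimed. $M$ denotes Maker's graph at the end. In the $H$-subdivision game Maker wins iff $M$ contains a subdivision of $H$ as a subgraph (a subdivision of $H$ is obtained by repeatedly replacing an edge $uv$ by a path $uwv$ through a new vertex $w$); otherwise Breaker wins. {\tt RandomMaker} chooses each of its edges uniformly at random among the currently unclaimed edges; {\tt CleverBreaker}, {\tt CleverMaker} follow strategies maximizing their probability of winning. For $X,Y\in\{\text{Random},\text{Clever}\}$, $f(n)$ is a threshold for the XMaker–YBreaker game if the probability that XMaker wins tends to $1$ as $n\to\infty$ whenever $b=o(f(n))$ and tends to $0$ whenever $b=\omega(f(n))$. *)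

theory Defs
  imports "HOL-Probability.Probability" "HOL-Library.Landau_Symbols"
    "Graph_Theory.Graph_Theory"
begin

section \<open>Biased Maker--Breaker games\<close>

text \<open>
  A history lists the completed rounds in chronological order; a round consists of the element
  claimed by Maker and the set claimed by Breaker. Strategies may depend on the whole history and
  may randomise; Breaker's second argument is Maker's move in the current round.
\<close>

type_synonym 'e history = "('e \<times> 'e set) list"
type_synonym 'e maker_strategy = "'e history \<Rightarrow> 'e pmf"
type_synonym 'e breaker_strategy = "'e history \<Rightarrow> 'e \<Rightarrow> 'e set pmf"

definition maker_claims :: "'e history \<Rightarrow> 'e set" where
  "maker_claims h = fst ` set h"

definition breaker_claims :: "'e history \<Rightarrow> 'e set" where
  "breaker_claims h = \<Union> (snd ` set h)"

definition unclaimed :: "'e set \<Rightarrow> 'e history \<Rightarrow> 'e set" where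
  "unclaimed X h = X - (maker_claims h \<union> breaker_claims h)"

definition breaker_moves :: "'e set \<Rightarrow> nat \<Rightarrow> 'e history \<Rightarrow> 'e \<Rightarrow> 'e set set" where
  "breaker_moves X b h e =
     (let U = unclaimed X h - {e} in {F. F \<subseteq> U \<and> card F = min b (card U)})"

definition maker_strategies :: "'e set \<Rightarrow> 'e maker_strategy set" where
  "maker_strategies X = {\<sigma>. \<forall>h. unclaimed X h \<noteq> {} \<longrightarrow> set_pmf (\<sigma> h) \<subseteq> unclaimed X h}"

definition breaker_strategies :: "'e set \<Rightarrow> nat \<Rightarrow> 'e breaker_strategy set" where
  "breaker_strategies X b = {\<tau>. \<forall>h e. set_pmf (\<tau> h e) \<subseteq> breaker_moves X b h e}"

definition random_maker :: "'e set \<Rightarrow> 'e maker_strategy" where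
  "random_maker X h = pmf_of_set (unclaimed X h)"

primrec play_rounds ::
    "'e set \<Rightarrow> 'e maker_strategy \<Rightarrow> 'e breaker_strategy \<Rightarrow> nat \<Rightarrow> 'e history pmf" where
  "play_rounds X \<sigma> \<tau> 0 = return_pmf []"
| "play_rounds X \<sigma> \<tau> (Suc k) =
     do {
       h \<leftarrow> play_rounds X \<sigma> \<tau> k;
       if unclaimed X h = {} then return_pmf h
       else do {
         e \<leftarrow> \<sigma> h;
         F \<leftarrow> \<tau> h e;
         return_pmf (h @ [(e, F)])
       }
     }"

text \<open>
  Every round claims at least one element, so on a finite board \<open>card X\<close> rounds always exhaust
  the board.
\<close>

definition final_maker_claims ::
    "'e set \<Rightarrow> 'e maker_strategy \<Rightarrow> 'e breaker_strategy \<Rightarrow> 'e set pmf" where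
  "final_maker_claims X \<sigma> \<tau> = map_pmf maker_claims (play_rounds X \<sigma> \<tau> (card X))"

definition maker_win_prob ::
    "'e set \<Rightarrow> ('e set \<Rightarrow> bool) \<Rightarrow> 'e maker_strategy \<Rightarrow> 'e breaker_strategy \<Rightarrow> real" where
  "maker_win_prob X W \<sigma> \<tau> = measure_pmf.prob (final_maker_claims X \<sigma> \<tau>) {M. W M}"

text \<open>
  Maker's winning probability when the clever players play optimally. As these are finite
  games of perfect information, the suprema and infima are attained, also by deterministic
  strategies.
\<close>

definition clever_clever_prob :: "'e set \<Rightarrow> nat \<Rightarrow> ('e set \<Rightarrow> bool) \<Rightarrow> real" where
  "clever_clever_prob X b W =
     (SUP \<sigma>\<in>maker_strategies X. INF \<tau>\<in>breaker_strategies X b. maker_win_prob X W \<sigma> \<tau>)"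

definition random_clever_prob :: "'e set \<Rightarrow> nat \<Rightarrow> ('e set \<Rightarrow> bool) \<Rightarrow> real" where
  "random_clever_prob X b W =
     (INF \<tau>\<in>breaker_strategies X b. maker_win_prob X W (random_maker X) \<tau>)"

definition breaker_has_winning_strategy :: "'e set \<Rightarrow> nat \<Rightarrow> ('e set \<Rightarrow> bool) \<Rightarrow> bool" where
  "breaker_has_winning_strategy X b W \<longleftrightarrow>
     (\<exists>t :: 'e history \<Rightarrow> 'e \<Rightarrow> 'e set.
        (\<forall>h e. t h e \<in> breaker_moves X b h e) \<and>
        (\<forall>\<sigma>\<in>maker_strategies X.
           \<forall>M\<in>set_pmf (final_maker_claims X \<sigma> (\<lambda>h e. return_pmf (t h e))). \<not> W M))"

definition is_threshold :: "(nat \<Rightarrow> nat \<Rightarrow> real) \<Rightarrow> (nat \<Rightarrow> real) \<Rightarrow> bool" where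
  "is_threshold p f \<longleftrightarrow>
     (\<forall>b :: nat \<Rightarrow> nat.
        ((\<lambda>n. real (b n)) \<in> o(f) \<longrightarrow> (\<lambda>n. p n (b n)) \<longlonglongrightarrow> 1) \<and>
        ((\<lambda>n. real (b n)) \<in> \<omega>(f) \<longrightarrow> (\<lambda>n. p n (b n)) \<longlonglongrightarrow> 0))"

section \<open>The subdivision game on the complete graph\<close>

text \<open>
  Finite simple graphs are those satisfying \<^locale>\<open>pair_graph\<close>: an undirected edge \<open>uv\<close> is
  represented by the two arcs \<open>(u, v)\<close> and \<open>(v, u)\<close>, so out-degrees are degrees. Board elements
  are the two-element sets of vertices.
\<close>

definition max_degree :: "'a pair_pre_digraph \<Rightarrow> nat" where
  "max_degree H = Max (insert 0 (out_degree (with_proj H) ` pverts H))"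

definition complete_edges :: "nat \<Rightarrow> nat set set" where
  "complete_edges n = {e. e \<subseteq> {..<n} \<and> card e = 2}"

definition edge_graph :: "nat \<Rightarrow> nat set set \<Rightarrow> nat pair_pre_digraph" where
  "edge_graph n M = \<lparr>pverts = {..<n}, parcs = {(u, v). {u, v} \<in> M}\<rparr>"

text \<open>
  \<^const>\<open>subdivision\<close> relates graphs over one and the same vertex type, so \<open>H\<close> is first replaced by an
  isomorphic copy over the vertex type of \<open>G\<close>.
\<close>

definition contains_subdivision :: "'v pair_pre_digraph \<Rightarrow> 'a pair_pre_digraph \<Rightarrow> bool" where
  "contains_subdivision G H \<longleftrightarrow>
     (\<exists>H' S. digraph_iso (with_proj H) (with_proj H') \<and> subdivision_pair H' S \<and>
        subgraph (with_proj S) (with_proj G))"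

definition subdivision_win :: "'a pair_pre_digraph \<Rightarrow> nat \<Rightarrow> nat set set \<Rightarrow> bool" where
  "subdivision_win H n M \<longleftrightarrow> contains_subdivision (edge_graph n M) H"

text \<open>A real-valued bias stands for either of its two integer roundings.\<close>

definition is_rounding :: "nat \<Rightarrow> real \<Rightarrow> bool" where
  "is_rounding b x \<longleftrightarrow> int b = \<lfloor>x\<rfloor> \<or> int b = \<lceil>x\<rceil>"

end

theory Submission
  imports Defs "HOL-Real_Asymp.Real_Asymp"
begin

text \<open>
  Breaker answers each Maker edge \<open>uv\<close> by \<open>\<lfloor>b/2\<rfloor>\<close> edges at \<open>u\<close> and as many at \<open>v\<close>, which keeps
  Maker's degrees below \<open>\<Delta>(H)\<close>.

  For the converse, stop the game while a positive fraction of the board is unclaimed. Against every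
  Breaker, Maker's random graph then contains a fixed set of \<open>k\<close> edges with probability at most
  \<open>(C/n)\<^sup>k\<close>, so first-moment arguments show that small vertex sets span few edges, that small sets
  touch few edges and that short cycles are rare, while the average degree exceeds \<open>\<Delta>(H) - 1 \<ge> 3\<close>.
  A minimal sufficiently dense vertex set \<open>W\<close> of this graph is an expander containing many vertices
  of degree at least \<open>\<Delta>(H)\<close>. Around such vertices, chosen far apart, one grows disjoint trees, one for
  each arc of \<open>H\<close>, up to linear size, and connects them in pairs by short paths. Routing the edges of
  \<open>H\<close> one after the other with trees of geometrically decreasing sizes lets every path avoid the trees
  that are still needed.
\<close>

section \<open>Graphs given by edge sets\<close>

text \<open>Breaker reacts to Maker, so Maker's edges are far from independent. Two facts survive:
  an upper bound on the probability that given edges are all present, and the exact number of edges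
  that Maker has claimed. Hence every random property below says that something is sparse or rare,
  while expansion and large degrees are extracted deterministically from the edge count. Put
  \<open>d = max_degree H - 1\<close>. Against bias \<open>(1 - \<epsilon>) n / d\<close> Maker can
  claim about \<open>(d / 2) (1 + \<epsilon> / 2) n\<close> edges while order \<open>n ^ 2\<close>
  edges remain free. Every vertex set in the core then touches more than 3/2 edges per vertex,
  whereas small sets span hardly more than one; this gap of 1/2 pays both for expansion and for the
  growth of trees. Growth cannot start from single vertices: a forest lacks one edge per tree and
  one per branch vertex, and this loss must be small compared with each tree. So trees of a constant
  size \<open>Q\<close> are needed first, and they come from the absence of short cycles near the
  branch vertices.\<close>

definition inner_edges :: "'v set set \<Rightarrow> 'v set \<Rightarrow> 'v set set" where
  "inner_edges G U = {e \<in> G. e \<subseteq> U}"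

definition touching_edges :: "'v set set \<Rightarrow> 'v set \<Rightarrow> 'v set set" where
  "touching_edges G U = {e \<in> G. e \<inter> U \<noteq> {}}"

definition neighborhood :: "'v set set \<Rightarrow> 'v set \<Rightarrow> 'v set" where
  "neighborhood G U = {y. y \<notin> U \<and> (\<exists>x\<in>U. {x, y} \<in> G)}"

definition walk :: "'v set set \<Rightarrow> 'v list \<Rightarrow> bool" where
  "walk G = successively (\<lambda>x y. {x, y} \<in> G)"

text \<open>The number \<open>r\<close> bounds the number of vertices of the walk, not its number of edges.\<close>

definition linked :: "'v set set \<Rightarrow> 'v set \<Rightarrow> nat \<Rightarrow> 'v \<Rightarrow> 'v \<Rightarrow> bool" where
  "linked G S r x y \<longleftrightarrow>
     (\<exists>p. p \<noteq> [] \<and> hd p = x \<and> last p = y \<and> walk G p \<and> set p \<subseteq> S \<and> length p \<le> r)"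

lemma walk_rev [simp]: "walk G (rev p) = walk G p"
  by (simp add: walk_def insert_commute)

lemma walk_append: "walk G (p @ q) \<longleftrightarrow>
    walk G p \<and> walk G q \<and> (p = [] \<or> q = [] \<or> {last p, hd q} \<in> G)"
  by (simp add: walk_def successively_append_iff)

lemma walk_Cons: "walk G (x # p) \<longleftrightarrow> p = [] \<or> {x, hd p} \<in> G \<and> walk G p"
  by (simp add: walk_def successively_Cons)

lemma walk_mono: "walk G p \<Longrightarrow> G \<subseteq> G' \<Longrightarrow> walk G' p"
  unfolding walk_def by (erule successively_mono) auto

lemma linked_refl: "x \<in> S \<Longrightarrow> 1 \<le> r \<Longrightarrow> linked G S r x x"
  unfolding linked_def by (rule exI[of _ "[x]"]) (simp add: walk_def)

lemma linked_mono:
  "linked G S r x y \<Longrightarrow> G \<subseteq> G' \<Longrightarrow> S \<subseteq> S' \<Longrightarrow> r \<le> r' \<Longrightarrow> linked G' S' r' x y"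
  unfolding linked_def by (elim exE conjE) (rule exI, auto intro: walk_mono)

lemma linked_Suc: "linked G S r x y \<Longrightarrow> linked G S (Suc r) x y"
  by (erule linked_mono) auto

lemma linked_sym: "linked G S r x y \<Longrightarrow> linked G S r y x"
  unfolding linked_def by (metis hd_rev last_rev length_rev rev_is_Nil_conv set_rev walk_rev)

lemma linked_endpoints: "linked G S r x y \<Longrightarrow> x \<in> S \<and> y \<in> S"
  unfolding linked_def by auto

lemma linked_trans:
  assumes "linked G S r x y" "linked G S s y z"
  shows "linked G S (r + s) x z"
proof -
  obtain p where p: "p \<noteq> []" "hd p = x" "last p = y" "walk G p" "set p \<subseteq> S" "length p \<le> r"
    using assms(1) unfolding linked_def by auto
  obtain q where q: "q \<noteq> []" "hd q = y" "last q = z" "walk G q" "set q \<subseteq> S" "length q \<le> s"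
    using assms(2) unfolding linked_def by auto
  show ?thesis
  proof (cases "tl q = []")
    case True
    then have "y = z" using q by (cases q) auto
    then show ?thesis using assms(1) linked_mono[of G S r x y G S "r + s"] by auto
  next
    case False
    then obtain q' where q': "q = y # q'" "q' \<noteq> []" using q by (cases q) auto
    have "walk G (p @ q')" using p q q' by (auto simp: walk_append walk_Cons)
    moreover have "last (p @ q') = z" using q q' by auto
    ultimately show ?thesis unfolding linked_def
      using p q q' by (intro exI[of _ "p @ q'"]) auto
  qed
qed

lemma linked_step:
  assumes "linked G S r x y" "{y, z} \<in> G" "z \<in> S"
  shows "linked G S (Suc r) x z"
proof -
  obtain p where p: "p \<noteq> []" "hd p = x" "last p = y" "walk G p" "set p \<subseteq> S" "length p \<le> r"
    using assms(1) unfolding linked_def by auto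
  then show ?thesis unfolding linked_def using assms
    by (intro exI[of _ "p @ [z]"]) (auto simp: walk_append walk_Cons)
qed

lemma linked_unstep:
  assumes "linked G S (Suc (Suc r)) x z"
  shows "x = z \<or> (\<exists>y. linked G S (Suc r) x y \<and> {y, z} \<in> G)"
proof -
  obtain p where p: "p \<noteq> []" "hd p = x" "last p = z" "walk G p" "set p \<subseteq> S"
      "length p \<le> Suc (Suc r)"
    using assms unfolding linked_def by auto
  obtain q where q: "p = q @ [z]" using p by (metis append_butlast_last_id)
  show ?thesis
  proof (cases "q = []")
    case True
    then show ?thesis using p q by auto
  next
    case False
    then have "linked G S (Suc r) x (last q)" unfolding linked_def
      using p q by (intro exI[of _ q]) (auto simp: walk_append)
    then show ?thesis using p q False by (auto simp: walk_append)
  qed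
qed

text \<open>A shortest such walk repeats no vertex, since the closed part between two visits could
  be cut out.\<close>

lemma linked_distinct_path:
  assumes "linked G S r x y"
  obtains p where "p \<noteq> []" "hd p = x" "last p = y" "walk G p" "set p \<subseteq> S" "length p \<le> r"
    "distinct p"
proof -
  define P where "P p \<longleftrightarrow> p \<noteq> [] \<and> hd p = x \<and> last p = y \<and> walk G p \<and> set p \<subseteq> S \<and> length p \<le> r"
    for p
  have "\<exists>p. P p" using assms unfolding linked_def P_def by auto
  then have "\<exists>p. P p \<and> (\<forall>q. P q \<longrightarrow> length p \<le> length q)"
    by (metis ex_has_least_nat)
  then obtain p where p: "P p" "\<And>q. P q \<Longrightarrow> length p \<le> length q" by blast
  have "distinct p"
  proof (rule ccontr)
    assume "\<not> distinct p"
    then obtain as bs cs z where d: "p = as @ [z] @ bs @ [z] @ cs"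
      using not_distinct_decomp by blast
    have "walk G (as @ [z])" "walk G ([z] @ cs)"
      using p(1) unfolding P_def d by (auto simp: walk_append walk_Cons)
    then have "walk G (as @ [z] @ cs)" by (auto simp: walk_append walk_Cons)
    moreover have "hd (as @ [z] @ cs) = x" "last (as @ [z] @ cs) = y"
      using p(1) unfolding P_def d by (cases as; simp)+
    ultimately have "P (as @ [z] @ cs)"
      using p(1) unfolding P_def d by simp
    then have "length p \<le> length (as @ [z] @ cs)" using p(2) by blast
    then show False unfolding d by simp
  qed
  then show thesis using that[of p] p(1) unfolding P_def by blast
qed

section \<open>Counting edges inside vertex sets\<close>

locale finite_graph =
  fixes G :: "'v set set" and W :: "'v set"
  assumes finite_W: "finite W"
    and edge_subset: "e \<in> G \<Longrightarrow> e \<subseteq> W"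
    and edge_card: "e \<in> G \<Longrightarrow> card e = 2"
begin

lemma finite_G: "finite G"
  using finite_subset[of G "Pow W"] finite_W edge_subset by auto

lemma finite_inner [simp]: "finite (inner_edges G U)"
  using finite_G by (simp add: inner_edges_def)

lemma finite_touching [simp]: "finite (touching_edges G U)"
  using finite_G by (simp add: touching_edges_def)

lemma edge_ends: "{x, y} \<in> G \<Longrightarrow> x \<noteq> y \<and> x \<in> W \<and> y \<in> W"
  using edge_subset[of "{x, y}"] edge_card[of "{x, y}"] by (auto simp: card_insert_if split: if_splits)

lemma edge_obtain: assumes "e \<in> G" "x \<in> e" obtains y where "e = {x, y}" "x \<noteq> y"
  using edge_card[OF assms(1)] assms(2) by (auto simp: card_2_iff)

lemma neighborhood_subset: "neighborhood G U \<subseteq> W"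
  using edge_ends by (auto simp: neighborhood_def)

lemma finite_neighborhood [simp]: "finite (neighborhood G U)"
  using neighborhood_subset finite_W finite_subset by blast

lemma inner_mono: "U \<subseteq> V \<Longrightarrow> card (inner_edges G U) \<le> card (inner_edges G V)"
  by (rule card_mono) (auto simp: inner_edges_def finite_G)

lemma inner_Un_disjoint:
  assumes "A \<inter> B = {}"
  shows "card (inner_edges G A) + card (inner_edges G B) \<le> card (inner_edges G (A \<union> B))"
proof -
  have "inner_edges G A \<inter> inner_edges G B = {}"
  proof -
    { fix e assume "e \<in> G" "e \<subseteq> A" "e \<subseteq> B"
      then have "e = {}" using assms by auto
      then have False using edge_card[OF \<open>e \<in> G\<close>] by simp }
    then show ?thesis by (auto simp: inner_edges_def)
  qed
  then have "card (inner_edges G A) + card (inner_edges G B) =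
      card (inner_edges G A \<union> inner_edges G B)"
    by (simp add: card_Un_disjoint)
  also have "\<dots> \<le> card (inner_edges G (A \<union> B))"
    by (rule card_mono) (auto simp: inner_edges_def finite_G)
  finally show ?thesis .
qed

lemma inner_UN_disjoint:
  assumes "finite I" "\<And>i j. i \<in> I \<Longrightarrow> j \<in> I \<Longrightarrow> i \<noteq> j \<Longrightarrow> A i \<inter> A j = {}"
  shows "(\<Sum>i\<in>I. card (inner_edges G (A i))) \<le> card (inner_edges G (\<Union>i\<in>I. A i))"
  using assms
proof (induction I rule: finite_induct)
  case empty
  then show ?case by simp
next
  case (insert i I)
  have "(\<Sum>i\<in>I. card (inner_edges G (A i))) \<le> card (inner_edges G (\<Union>i\<in>I. A i))"
    using insert by auto
  moreover have "A i \<inter> (\<Union>i\<in>I. A i) = {}" using insert by fastforce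
  ultimately show ?case using inner_Un_disjoint[of "A i" "\<Union>i\<in>I. A i"] insert(1,2)
    by (simp add: Un_commute)
qed

text \<open>The counting step behind every expansion argument: if no edge at \<open>A\<close> leaves
  \<open>A \<union> B\<close>, the many edges touching \<open>A\<close> are crammed into that union,
  which contradicts the sparsity of small sets.\<close>

lemma inner_Un_touching:
  assumes "A \<inter> B = {}" "\<And>e. e \<in> touching_edges G A \<Longrightarrow> e \<subseteq> A \<union> B"
  shows "card (inner_edges G B) + card (touching_edges G A) \<le> card (inner_edges G (A \<union> B))"
proof -
  have "inner_edges G B \<inter> touching_edges G A = {}"
    using assms(1) by (auto simp: inner_edges_def touching_edges_def)
  then have "card (inner_edges G B) + card (touching_edges G A) =
      card (inner_edges G B \<union> touching_edges G A)"
    by (simp add: card_Un_disjoint)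
  also have "\<dots> \<le> card (inner_edges G (A \<union> B))"
    by (rule card_mono) (use assms in \<open>auto simp: inner_edges_def touching_edges_def finite_G\<close>)
  finally show ?thesis .
qed

text \<open>Each new vertex brings an edge to a parent in \<open>A\<close>, and these edges differ
  because each contains exactly one new vertex. So edges minus vertices never drops while a tree
  grows.\<close>

lemma inner_grow:
  assumes "A \<subseteq> A'" "A' - A \<subseteq> neighborhood G A"
  shows "card (inner_edges G A) + card (A' - A) \<le> card (inner_edges G A')"
proof -
  define par where "par y = (SOME x. x \<in> A \<and> {x, y} \<in> G)" for y
  have par: "par y \<in> A \<and> {par y, y} \<in> G" if "y \<in> A' - A" for y
    unfolding par_def by (rule someI_ex) (use assms(2) that in \<open>auto simp: neighborhood_def\<close>)
  let ?f = "\<lambda>y. {par y, y}"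
  have inj: "inj_on ?f (A' - A)"
    by (rule inj_onI) (use par in \<open>auto simp: doubleton_eq_iff\<close>)
  have disj: "inner_edges G A \<inter> ?f ` (A' - A) = {}"
    by (auto simp: inner_edges_def)
  have fin: "finite (A' - A)"
    using assms(2) finite_subset finite_neighborhood by blast
  have "card (inner_edges G A) + card (A' - A) = card (inner_edges G A \<union> ?f ` (A' - A))"
    using disj inj fin by (simp add: card_Un_disjoint card_image)
  also have "\<dots> \<le> card (inner_edges G A')"
    by (rule card_mono) (use par assms in \<open>auto simp: inner_edges_def finite_G\<close>)
  finally show ?thesis .
qed

lemma inner_add_edge:
  assumes "A \<inter> B = {}" "x \<in> A" "y \<in> B" "{x, y} \<in> G"
  shows "card (inner_edges G A) + card (inner_edges G B) + 1 \<le> card (inner_edges G (A \<union> B))"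
proof -
  have "inner_edges G A \<inter> inner_edges G B = {}"
  proof -
    { fix e assume "e \<in> G" "e \<subseteq> A" "e \<subseteq> B"
      then have "e = {}" using assms by auto
      then have False using edge_card[OF \<open>e \<in> G\<close>] by simp }
    then show ?thesis by (auto simp: inner_edges_def)
  qed
  moreover have "{x, y} \<notin> inner_edges G A \<union> inner_edges G B"
    using assms by (auto simp: inner_edges_def)
  ultimately have "card (inner_edges G A) + card (inner_edges G B) + 1 =
      card (insert {x, y} (inner_edges G A \<union> inner_edges G B))"
    by (simp add: card_Un_disjoint)
  also have "\<dots> \<le> card (inner_edges G (A \<union> B))"
    by (rule card_mono) (use assms in \<open>auto simp: inner_edges_def finite_G\<close>)
  finally show ?thesis .
qed

end

section \<open>Disjoint trees hanging off one vertex\<close>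

context finite_graph begin

lemma finite_sub: "U \<subseteq> W \<Longrightarrow> finite U"
  using finite_W finite_subset by blast

text \<open>Each leg \<open>{v, u b}\<close> makes up for the one edge that its tree may lack, so
  only the defect of the single vertex \<open>v\<close> remains.\<close>

lemma spider_inner:
  assumes "finite B" "\<And>b. b \<in> B \<Longrightarrow> u b \<in> T b \<and> {v, u b} \<in> G \<and> T b \<subseteq> W \<and> v \<notin> T b \<and>
      card (T b) \<le> card (inner_edges G (T b)) + 1"
    and "\<And>b c. b \<in> B \<Longrightarrow> c \<in> B \<Longrightarrow> b \<noteq> c \<Longrightarrow> T b \<inter> T c = {}"
  shows "card (insert v (\<Union>b\<in>B. T b)) \<le> card (inner_edges G (insert v (\<Union>b\<in>B. T b))) + 1"
  using assms
proof (induction B rule: finite_induct)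
  case empty
  then show ?case by simp
next
  case (insert b B)
  let ?R = "insert v (\<Union>b\<in>B. T b)"
  have T: "u c \<in> T c" "{v, u c} \<in> G" "T c \<subseteq> W" "v \<notin> T c"
      "card (T c) \<le> card (inner_edges G (T c)) + 1" if "c \<in> insert b B" for c
    using insert.prems(1)[OF that] by simp_all
  have IH: "card ?R \<le> card (inner_edges G ?R) + 1"
    by (rule insert.IH) (use insert.prems in blast)+
  have "T c \<inter> T b = {}" if "c \<in> B" for c
    using insert.prems(2)[of c b] insert.hyps(2) that by blast
  then have disj: "?R \<inter> T b = {}" using T(4)[of b] by blast
  have fin: "finite ?R" "finite (T b)" using insert.hyps(1) T(3) finite_sub by simp_all
  have "card (inner_edges G ?R) + card (inner_edges G (T b)) + 1 \<le> card (inner_edges G (?R \<union> T b))"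
    by (rule inner_add_edge[OF disj, of v "u b"]) (use T[of b] in simp_all)
  moreover have "card (?R \<union> T b) = card ?R + card (T b)"
    using card_Un_disjoint[OF fin disj] .
  moreover have "card (T b) \<le> card (inner_edges G (T b)) + 1" using T(5)[of b] by simp
  moreover have "insert v (\<Union>b\<in>insert b B. T b) = ?R \<union> T b" by blast
  ultimately show ?case using IH by simp
qed

text \<open>
  A maximal family of disjoint trees hanging off \<open>v\<close> has all its trees of full size: otherwise
  every edge at a small tree stays inside the spider, which then has at least as many edges as
  vertices.
\<close>

lemma spider_exists:
  fixes A :: "'c set" and u :: "'c \<Rightarrow> 'v"
  assumes fin: "finite A" and vW: "v \<in> W" and inj: "inj_on u A"
    and nb: "\<And>a. a \<in> A \<Longrightarrow> {v, u a} \<in> G" and Q: "1 \<le> Q"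
    and dens: "\<And>U. U \<subseteq> W \<Longrightarrow> U \<noteq> {} \<Longrightarrow> 3 * card U < 2 * card (touching_edges G U)"
    and sparse: "\<And>U. U \<subseteq> W \<Longrightarrow> v \<in> U \<Longrightarrow> card U \<le> card A * Q + 1 \<Longrightarrow>
        card (inner_edges G U) < card U"
  obtains T where
    "\<And>a. a \<in> A \<Longrightarrow> u a \<in> T a \<and> T a \<subseteq> W \<and> v \<notin> T a \<and> card (T a) = Q \<and>
       Q \<le> card (inner_edges G (T a)) + 1"
    "\<And>a x. a \<in> A \<Longrightarrow> x \<in> T a \<Longrightarrow> linked G (T a) Q (u a) x"
    "\<And>a b. a \<in> A \<Longrightarrow> b \<in> A \<Longrightarrow> a \<noteq> b \<Longrightarrow> T a \<inter> T b = {}"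
proof -
  \<comment> \<open>The radius bound is the size of the tree itself: it grows by one with each added
    vertex and ends at \<open>Q\<close>.\<close>
  define P where "P T \<longleftrightarrow> (\<forall>a\<in>A. u a \<in> T a \<and> T a \<subseteq> W \<and> v \<notin> T a \<and> card (T a) \<le> Q \<and>
       card (T a) \<le> card (inner_edges G (T a)) + 1 \<and>
       (\<forall>x\<in>T a. linked G (T a) (card (T a)) (u a) x)) \<and>
       (\<forall>a\<in>A. \<forall>b\<in>A. a \<noteq> b \<longrightarrow> T a \<inter> T b = {})" for T
  define f where "f T = (\<Sum>a\<in>A. card (T a))" for T :: "'c \<Rightarrow> 'v set"
  have "P (\<lambda>a. {u a})"
    unfolding P_def using nb edge_ends inj Q by (auto simp: linked_refl inj_on_def)
  moreover have "\<forall>T. P T \<longrightarrow> f T < card A * Q + 1"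
  proof (intro allI impI)
    fix T assume "P T"
    then have "f T \<le> (\<Sum>a\<in>A. Q)" unfolding f_def P_def by (intro sum_mono) auto
    then show "f T < card A * Q + 1" by simp
  qed
  ultimately have "\<exists>T. P T \<and> (\<forall>T'. P T' \<longrightarrow> f T' \<le> f T)"
    by (rule ex_has_greatest_nat)
  then obtain T where T: "P T" and max: "\<And>T'. P T' \<Longrightarrow> f T' \<le> f T" by blast
  have Ta: "u a \<in> T a" "T a \<subseteq> W" "v \<notin> T a" "card (T a) \<le> Q"
       "card (T a) \<le> card (inner_edges G (T a)) + 1" 
       "\<And>x. x \<in> T a \<Longrightarrow> linked G (T a) (card (T a)) (u a) x"
     if "a \<in> A" for a using T that unfolding P_def by auto
  have disj: "T a \<inter> T b = {}" if "a \<in> A" "b \<in> A" "a \<noteq> b" for a b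
    using T that unfolding P_def by auto
  have full: "card (T a) = Q" if a: "a \<in> A" for a
  proof (rule ccontr)
    assume "card (T a) \<noteq> Q"
    then have less: "card (T a) < Q" using Ta[OF a] by auto
    let ?R = "insert v (\<Union>b\<in>A - {a}. T b)"
    have R: "card ?R \<le> card (inner_edges G ?R) + 1"
      by (rule spider_inner[where u = u]) (use Ta disj nb fin in auto)
    have disjR: "T a \<inter> ?R = {}" using disj a Ta(3)[OF a] by auto
    have finR: "finite ?R" "?R \<subseteq> W" "finite (T a)" using fin Ta finite_sub vW a by auto
    have "card (T a \<union> ?R) \<le> card A * Q + 1"
    proof -
      have "T a \<union> ?R = insert v (\<Union>b\<in>A. T b)" using a by auto
      also have "card \<dots> \<le> card (\<Union>b\<in>A. T b) + 1"
        by (metis Suc_eq_plus1 card_insert_le_m1 diff_Suc_1 le_SucI not_less_eq_eq order_refl zero_less_Suc)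
      also have "card (\<Union>b\<in>A. T b) \<le> (\<Sum>b\<in>A. card (T b))" by (rule card_UN_le[OF fin])
      also have "\<dots> \<le> (\<Sum>b\<in>A. Q)" using Ta by (intro sum_mono) auto
      finally show ?thesis by simp
    qed
    then have small: "card (inner_edges G (T a \<union> ?R)) < card (T a \<union> ?R)"
      using finR Ta(2)[OF a] by (intro sparse) auto
    have cardZ: "card (T a \<union> ?R) = card (T a) + card ?R"
      by (rule card_Un_disjoint[OF finR(3,1) disjR])
    have "card (T a) > 0" using Ta(1)[OF a] finR by (auto simp: card_gt_0_iff)
    moreover have "3 * card (T a) < 2 * card (touching_edges G (T a))"
      using Ta(1,2)[OF a] by (intro dens) auto
    ultimately have t: "card (T a) + 1 \<le> card (touching_edges G (T a))" by linarith
    \<comment> \<open>Otherwise at least \<open>card ?R - 1\<close> edges inside \<open>?R\<close>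
      and \<open>card (T a) + 1\<close> edges at \<open>T a\<close> would lie in the union, as many
      as it has vertices.\<close>
    have "\<not> (\<forall>e\<in>touching_edges G (T a). e \<subseteq> T a \<union> ?R)"
      using inner_Un_touching[OF disjR] small cardZ R t by fastforce
    then obtain e where e: "e \<in> G" "e \<inter> T a \<noteq> {}" "\<not> e \<subseteq> T a \<union> ?R"
      by (auto simp: touching_edges_def)
    then obtain x where x: "x \<in> e" "x \<in> T a" by auto
    obtain y where y: "e = {x, y}" "x \<noteq> y" using edge_obtain[OF e(1) x(1)] by auto
    have yZ: "y \<notin> T a \<union> ?R" using e y x by auto
    have yW: "y \<in> W" using e y edge_subset by auto
    let ?T' = "T(a := insert y (T a))"
    have "card (inner_edges G (T a)) + card (insert y (T a) - T a) \<le> card (inner_edges G (insert y (T a)))"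
      by (rule inner_grow) (use x y yZ e in \<open>auto simp: neighborhood_def\<close>)
    moreover have "insert y (T a) - T a = {y}" using yZ by auto
    ultimately have inn: "card (inner_edges G (T a)) + 1 \<le> card (inner_edges G (insert y (T a)))"
      by simp
    have cins: "card (insert y (T a)) = Suc (card (T a))" using yZ finR by simp
    have lnk: "linked G (insert y (T a)) (Suc (card (T a))) (u a) z" if "z \<in> insert y (T a)" for z
    proof (cases "z = y")
      case True
      have "linked G (insert y (T a)) (card (T a)) (u a) x"
        by (rule linked_mono[OF Ta(6)[OF a x(2)]]) auto
      then show ?thesis using linked_step[of G _ _ "u a" x y] True e y by auto
    next
      case False
      then have "z \<in> T a" using that by auto
      then show ?thesis by (rule linked_mono[OF Ta(6)[OF a]]) auto
    qed
    have "P ?T'"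
      unfolding P_def
    proof (intro conjI ballI impI)
      fix b assume b: "b \<in> A"
      show "u b \<in> ?T' b" "?T' b \<subseteq> W" "v \<notin> ?T' b" "card (?T' b) \<le> Q"
        "card (?T' b) \<le> card (inner_edges G (?T' b)) + 1"
        using Ta[OF b] yZ yW inn cins less a by auto
      fix z assume "z \<in> ?T' b"
      then show "linked G (?T' b) (card (?T' b)) (u b) z"
        using lnk Ta(6)[OF b] cins by (cases "b = a") auto
    next
      fix b c assume "b \<in> A" "c \<in> A" "b \<noteq> c"
      then show "?T' b \<inter> ?T' c = {}" using disj[of b c] yZ a by (auto split: if_splits)
    qed
    then have "f ?T' \<le> f T" using max by blast
    moreover have "f ?T' = f T + 1"
    proof -
      have "(\<Sum>b\<in>A. card (?T' b)) = card (?T' a) + (\<Sum>b\<in>A - {a}. card (?T' b))"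
        by (rule sum.remove[OF fin a])
      moreover have "(\<Sum>b\<in>A. card (T b)) = card (T a) + (\<Sum>b\<in>A - {a}. card (T b))"
        by (rule sum.remove[OF fin a])
      moreover have "(\<Sum>b\<in>A - {a}. card (?T' b)) = (\<Sum>b\<in>A - {a}. card (T b))"
        by (rule sum.cong) auto
      ultimately show ?thesis unfolding f_def using cins by simp
    qed
    ultimately show False by simp
  qed
  show thesis
  proof (rule that[of T])
    fix a assume a: "a \<in> A"
    show "u a \<in> T a \<and> T a \<subseteq> W \<and> v \<notin> T a \<and> card (T a) = Q \<and>
       Q \<le> card (inner_edges G (T a)) + 1"
      using Ta[OF a] full[OF a] by auto
    show "linked G (T a) Q (u a) x" if "x \<in> T a" for x
      using Ta(6)[OF a that] full[OF a] by simp
  qed (use disj in auto)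
qed

end

section \<open>Simultaneous growth of disjoint trees\<close>

primrec grown_size :: "nat \<Rightarrow> nat \<Rightarrow> nat" where
  "grown_size Q 0 = Q"
| "grown_size Q (Suc t) = grown_size Q t + grown_size Q t div 8"

lemma grown_size_mono: "t \<le> t' \<Longrightarrow> grown_size Q t \<le> grown_size Q t'"
  by (induction t' rule: dec_induct) auto

context finite_graph begin

text \<open>Here \<open>R\<close> is a region to be avoided that lacks at most \<open>k\<close>
  edges for having as many edges as vertices. With fewer than \<open>a\<close> neighbours of
  \<open>T\<close> outside \<open>R\<close>, the more than \<open>3 / 2 * card T\<close> edges at
  \<open>T\<close> and the edges inside \<open>R\<close> would lie in one small set; sparsity then
  leaves no room for the surplus \<open>card T / 2\<close>.\<close>

lemma many_outside_neighbors:
  fixes \<eta> :: real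
  assumes T: "T \<subseteq> W" "T \<noteq> {}" and R: "R \<subseteq> W" "T \<inter> R = {}"
    and k: "card R \<le> card (inner_edges G R) + k"
    and dens: "3 * card T < 2 * card (touching_edges G T)"
    and sparse: "\<And>U. U \<subseteq> W \<Longrightarrow> card U \<le> M \<Longrightarrow> card (inner_edges G U) \<le> (1 + \<eta>) * card U"
    and M: "card R + card T + a \<le> M" and \<eta>: "0 \<le> \<eta>"
    and small: "real k + real a + \<eta> * (real (card R) + real (card T) + real a) \<le> real (card T) / 2"
  shows "a \<le> card (neighborhood G T - R)"
proof (rule ccontr)
  let ?X = "neighborhood G T - R"
  assume "\<not> a \<le> card ?X"
  then have X: "card ?X < a" by simp
  have XT: "T \<inter> (R \<union> ?X) = {}" using R by (auto simp: neighborhood_def)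
  have fin: "finite T" "finite R" "finite ?X" using T R finite_sub by auto
  have "e \<subseteq> T \<union> (R \<union> ?X)" if e: "e \<in> touching_edges G T" for e
  proof -
    obtain x where x: "x \<in> e" "x \<in> T" using e by (auto simp: touching_edges_def)
    moreover have "e \<in> G" using e by (auto simp: touching_edges_def)
    moreover obtain y where "e = {x, y}" using edge_obtain[of e x] x \<open>e \<in> G\<close> by auto
    ultimately show ?thesis by (auto simp: neighborhood_def)
  qed
  then have "card (inner_edges G (R \<union> ?X)) + card (touching_edges G T) \<le>
      card (inner_edges G (T \<union> (R \<union> ?X)))"
    by (intro inner_Un_touching XT) auto
  moreover have "card (inner_edges G R) \<le> card (inner_edges G (R \<union> ?X))"
    by (rule inner_mono) auto
  ultimately have 1: "card R + card (touching_edges G T) \<le> card (inner_edges G (T \<union> (R \<union> ?X))) + k"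
    using k by linarith
  have "card (T \<union> (R \<union> ?X)) = card T + card (R \<union> ?X)"
    using XT fin by (intro card_Un_disjoint) auto
  also have "card (R \<union> ?X) = card R + card ?X"
    using fin by (intro card_Un_disjoint) auto
  finally have cZ: "card (T \<union> (R \<union> ?X)) = card R + card T + card ?X" by simp
  have "real (card (inner_edges G (T \<union> (R \<union> ?X)))) \<le> (1 + \<eta>) * card (T \<union> (R \<union> ?X))"
    using cZ M X T R neighborhood_subset by (intro sparse) auto
  also have "\<dots> = card R + card T + card ?X + \<eta> * (card R + card T + card ?X)"
    unfolding cZ by (simp add: algebra_simps)
  also have "\<dots> \<le> card R + card T + a + \<eta> * (card R + card T + a)"
    using X \<eta> by (intro add_mono mult_left_mono) auto
  finally have "real (card R + card (touching_edges G T)) \<le>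
      card R + card T + a + \<eta> * (card R + card T + a) + k"
    using 1 by linarith
  then have "real (card (touching_edges G T)) \<le> 3 / 2 * card T"
    using small by (simp add: algebra_simps)
  moreover have "real (3 * card T) < real (2 * card (touching_edges G T))"
    using dens by (simp only: of_nat_less_iff)
  ultimately show False by simp
qed

text \<open>Two substitutes for being a tree are kept side by side: the edge count feeds the
  sparsity arguments, while \<open>linked\<close> gives the walks from the root \<open>u i\<close>
  that the routing needs. \<open>V0\<close> will be the set of branch vertices.\<close>

definition tree_family :: "'c set \<Rightarrow> 'v set \<Rightarrow> nat \<Rightarrow> nat \<Rightarrow> ('c \<Rightarrow> 'v) \<Rightarrow> ('c \<Rightarrow> 'v set) \<Rightarrow> bool" where
  "tree_family I V0 s r u T \<longleftrightarrow>
     (\<forall>i\<in>I. T i \<subseteq> W \<and> T i \<inter> V0 = {} \<and> card (T i) = s \<and> s \<le> card (inner_edges G (T i)) + 1 \<and>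
        (\<forall>x\<in>T i. linked G (T i) r (u i) x)) \<and>
     (\<forall>i\<in>I. \<forall>j\<in>I. i \<noteq> j \<longrightarrow> T i \<inter> T j = {})"

text \<open>Each tree lacks at most one edge and each vertex of \<open>V0\<close> counts as one more
  missing edge. This is the defect \<open>k\<close> in
  \<open>many_outside_neighbors\<close>.\<close>

lemma forest_inner:
  assumes "finite I" "V0 \<subseteq> W"
    and T: "\<And>i. i \<in> I \<Longrightarrow> T i \<subseteq> W \<and> T i \<inter> V0 = {} \<and> card (T i) \<le> card (inner_edges G (T i)) + 1"
    and disj: "\<And>i j. i \<in> I \<Longrightarrow> j \<in> I \<Longrightarrow> i \<noteq> j \<Longrightarrow> T i \<inter> T j = {}"
  shows "card (V0 \<union> (\<Union>i\<in>I. T i)) \<le> card (inner_edges G (V0 \<union> (\<Union>i\<in>I. T i))) + (card V0 + card I)"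
proof -
  have "card (V0 \<union> (\<Union>i\<in>I. T i)) \<le> card V0 + card (\<Union>i\<in>I. T i)" by (rule card_Un_le)
  also have "card (\<Union>i\<in>I. T i) \<le> (\<Sum>i\<in>I. card (T i))" by (rule card_UN_le[OF assms(1)])
  also have "\<dots> \<le> (\<Sum>i\<in>I. card (inner_edges G (T i)) + 1)"
    by (rule sum_mono) (use T in blast)
  also have "\<dots> = (\<Sum>i\<in>I. card (inner_edges G (T i))) + card I"
    by (subst sum.distrib) simp
  also have "(\<Sum>i\<in>I. card (inner_edges G (T i))) \<le> card (inner_edges G (\<Union>i\<in>I. T i))"
    by (rule inner_UN_disjoint[OF assms(1) disj])
  also have "\<dots> \<le> card (inner_edges G (V0 \<union> (\<Union>i\<in>I. T i)))" by (rule inner_mono) auto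
  finally show ?thesis by simp
qed

text \<open>The trees are enlarged one at a time, each by an eighth of its size, with the current
  state of all other trees as the region to avoid. All trees of a stage have exactly the same size,
  so none can starve another.\<close>

lemma grow_family_once:
  fixes \<eta> :: real
  assumes fin: "finite I" and V0: "V0 \<subseteq> W" and fam: "tree_family I V0 s r u T"
    and dens: "\<And>U. U \<subseteq> W \<Longrightarrow> U \<noteq> {} \<Longrightarrow> 3 * card U < 2 * card (touching_edges G U)"
    and sparse: "\<And>U. U \<subseteq> W \<Longrightarrow> card U \<le> M \<Longrightarrow> card (inner_edges G U) \<le> (1 + \<eta>) * card U"
    and \<eta>: "0 \<le> \<eta>" "20 * \<eta> * card I \<le> 1"
    and s: "20 * (card V0 + card I) \<le> s" "1 \<le> s" and M: "2 * card I * s \<le> M"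
  shows "\<exists>T'. tree_family I V0 (s + s div 8) (Suc r) u T' \<and> (\<forall>i\<in>I. T i \<subseteq> T' i)"
proof -
  let ?s' = "s + s div 8"
  have T: "T i \<subseteq> W" "T i \<inter> V0 = {}" "card (T i) = s" "s \<le> card (inner_edges G (T i)) + 1"
     "\<And>x. x \<in> T i \<Longrightarrow> linked G (T i) r (u i) x" if "i \<in> I" for i
    using fam that unfolding tree_family_def by auto
  have Tdisj: "T i \<inter> T j = {}" if "i \<in> I" "j \<in> I" "i \<noteq> j" for i j
    using fam that unfolding tree_family_def by auto
  \<comment> \<open>The trees in \<open>J\<close> are already enlarged, the others are unchanged.
    New vertices are neighbours of the old tree, so the radius grows by only one per stage.\<close>
  define P where "P J T' \<longleftrightarrow> (\<forall>i\<in>J. card (T' i) = ?s') \<and> (\<forall>i\<in>I - J. T' i = T i) \<and>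
      (\<forall>i\<in>I. T i \<subseteq> T' i \<and> T' i \<subseteq> T i \<union> neighborhood G (T i) \<and> T' i \<inter> V0 = {}) \<and>
      (\<forall>i\<in>I. \<forall>j\<in>I. i \<noteq> j \<longrightarrow> T' i \<inter> T' j = {})" for J T'
  have "\<exists>T'. P J T'" if "finite J" "J \<subseteq> I" for J
    using that
  proof (induction J rule: finite_induct)
    case empty
    show ?case by (rule exI[of _ T]) (use T Tdisj in \<open>auto simp: P_def\<close>)
  next
    case (insert i J)
    then obtain T' where "P J T'" by auto
    then have T': "\<And>j. j \<in> J \<Longrightarrow> card (T' j) = ?s'" "\<And>j. j \<in> I - J \<Longrightarrow> T' j = T j"
      "\<And>j. j \<in> I \<Longrightarrow> T j \<subseteq> T' j" "\<And>j. j \<in> I \<Longrightarrow> T' j \<subseteq> T j \<union> neighborhood G (T j)"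
      "\<And>j. j \<in> I \<Longrightarrow> T' j \<inter> V0 = {}" 
      "\<And>j k. j \<in> I \<Longrightarrow> k \<in> I \<Longrightarrow> j \<noteq> k \<Longrightarrow> T' j \<inter> T' k = {}"
      by (simp_all add: P_def)
    have i: "i \<in> I" "T' i = T i" using insert T'(2) by auto
    have T'W: "T' j \<subseteq> W" if "j \<in> I" for j
      using T(1)[OF that] T'(4)[OF that] neighborhood_subset by blast
    have tree: "card (T' j) \<le> card (inner_edges G (T' j)) + 1" if j: "j \<in> I" for j
    proof -
      have "card (inner_edges G (T j)) + card (T' j - T j) \<le> card (inner_edges G (T' j))"
        using T'(3,4)[OF j] by (intro inner_grow) auto
      moreover have "card (T' j) = card (T j) + card (T' j - T j)"
        using T'(3)[OF j] T'W[OF j] finite_sub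
        by (metis card_Diff_subset card_mono finite_subset le_add_diff_inverse)
      ultimately show ?thesis using T(3,4)[OF j] by linarith
    qed
    let ?R = "V0 \<union> (\<Union>j\<in>I - {i}. T' j)"
    have "card ?R \<le> card (inner_edges G ?R) + (card V0 + card (I - {i}))"
      by (rule forest_inner) (use fin V0 T'W T'(5,6) tree in auto)
    then have R1: "card ?R \<le> card (inner_edges G ?R) + (card V0 + card I)"
      using card_mono[OF fin, of "I - {i}"] by fastforce
    have le: "card (T' j) \<le> ?s'" if "j \<in> I" for j
      using T'(1,2)[of j] T(3)[OF that] that by (cases "j \<in> J") auto
    have "card ?R \<le> card V0 + card (\<Union>j\<in>I - {i}. T' j)" by (rule card_Un_le)
    also have "card (\<Union>j\<in>I - {i}. T' j) \<le> (\<Sum>j\<in>I - {i}. card (T' j))"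
      by (rule card_UN_le) (use fin in auto)
    also have "\<dots> \<le> (\<Sum>j\<in>I - {i}. ?s')" by (rule sum_mono) (use le in auto)
    finally have "card ?R \<le> card V0 + card (I - {i}) * ?s'" by simp
    moreover have "card I = Suc (card (I - {i}))" using fin i by (metis card_Suc_Diff1)
    ultimately have Rs: "card ?R + ?s' \<le> card V0 + card I * ?s'" by simp
    have "8 * (card I * ?s') \<le> 9 * (card I * s)"
      using mult_left_mono[of "8 * ?s'" "9 * s" "card I"] by (simp add: mult.left_commute)
    moreover have "s \<le> card I * s" using \<open>card I = Suc _\<close> by simp
    moreover have "x + s + d \<le> 2 * p"
      if "8 * p' \<le> 9 * p" "s \<le> p" "x + (s + d) \<le> card V0 + p'" for x p p' d :: nat
    proof -
      have "20 * card V0 \<le> s" using s(1) by simp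
      with that show ?thesis by linarith
    qed
    ultimately have "card ?R + s + s div 8 \<le> 2 * (card I * s)"
      using Rs by blast
    then have total: "card ?R + s + s div 8 \<le> 2 * card I * s" by (simp only: mult.assoc)
    have "s div 8 \<le> card (neighborhood G (T i) - ?R)"
    proof (rule many_outside_neighbors[where M = M and \<eta> = \<eta> and k = "card V0 + card I"])
      show "T i \<subseteq> W" "T i \<noteq> {}" using T[OF i(1)] s by auto
      then show "3 * card (T i) < 2 * card (touching_edges G (T i))" by (rule dens)
      show "?R \<subseteq> W" using V0 T'W by auto
      show "T i \<inter> ?R = {}" using T'(5,6) i by fastforce
      show "card ?R + card (T i) + s div 8 \<le> M" using total M T(3)[OF i(1)] by linarith
      have "real (card ?R + card (T i) + s div 8) \<le> real (2 * card I * s)"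
        using total T(3)[OF i(1)] by (simp only: of_nat_le_iff)
      then have "real (card ?R) + real (card (T i)) + real (s div 8) \<le> 2 * real (card I) * real s"
        by simp
      then have "\<eta> * (real (card ?R) + real (card (T i)) + real (s div 8)) \<le>
          \<eta> * (2 * real (card I) * real s)"
        by (rule mult_left_mono) (rule \<eta>)
      also have "\<dots> = 20 * \<eta> * real (card I) * (real s / 10)" by simp
      also have "\<dots> \<le> 1 * (real s / 10)" by (rule mult_right_mono[OF \<eta>(2)]) simp
      finally have "\<eta> * (real (card ?R) + real (card (T i)) + real (s div 8)) \<le> real s / 10" by simp
      moreover have "real (s div 8) \<le> s / 8" by linarith
      moreover have "real (card V0 + card I) \<le> real s / 20"
        using of_nat_mono[OF s(1), where 'a = real] by simp
      \<comment> \<open>The losses are \<open>s / 20\<close> for the defect, \<open>s / 8\<close>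
        for the new vertices and \<open>s / 10\<close> for the \<open>\<eta>\<close> term, together
        below the available \<open>s / 2\<close>.\<close>
      ultimately show "real (card V0 + card I) + real (s div 8) +
          \<eta> * (real (card ?R) + real (card (T i)) + real (s div 8)) \<le> real (card (T i)) / 2"
        unfolding T(3)[OF i(1)] by linarith
    qed (use R1 sparse \<eta> in auto)
    then obtain X where X: "X \<subseteq> neighborhood G (T i) - ?R" "card X = s div 8"
      by (meson obtain_subset_with_card_n)
    let ?T' = "T'(i := T i \<union> X)"
    show ?case
      unfolding P_def
    proof (rule exI[of _ ?T'], intro conjI ballI impI)
      fix j assume "j \<in> insert i J"
      have "card (T i \<union> X) = ?s'"
        using X T[OF i(1)] finite_sub neighborhood_subset
        by (subst card_Un_disjoint) (auto simp: neighborhood_def intro: finite_subset)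
      then show "card (?T' j) = ?s'" using \<open>j \<in> insert i J\<close> T'(1) by auto
    next
      fix j assume "j \<in> I - insert i J"
      then show "?T' j = T j" using T'(2) by auto
    next
      fix j assume j: "j \<in> I"
      show "T j \<subseteq> ?T' j" "?T' j \<subseteq> T j \<union> neighborhood G (T j)" "?T' j \<inter> V0 = {}"
        using T'(3-5)[OF j] X T(2)[OF i(1)] by auto
    next
      fix j k assume jk: "j \<in> I" "k \<in> I" "j \<noteq> k"
      have "X \<inter> T' l = {}" if "l \<in> I" "l \<noteq> i" for l using X that by auto
      then show "?T' j \<inter> ?T' k = {}" using T'(6)[OF jk] T'(6)[of i] i jk by auto
    qed
  qed
  from this[OF fin order_refl] obtain T' where "P I T'" by blast
  then have T': "\<And>i. i \<in> I \<Longrightarrow> card (T' i) = ?s'" "\<And>i. i \<in> I \<Longrightarrow> T i \<subseteq> T' i"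
      "\<And>i. i \<in> I \<Longrightarrow> T' i \<subseteq> T i \<union> neighborhood G (T i)" "\<And>i. i \<in> I \<Longrightarrow> T' i \<inter> V0 = {}"
      "\<And>i j. i \<in> I \<Longrightarrow> j \<in> I \<Longrightarrow> i \<noteq> j \<Longrightarrow> T' i \<inter> T' j = {}"
    by (simp_all add: P_def)
  have "tree_family I V0 ?s' (Suc r) u T'"
    unfolding tree_family_def
  proof (intro conjI ballI impI)
    fix i assume i: "i \<in> I"
    show W': "T' i \<subseteq> W" using T(1)[OF i] T'(3)[OF i] neighborhood_subset by blast
    show "T' i \<inter> V0 = {}" "card (T' i) = ?s'" using T' i by auto
    have "card (inner_edges G (T i)) + card (T' i - T i) \<le> card (inner_edges G (T' i))"
      using T'(2,3)[OF i] by (intro inner_grow) auto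
    moreover have "card (T' i - T i) = s div 8"
      using T'(1,2)[OF i] T(1,3)[OF i] finite_sub by (simp add: card_Diff_subset)
    ultimately show "?s' \<le> card (inner_edges G (T' i)) + 1" using T(4)[OF i] by linarith
    fix x assume x: "x \<in> T' i"
    show "linked G (T' i) (Suc r) (u i) x"
    proof (cases "x \<in> T i")
      case True
      show ?thesis by (rule linked_mono[OF T(5)[OF i True]]) (use T'(2)[OF i] in auto)
    next
      case False
      then obtain y where y: "y \<in> T i" "{y, x} \<in> G"
        using x T'(3)[OF i] by (auto simp: neighborhood_def)
      have "linked G (T' i) r (u i) y"
        by (rule linked_mono[OF T(5)[OF i y(1)]]) (use T'(2)[OF i] in auto)
      then show ?thesis using y x by (intro linked_step) auto
    qed
  qed (use T'(5) in auto)
  then show ?thesis using T'(2) by auto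
qed

text \<open>All stages are kept and nested, because the routing uses the same trees at several
  sizes.\<close>

lemma grow_family:
  fixes \<eta> :: real
  assumes fin: "finite I" and V0: "V0 \<subseteq> W" and fam: "tree_family I V0 Q r u T"
    and dens: "\<And>U. U \<subseteq> W \<Longrightarrow> U \<noteq> {} \<Longrightarrow> 3 * card U < 2 * card (touching_edges G U)"
    and sparse: "\<And>U. U \<subseteq> W \<Longrightarrow> card U \<le> M \<Longrightarrow> card (inner_edges G U) \<le> (1 + \<eta>) * card U"
    and \<eta>: "0 \<le> \<eta>" "20 * \<eta> * card I \<le> 1"
    and Q: "20 * (card V0 + card I) \<le> Q" "1 \<le> Q" and M: "2 * card I * grown_size Q N \<le> M"
  shows "\<exists>TT. (\<forall>t\<le>N. tree_family I V0 (grown_size Q t) (r + t) u (TT t)) \<and>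
     (\<forall>i\<in>I. \<forall>t t'. t \<le> t' \<longrightarrow> t' \<le> N \<longrightarrow> TT t i \<subseteq> TT t' i)"
  using M
proof (induction N)
  case 0
  show ?case by (rule exI[of _ "\<lambda>_. T"]) (use fam in auto)
next
  case (Suc N)
  have "2 * card I * grown_size Q N \<le> 2 * card I * grown_size Q (Suc N)" by simp
  then have M: "2 * card I * grown_size Q N \<le> M" using Suc.prems by (rule order_trans)
  then obtain TT where TT: "\<And>t. t \<le> N \<Longrightarrow> tree_family I V0 (grown_size Q t) (r + t) u (TT t)"
      "\<And>i t t'. i \<in> I \<Longrightarrow> t \<le> t' \<Longrightarrow> t' \<le> N \<Longrightarrow> TT t i \<subseteq> TT t' i"
    using Suc.IH by blast
  have Qs: "Q \<le> grown_size Q N" using grown_size_mono[of 0 N Q] by simp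
  have "\<exists>T'. tree_family I V0 (grown_size Q N + grown_size Q N div 8) (Suc (r + N)) u T' \<and>
      (\<forall>i\<in>I. TT N i \<subseteq> T' i)"
    by (rule grow_family_once[OF fin V0 TT(1)[OF order_refl] dens sparse \<eta> _ _ M])
      (use Q Qs in auto)
  then obtain T' where T': "tree_family I V0 (grown_size Q (Suc N)) (r + Suc N) u T'"
      "\<And>i. i \<in> I \<Longrightarrow> TT N i \<subseteq> T' i" by auto
  let ?TT = "TT(Suc N := T')"
  have "?TT t i \<subseteq> ?TT t' i" if "i \<in> I" "t \<le> t'" "t' \<le> Suc N" for i t t'
  proof (cases "t' = Suc N")
    case True
    then show ?thesis using TT(2)[of i t N] T'(2)[of i] that by (cases "t = Suc N") auto
  next
    case False
    then show ?thesis using TT(2)[of i t t'] that by auto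
  qed
  moreover have "tree_family I V0 (grown_size Q t) (r + t) u (?TT t)" if "t \<le> Suc N" for t
    using TT(1)[of t] T'(1) that by (cases "t = Suc N") auto
  ultimately show ?case by blast
qed

end

section \<open>Short connections and routing\<close>

context finite_graph begin

text \<open>While the ball has at most half of \<open>W\<close>, expansion yields at least
  \<open>\<gamma> * a\<close> new neighbours, of which \<open>F\<close> blocks at most half.
  Additive growth suffices, since \<open>a\<close> will be linear in \<open>n\<close>.\<close>

lemma ball_growth:
  fixes \<gamma> a :: real
  assumes expand: "\<And>U. U \<subseteq> W \<Longrightarrow> U \<noteq> {} \<Longrightarrow> 2 * card U \<le> card W \<Longrightarrow>
        \<gamma> * card U \<le> card (neighborhood G U)"
    and A: "A \<subseteq> W - F" "A \<noteq> {}" "a \<le> card A" and F: "finite F" "card F \<le> \<gamma> * a / 2" and \<gamma>: "0 < \<gamma>"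
  shows "card W < 2 * card {y. \<exists>x\<in>A. linked G (W - F) (Suc t) x y} \<or>
     a + t * (\<gamma> * a / 2) \<le> card {y. \<exists>x\<in>A. linked G (W - F) (Suc t) x y}"
proof (induction t)
  case 0
  have "A \<subseteq> {y. \<exists>x\<in>A. linked G (W - F) (Suc 0) x y}"
    using A linked_refl[of _ "W - F" 1 G] by auto
  moreover have "finite {y. \<exists>x\<in>A. linked G (W - F) (Suc 0) x y}"
    by (rule finite_subset[OF _ finite_W]) (auto dest: linked_endpoints)
  ultimately have "card A \<le> card {y. \<exists>x\<in>A. linked G (W - F) (Suc 0) x y}" by (rule card_mono[rotated])
  then show ?case using A(3) by simp
next
  case (Suc t)
  define R where "R t = {y. \<exists>x\<in>A. linked G (W - F) (Suc t) x y}" for t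
  have RW: "R t \<subseteq> W" for t unfolding R_def by (auto dest: linked_endpoints)
  have fin: "finite (R t)" for t using finite_sub RW .
  have sub: "R t \<subseteq> R (Suc t)" unfolding R_def
    using linked_Suc by fast
  have sub2: "neighborhood G (R t) - F \<subseteq> R (Suc t)"
  proof
    fix z assume z: "z \<in> neighborhood G (R t) - F"
    then obtain y where y: "y \<in> R t" "{y, z} \<in> G" by (auto simp: neighborhood_def)
    moreover have "z \<in> W - F" using z neighborhood_subset by auto
    ultimately show "z \<in> R (Suc t)" unfolding R_def using linked_step by fast
  qed
  have AR: "A \<subseteq> R t" unfolding R_def
    using A linked_refl[of _ "W - F" "Suc t" G] by auto
  show ?case
  proof (cases "card W < 2 * card (R t)")
    case True
    then show ?thesis using card_mono[OF fin sub] unfolding R_def by linarith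
  next
    case False
    then have IH: "a + t * (\<gamma> * a / 2) \<le> card (R t)" using Suc unfolding R_def by auto
    have "card A \<le> card (R t)" by (rule card_mono[OF fin AR])
    then have aR: "a \<le> card (R t)" using A(3) by linarith
    have "R t \<noteq> {}" using AR A(2) by auto
    then have "\<gamma> * card (R t) \<le> card (neighborhood G (R t))"
      using expand[OF RW] False by simp
    moreover have "\<gamma> * a \<le> \<gamma> * card (R t)" using aR \<gamma> by simp
    moreover have "card (neighborhood G (R t)) - card F \<le> card (neighborhood G (R t) - F)"
      by (rule diff_card_le_card_Diff[OF F(1)])
    ultimately have "\<gamma> * a / 2 \<le> card (neighborhood G (R t) - F)" using F(2) by linarith
    moreover have "card (R t) + card (neighborhood G (R t) - F) =
        card (R t \<union> (neighborhood G (R t) - F))"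
      by (intro card_Un_disjoint[symmetric] fin finite_Diff finite_neighborhood)
        (auto simp: neighborhood_def)
    moreover have "\<dots> \<le> card (R (Suc t))"
      by (rule card_mono[OF fin]) (use sub sub2 in auto)
    ultimately have "a + t * (\<gamma> * a / 2) + \<gamma> * a / 2 \<le> card (R (Suc t))" using IH by linarith
    then have "a + real (Suc t) * (\<gamma> * a / 2) \<le> card (R (Suc t))" by (simp add: algebra_simps add_divide_distrib)
    then show ?thesis unfolding R_def by blast
  qed
qed

text \<open>Both balls come to contain more than half of \<open>W\<close>, so they meet. The bound
  \<open>2 * K + 2\<close> counts two walks of \<open>K + 1\<close> vertices each.\<close>

lemma short_link:
  fixes \<gamma> a :: real
  assumes expand: "\<And>U. U \<subseteq> W \<Longrightarrow> U \<noteq> {} \<Longrightarrow> 2 * card U \<le> card W \<Longrightarrow>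
        \<gamma> * card U \<le> card (neighborhood G U)"
    and A: "A \<subseteq> W - F" "a \<le> card A" and B: "B \<subseteq> W - F" "a \<le> card B"
    and F: "finite F" "card F \<le> \<gamma> * a / 2" and \<gamma>: "0 < \<gamma>" and a: "0 < a"
    and K: "card W \<le> \<gamma> * a * real K"
  shows "\<exists>x\<in>A. \<exists>y\<in>B. linked G (W - F) (2 * K + 2) x y"
proof -
  define R where "R A = {y. \<exists>x\<in>A. linked G (W - F) (Suc K) x y}" for A
  have RW: "R A \<subseteq> W" for A unfolding R_def by (auto dest: linked_endpoints)
  have big: "card W < 2 * card (R A)" if sA: "A \<subseteq> W - F" "a \<le> card A" for A
  proof -
    have "A \<noteq> {}" using sA a by auto
    then consider "card W < 2 * card (R A)" | "a + K * (\<gamma> * a / 2) \<le> card (R A)"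
      using ball_growth[OF expand sA(1) _ sA(2) F \<gamma>, of K] unfolding R_def by blast
    then show ?thesis
    proof cases
      case 2
      have "K * (\<gamma> * a / 2) = \<gamma> * a * real K / 2" by simp
      then have "real (card W) < 2 * real (card (R A))" using 2 K a by linarith
      then show ?thesis by linarith
    qed
  qed
  have "R A \<inter> R B \<noteq> {}"
  proof
    assume "R A \<inter> R B = {}"
    then have "card (R A) + card (R B) = card (R A \<union> R B)"
      using RW finite_sub by (metis card_Un_disjoint)
    also have "\<dots> \<le> card W" by (rule card_mono[OF finite_W]) (use RW in auto)
    finally show False using big[OF A] big[OF B] by linarith
  qed
  then obtain x y z where "x \<in> A" "y \<in> B" "linked G (W - F) (Suc K) x z" "linked G (W - F) (Suc K) y z"
    unfolding R_def by auto
  then have "x \<in> A" "y \<in> B" "linked G (W - F) (Suc K + Suc K) x y"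
    using linked_trans linked_sym by metis+
  then show ?thesis by (auto simp: mult_2)
qed

text \<open>
  The connections are routed one after the other. The \<open>k\<close>-th one starts from the trees of
  stage \<open>k\<close> and has to avoid the trees of stage \<open>k + 1\<close>, which are much smaller, so that expansion
  is not destroyed by the forbidden set.
\<close>

lemma route_all:
  fixes \<gamma> :: real and a c :: "nat \<Rightarrow> real" and S :: "nat \<Rightarrow> 'i \<Rightarrow> 'v set"
  assumes expand: "\<And>U. U \<subseteq> W \<Longrightarrow> U \<noteq> {} \<Longrightarrow> 2 * card U \<le> card W \<Longrightarrow>
        \<gamma> * card U \<le> card (neighborhood G U)"
    and \<gamma>: "0 < \<gamma>" and fin: "finite I" and V0: "V0 \<subseteq> W"
    and S: "\<And>k i. k \<le> m \<Longrightarrow> i \<in> I \<Longrightarrow> S k i \<subseteq> W - V0 \<and> a k \<le> card (S k i) \<and> card (S k i) \<le> c k"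
    and link: "\<And>k i x. k \<le> m \<Longrightarrow> i \<in> I \<Longrightarrow> x \<in> S k i \<Longrightarrow> linked G (S k i) r (u i) x"
    and disj: "\<And>k i j. k \<le> m \<Longrightarrow> i \<in> I \<Longrightarrow> j \<in> I \<Longrightarrow> i \<noteq> j \<Longrightarrow> S k i \<inter> S k j = {}"
    and anti: "\<And>j k i. j \<le> k \<Longrightarrow> k \<le> m \<Longrightarrow> i \<in> I \<Longrightarrow> S k i \<subseteq> S j i"
    and slots: "\<And>k. k < m \<Longrightarrow> src k \<in> I \<and> dst k \<in> I"
      "\<And>j k. j < m \<Longrightarrow> k < m \<Longrightarrow> src j \<noteq> dst k"
      "\<And>j k. j < m \<Longrightarrow> k < m \<Longrightarrow> j \<noteq> k \<Longrightarrow> src j \<noteq> src k \<and> dst j \<noteq> dst k"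
    and a: "\<And>k. k < m \<Longrightarrow> 0 < a k"
    and K: "\<And>k. k < m \<Longrightarrow> card W \<le> \<gamma> * a k * real K"
    and size: "\<And>k. k < m \<Longrightarrow>
        card V0 + real m * real (2 * r + 2 * K + 2) + real (card I) * c (Suc k) \<le> \<gamma> * a k / 2"
  shows "\<exists>P. (\<forall>k<m. P k \<noteq> [] \<and> hd (P k) = u (src k) \<and> last (P k) = u (dst k) \<and> walk G (P k) \<and>
       distinct (P k) \<and> set (P k) \<subseteq> W - V0) \<and>
     (\<forall>j<m. \<forall>k<m. j \<noteq> k \<longrightarrow> set (P j) \<inter> set (P k) = {})"
proof -
  let ?L = "2 * r + 2 * K + 2"
  \<comment> \<open>The last clause keeps the induction going: every later connection starts from
    other trees, at a stage contained in stage \<open>Suc k\<close>, and so finds them untouched by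
    this path.\<close>
  define good where "good k p \<longleftrightarrow> p \<noteq> [] \<and> hd p = u (src k) \<and> last p = u (dst k) \<and> walk G p \<and>
       distinct p \<and> set p \<subseteq> W - V0 \<and> length p \<le> ?L \<and>
       (\<forall>i\<in>I. i \<noteq> src k \<longrightarrow> i \<noteq> dst k \<longrightarrow> set p \<inter> S (Suc k) i = {})" for k p
  have "\<exists>P. (\<forall>k<n. good k (P k)) \<and> (\<forall>j<n. \<forall>k<n. j \<noteq> k \<longrightarrow> set (P j) \<inter> set (P k) = {})"
    if "n \<le> m" for n
    using that
  proof (induction n)
    case 0
    show ?case by simp
  next
    case (Suc n)
    then have "\<exists>P. (\<forall>k<n. good k (P k)) \<and> (\<forall>j<n. \<forall>k<n. j \<noteq> k \<longrightarrow> set (P j) \<inter> set (P k) = {})"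
      by simp
    then obtain P where "(\<forall>k<n. good k (P k)) \<and>
        (\<forall>j<n. \<forall>k<n. j \<noteq> k \<longrightarrow> set (P j) \<inter> set (P k) = {})" ..
    then have P: "\<And>k. k < n \<Longrightarrow> good k (P k)"
      "\<And>j k. j < n \<Longrightarrow> k < n \<Longrightarrow> j \<noteq> k \<Longrightarrow> set (P j) \<inter> set (P k) = {}" by simp_all
    have n: "n < m" using Suc by simp
    let ?I' = "I - {src n, dst n}"
    \<comment> \<open>Forbidden are the branch vertices, the earlier paths, and the trees of all
      other arcs at the next, much smaller stage.\<close>
    let ?F = "V0 \<union> ((\<Union>j<n. set (P j)) \<union> (\<Union>i\<in>?I'. S (Suc n) i))"
    have SfinW: "finite (S k i)" if "k \<le> m" "i \<in> I" for k i
      using S[OF that] finite_sub by blast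
    have finF: "finite ?F"
      using V0 finite_sub fin SfinW Suc.prems by auto
    have avoid: "S n i \<subseteq> W - ?F" if i: "i = src n \<or> i = dst n" for i
    proof -
      have iI: "i \<in> I" using i slots(1)[OF n] by auto
      have "S n i \<inter> set (P j) = {}" if j: "j < n" for j
      proof -
        have jm: "j < m" and jn: "j \<noteq> n" using j n by auto
        have "i \<noteq> src j" "i \<noteq> dst j"
          using i slots(2)[OF n jm] slots(2)[OF jm n] slots(3)[OF jm n jn] by auto
        then have "set (P j) \<inter> S (Suc j) i = {}" using P(1)[OF j] iI unfolding good_def by blast
        moreover have "S n i \<subseteq> S (Suc j) i" using anti[of "Suc j" n i] j n iI by auto
        ultimately show ?thesis by blast
      qed
      moreover have "S n i \<inter> S (Suc n) j = {}" if "j \<in> ?I'" for j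
      proof -
        have "S (Suc n) j \<subseteq> S n j" using anti[of n "Suc n" j] n that by auto
        moreover have "S n i \<inter> S n j = {}" using disj[of n i j] n that i iI by auto
        ultimately show ?thesis by blast
      qed
      moreover have "S n i \<subseteq> W - V0" using S[of n i] n iI by auto
      ultimately show ?thesis by blast
    qed
    have cardF: "real (card ?F) \<le> \<gamma> * a n / 2"
    proof -
      have "card ?F \<le> card V0 + (card (\<Union>j<n. set (P j)) + card (\<Union>i\<in>?I'. S (Suc n) i))"
        by (meson add_le_mono card_Un_le order_refl order_trans)
      moreover have "card (\<Union>j<n. set (P j)) \<le> m * ?L"
      proof -
        have "card (\<Union>j<n. set (P j)) \<le> (\<Sum>j<n. card (set (P j)))" by (rule card_UN_le) simp
        also have "\<dots> \<le> (\<Sum>j<n. ?L)"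
        proof (rule sum_mono)
          fix j assume "j \<in> {..<n}"
          then have "length (P j) \<le> ?L" using P(1)[of j] unfolding good_def by auto
          then show "card (set (P j)) \<le> ?L" using card_length order_trans by blast
        qed
        also have "\<dots> = n * ?L" by simp
        also have "\<dots> \<le> m * ?L" using n by (intro mult_le_mono1) simp
        finally show ?thesis .
      qed
      ultimately have "real (card ?F) \<le> card V0 + real (m * ?L) + card (\<Union>i\<in>?I'. S (Suc n) i)"
        by linarith
      moreover have "real (card (\<Union>i\<in>?I'. S (Suc n) i)) \<le> real (card I) * c (Suc n)"
      proof -
        have cn: "0 \<le> c (Suc n)"
          using S[of "Suc n" "src n"] slots(1)[OF n] Suc.prems by (meson Suc_leI n of_nat_0_le_iff order_trans)
        have "card (\<Union>i\<in>?I'. S (Suc n) i) \<le> (\<Sum>i\<in>?I'. card (S (Suc n) i))"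
          by (rule card_UN_le) (use fin in auto)
        then have "real (card (\<Union>i\<in>?I'. S (Suc n) i)) \<le> (\<Sum>i\<in>?I'. real (card (S (Suc n) i)))"
          by (metis of_nat_mono of_nat_sum)
        also have "\<dots> \<le> (\<Sum>i\<in>?I'. c (Suc n))"
          by (rule sum_mono) (use S Suc.prems in auto)
        also have "\<dots> = real (card ?I') * c (Suc n)" by simp
        also have "\<dots> \<le> real (card I) * c (Suc n)"
          by (rule mult_right_mono) (use cn card_mono[OF fin, of ?I'] in auto)
        finally show ?thesis .
      qed
      ultimately show ?thesis using size[OF n] unfolding of_nat_mult by linarith
    qed
    have "\<exists>x\<in>S n (src n). \<exists>y\<in>S n (dst n). linked G (W - ?F) (2 * K + 2) x y"
      by (rule short_link[OF expand avoid _ avoid _ finF cardF \<gamma> a[OF n] K[OF n]])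
        (use S[of n] slots(1)[OF n] n in auto)
    then obtain x y where x: "x \<in> S n (src n)" and y: "y \<in> S n (dst n)"
      and xy: "linked G (W - ?F) (2 * K + 2) x y" by blast
    have lx: "linked G (W - ?F) r (u (src n)) x"
      by (rule linked_mono[OF link[OF _ _ x]]) (use avoid n slots(1)[OF n] in auto)
    have ly: "linked G (W - ?F) r (u (dst n)) y"
      by (rule linked_mono[OF link[OF _ _ y]]) (use avoid n slots(1)[OF n] in auto)
    \<comment> \<open>The walk runs from one root through its tree, over the short link, and back
      through the other tree to its root.\<close>
    have "linked G (W - ?F) (r + (2 * K + 2) + r) (u (src n)) (u (dst n))"
      by (rule linked_trans[OF linked_trans[OF lx xy] linked_sym[OF ly]])
    then obtain p where p: "p \<noteq> []" "hd p = u (src n)" "last p = u (dst n)" "walk G p"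
        "set p \<subseteq> W - ?F" "length p \<le> r + (2 * K + 2) + r" "distinct p"
      by (rule linked_distinct_path)
    have good: "good n p"
      unfolding good_def using p by auto
    let ?P = "P(n := p)"
    have "good k (?P k)" if "k < Suc n" for k
      using P(1)[of k] good that by (cases "k = n") auto
    moreover have "set (?P j) \<inter> set (?P k) = {}" if "j < Suc n" "k < Suc n" "j \<noteq> k" for j k
    proof -
      have "set p \<inter> set (P l) = {}" if "l < n" for l using p(5) that by auto
      from this[of j] this[of k] show ?thesis
        using P(2)[of j k] that by (cases "j = n"; cases "k = n") (auto simp: Int_commute)
    qed
    ultimately show ?case by blast
  qed
  from this[OF order_refl] show ?thesis unfolding good_def by meson
qed

end

section \<open>Subdivisions\<close>

fun path_arcs :: "'a list \<Rightarrow> ('a \<times> 'a) set" where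
  "path_arcs (x # y # p) = {(x, y), (y, x)} \<union> path_arcs (y # p)"
| "path_arcs _ = {}"

lemma path_arcs_walk: "walk M p \<Longrightarrow> path_arcs p \<subseteq> {(x, y). {x, y} \<in> M}"
  by (induction p rule: path_arcs.induct) (auto simp: walk_Cons insert_commute)

text \<open>After \<open>(u, v)\<close> is subdivided at the first new vertex \<open>w\<close>, the
  remaining vertices subdivide the arc \<open>(w, v)\<close>, to which the induction hypothesis
  applies.\<close>

lemma subdivide_along_path:
  assumes "subdivision_pair H S" "(u, v) \<in> parcs S" "distinct ws" "set ws \<inter> pverts S = {}"
  shows "subdivision_pair H
     \<lparr>pverts = pverts S \<union> set ws,
      parcs = (parcs S - {(u, v), (v, u)}) \<union> path_arcs (u # ws @ [v])\<rparr>"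
  using assms
proof (induction ws arbitrary: u S)
  case Nil
  interpret pair_bidirected_digraph S by (rule bidirected_digraphI_subdivision[OF Nil.prems(1)])
  have "(v, u) \<in> parcs S" using Nil.prems(2) arcs_symmetric by blast
  then have "(parcs S - {(u, v), (v, u)}) \<union> path_arcs (u # [] @ [v]) = parcs S"
    using Nil.prems(2) by auto
  then have "\<lparr>pverts = pverts S \<union> set [],
      parcs = (parcs S - {(u, v), (v, u)}) \<union> path_arcs (u # [] @ [v])\<rparr> = S" by simp
  then show ?case using Nil.prems(1) by (simp only:)
next
  case (Cons w ws)
  interpret pair_bidirected_digraph S by (rule bidirected_digraphI_subdivision[OF Cons.prems(1)])
  have uv: "u \<noteq> v" "u \<in> pverts S" "v \<in> pverts S"
    using Cons.prems(2) no_loops[of "(u, v)"] in_arcsD1 in_arcsD2 by auto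
  have w: "w \<notin> pverts S" "w \<noteq> u" "w \<noteq> v" using Cons.prems(4) uv by auto
  have wS: "(w, x) \<notin> parcs S" "(x, w) \<notin> parcs S" for x
    using in_arcsD1 in_arcsD2 w(1) by blast+
  let ?S = "subdivide S (u, v) w"
  have "subdivision_pair H ?S" by (rule subdivision_pair_divide[OF Cons.prems(2) w(1) Cons.prems(1)])
  then have "subdivision_pair H
     \<lparr>pverts = pverts ?S \<union> set ws,
      parcs = (parcs ?S - {(w, v), (v, w)}) \<union> path_arcs (w # ws @ [v])\<rparr>"
    by (rule Cons.IH) (use Cons.prems w in auto)
  moreover have "parcs ?S - {(w, v), (v, w)} = (parcs S - {(u, v), (v, u)}) \<union> {(u, w), (w, u)}"
    using uv w wS by auto
  moreover have "pverts ?S \<union> set ws = pverts S \<union> set (w # ws)" by auto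
  ultimately show ?case by (simp add: Un_assoc insert_commute)
qed

lemma edge_graph_wf:
  assumes "M \<subseteq> complete_edges n"
  shows "wf_digraph (with_proj (edge_graph n M))"
  by unfold_locales (use assms in \<open>auto simp: edge_graph_def complete_edges_def\<close>)

text \<open>\<open>E\<close> picks one of the two arcs of each edge of \<open>H\<close>, the one
  that increases under \<open>\<phi>\<close>. Starting from the copy of \<open>H\<close> with
  vertices \<open>\<phi> x\<close>, the edges are replaced by their paths one after the
  other.\<close>

lemma contains_subdivisionI:
  fixes \<phi> :: "'a \<Rightarrow> nat" and P :: "'a \<times> 'a \<Rightarrow> nat list"
  assumes H: "pair_graph H" and inj: "inj_on \<phi> (pverts H)" and \<phi>n: "\<phi> ` pverts H \<subseteq> {..<n}"
    and M: "M \<subseteq> complete_edges n"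
    and E: "E = {(x, y) \<in> parcs H. \<phi> x < \<phi> y}"
    and P: "\<And>x y. (x, y) \<in> E \<Longrightarrow> walk M (\<phi> x # P (x, y) @ [\<phi> y]) \<and> distinct (P (x, y)) \<and>
        set (P (x, y)) \<subseteq> {..<n} - \<phi> ` pverts H"
    and disj: "\<And>e f. e \<in> E \<Longrightarrow> f \<in> E \<Longrightarrow> e \<noteq> f \<Longrightarrow> set (P e) \<inter> set (P f) = {}"
  shows "contains_subdivision (edge_graph n M) H"
proof -
  interpret H: pair_graph H by (rule H)
  define H' where "H' = \<lparr>pverts = \<phi> ` pverts H, parcs = map_prod \<phi> \<phi> ` parcs H\<rparr>"
  have injA: "inj_on (map_prod \<phi> \<phi>) (parcs H)"
    using inj H.in_arcsD1 H.in_arcsD2 by (auto simp: inj_on_def)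
  let ?f = "\<lparr>iso_verts = \<phi>, iso_arcs = map_prod \<phi> \<phi>, iso_head = snd, iso_tail = fst\<rparr>"
  have "pre_digraph.digraph_isomorphism (with_proj H) ?f"
    unfolding pre_digraph.digraph_isomorphism_def
    using inj injA H.wf_digraph by auto
  moreover have "with_proj H' = app_iso ?f (with_proj H)"
    by (simp add: app_iso_def with_proj_def H'_def)
  ultimately have iso: "digraph_iso (with_proj H) (with_proj H')"
    unfolding digraph_iso_def by blast
  have bidir: "pair_bidirected_digraph H'"
  proof
    fix e assume e: "e \<in> parcs H'"
    then show "fst e \<in> pverts H'" "snd e \<in> pverts H'"
      using H.in_arcsD1 H.in_arcsD2 by (auto simp: H'_def)
    from e obtain x y where "(x, y) \<in> parcs H" "e = (\<phi> x, \<phi> y)" by (auto simp: H'_def)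
    then show "fst e \<noteq> snd e"
      using H.no_loops[of "(x, y)"] H.in_arcsD1 H.in_arcsD2 inj by (auto simp: inj_on_def)
  next
    show "symmetric (with_proj H')"
      unfolding symmetric_def sym_def H'_def using H.arcs_symmetric by fastforce
  qed
  let ?M = "{(x, y). {x, y} \<in> M}"
  let ?a = "map_prod \<phi> \<phi>"
  \<comment> \<open>\<open>F\<close> holds the edges already replaced. An intermediate
    \<open>S\<close> need not lie in Maker's graph, since arcs not yet replaced may be missing from
    \<open>M\<close>; only for \<open>F = E\<close> do all arcs come from \<open>M\<close>.\<close>
  have "\<exists>S. subdivision_pair H' S \<and> pverts S = \<phi> ` pverts H \<union> (\<Union>e\<in>F. set (P e)) \<and>
      ?a ` (E - F) \<subseteq> parcs S \<and> parcs S \<subseteq> ?M \<union> ?a ` (E - F) \<union> (?a ` (E - F))\<inverse>"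
    if "finite F" "F \<subseteq> E" for F
    using that
  proof (induction F rule: finite_induct)
    case empty
    have "parcs H' \<subseteq> ?a ` E \<union> (?a ` E)\<inverse>"
    proof
      fix e assume "e \<in> parcs H'"
      then obtain x y where xy: "(x, y) \<in> parcs H" "e = (\<phi> x, \<phi> y)" by (auto simp: H'_def)
      then have "\<phi> x \<noteq> \<phi> y"
        using H.no_loops[of "(x, y)"] H.in_arcsD1 H.in_arcsD2 inj by (auto simp: inj_on_def)
      then consider "(x, y) \<in> E" | "(y, x) \<in> E"
        using xy H.arcs_symmetric unfolding E by force
      then show "e \<in> ?a ` E \<union> (?a ` E)\<inverse>" using xy by cases force+
    qed
    moreover have "?a ` E \<subseteq> parcs H'" unfolding H'_def E by auto
    moreover have "pverts H' = \<phi> ` pverts H" by (simp add: H'_def)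
    ultimately show ?case
      using subdivision_pair_base[OF bidir] by (intro exI[of _ H']) auto
  next
    case (insert e F)
    then obtain S where S: "subdivision_pair H' S"
      "pverts S = \<phi> ` pverts H \<union> (\<Union>e\<in>F. set (P e))" "?a ` (E - F) \<subseteq> parcs S"
      "parcs S \<subseteq> ?M \<union> ?a ` (E - F) \<union> (?a ` (E - F))\<inverse>" by auto
    obtain x y where e: "e = (x, y)" by (cases e)
    have eE: "(x, y) \<in> E" using insert e by auto
    have inS: "(\<phi> x, \<phi> y) \<in> parcs S" using S(3) insert e by force
    let ?S = "\<lparr>pverts = pverts S \<union> set (P e),
      parcs = (parcs S - {(\<phi> x, \<phi> y), (\<phi> y, \<phi> x)}) \<union> path_arcs (\<phi> x # P e @ [\<phi> y])\<rparr>"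
    have "set (P e) \<inter> set (P f) = {}" if "f \<in> F" for f
      using disj[of e f] insert that by auto
    then have "set (P e) \<inter> pverts S = {}"
      unfolding S(2) using P[OF eE] e by auto
    then have sub: "subdivision_pair H' ?S"
      using P[OF eE] e by (intro subdivide_along_path S(1) inS) auto
    have "?a ` (E - insert e F) \<subseteq> parcs ?S"
    proof
      fix g assume "g \<in> ?a ` (E - insert e F)"
      then obtain x' y' where g: "g = (\<phi> x', \<phi> y')" "(x', y') \<in> E" "(x', y') \<notin> F" "(x', y') \<noteq> (x, y)"
        using e by auto
      have "(x', y') \<in> parcs H" "(x, y) \<in> parcs H" "\<phi> x' < \<phi> y'" "\<phi> x < \<phi> y"
        using g eE unfolding E by auto
      \<comment> \<open>Both arcs increase, so \<open>g\<close> cannot be the reverse of the removed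
        arc either.\<close>
      then have "g \<noteq> (\<phi> x, \<phi> y)" "g \<noteq> (\<phi> y, \<phi> x)"
        using g inj_onD[OF injA, of "(x', y')" "(x, y)"] by auto
      moreover have "g \<in> parcs S" using S(3) g by force
      ultimately show "g \<in> parcs ?S" by auto
    qed
    moreover have "parcs ?S \<subseteq> ?M \<union> ?a ` (E - insert e F) \<union> (?a ` (E - insert e F))\<inverse>"
    proof -
      have "path_arcs (\<phi> x # P e @ [\<phi> y]) \<subseteq> ?M"
        by (rule path_arcs_walk) (use P[OF eE] e in auto)
      moreover have "?a ` (E - F) \<subseteq> insert (\<phi> x, \<phi> y) (?a ` (E - insert e F))"
        using e by auto
      ultimately show ?thesis using S(4) by auto blast+
    qed
    moreover have "pverts ?S = \<phi> ` pverts H \<union> (\<Union>e\<in>insert e F. set (P e))" using S(2) by auto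
    ultimately show ?case using sub by blast
  qed
  moreover have "finite E" unfolding E using H.pair_finite_arcs by (rule rev_finite_subset) auto
  ultimately obtain S where S: "subdivision_pair H' S"
    "pverts S = \<phi> ` pverts H \<union> (\<Union>e\<in>E. set (P e))" "parcs S \<subseteq> ?M"
    by force
  interpret S: pair_bidirected_digraph S by (rule bidirected_digraphI_subdivision[OF S(1)])
  have "pverts S \<subseteq> {..<n}" unfolding S(2) using P \<phi>n by fastforce
  then have "subgraph (with_proj S) (with_proj (edge_graph n M))"
    unfolding subgraph_def using edge_graph_wf[OF M] S.wf_digraph S(3)
    by (simp add: edge_graph_def compatible_def)
  then show ?thesis unfolding contains_subdivision_def using iso S(1) by blast
qed

text \<open>An arc leaving \<open>v\<close> either survives or is redirected to \<open>w\<close>; as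
  \<open>w\<close> is new, redirected arcs never coincide with old ones.\<close>

lemma out_degree_subdivide_ge:
  assumes S: "pair_bidirected_digraph S" "finite (parcs S)" and e: "e \<in> parcs S" "w \<notin> pverts S"
    and v: "v \<in> pverts S"
  shows "out_degree (with_proj S) v \<le> out_degree (with_proj (subdivide S e w)) v"
proof -
  interpret pair_bidirected_digraph S by (rule S)
  obtain a b where ab: "e = (a, b)" by (cases e)
  have abn: "a \<noteq> b" using e ab no_loops[of "(a, b)"] by auto
  let ?g = "\<lambda>x. if x = (a, b) \<or> x = (b, a) then (fst x, w) else x"
  have fin: "finite (out_arcs (with_proj (subdivide S e w)) v)"
    unfolding ab by (rule finite_subset[of _ "parcs (subdivide S (a, b) w)"]) (use S in auto)
  have wS: "(x, w) \<notin> parcs S" for x using in_arcsD2 e(2) by blast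
  have "inj_on ?g (out_arcs (with_proj S) v)"
    using wS abn by (auto simp: inj_on_def out_arcs_def)
  moreover have "?g ` out_arcs (with_proj S) v \<subseteq> out_arcs (with_proj (subdivide S e w)) v"
    unfolding ab by (auto simp: out_arcs_def)
  ultimately show ?thesis unfolding out_degree_def using fin by (rule card_inj_on_le)
qed

lemma out_degree_subdivision_ge:
  assumes "subdivision_pair H S" "finite (parcs H)" "v \<in> pverts H"
  shows "out_degree (with_proj H) v \<le> out_degree (with_proj S) v"
proof -
  have "pair_bidirected_digraph S \<and> finite (parcs S) \<and> v \<in> pverts S \<and>
      out_degree (with_proj H) v \<le> out_degree (with_proj S) v"
    using assms
  proof (induction rule: subdivision_pair_induct)
    case base
    then show ?case by simp
  next
    case (divide e w S)
    then have IH: "pair_bidirected_digraph S" "finite (parcs S)" "v \<in> pverts S"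
      "out_degree (with_proj H) v \<le> out_degree (with_proj S) v" by auto
    obtain a b where "e = (a, b)" by (cases e)
    then show ?case
      using IH out_degree_subdivide_ge[OF IH(1,2) divide.hyps(1,2) IH(3)]
        pair_bidirected_digraph.pair_bidirected_digraph_subdivide[OF IH(1) divide.hyps(1,2)]
      by auto
  qed
  then show ?thesis by simp
qed

text \<open>All that Breaker's side needs to know about subdivisions: the image of a vertex of
  maximum degree keeps at least that degree.\<close>

lemma contains_subdivision_degree:
  assumes H: "pair_graph H" "0 < max_degree H" and M: "M \<subseteq> complete_edges n"
    and C: "contains_subdivision (edge_graph n M) H"
  obtains v where "v < n" "max_degree H \<le> card {e \<in> M. v \<in> e}"
proof -
  interpret H: pair_graph H by (rule H)
  obtain H' S where S: "digraph_iso (with_proj H) (with_proj H')" "subdivision_pair H' S"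
      "subgraph (with_proj S) (with_proj (edge_graph n M))"
    using C unfolding contains_subdivision_def by auto
  obtain f where f: "pre_digraph.digraph_isomorphism (with_proj H) f" "with_proj H' = app_iso f (with_proj H)"
    using S(1) unfolding digraph_iso_def by auto
  have "max_degree H \<in> insert 0 (out_degree (with_proj H) ` pverts H)"
    unfolding max_degree_def by (rule Max_in) (use H.pair_finite_verts in auto)
  \<comment> \<open>A positive maximum degree rules out the default value \<open>0\<close> inserted
    in \<open>max_degree\<close>.\<close>
  then obtain x where x: "x \<in> pverts H" "max_degree H = out_degree (with_proj H) x"
    using H(2) by auto
  let ?v = "iso_verts f x"
  have v: "?v \<in> pverts H'" using f(2) x(1) by (metis app_iso_simps(1) imageI with_proj_simps(1))
  have "parcs H' = iso_arcs f ` parcs H" using f(2) by (metis app_iso_simps(2) with_proj_simps(2))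
  then have finH': "finite (parcs H')" using H.pair_finite_arcs by simp
  have "out_degree (with_proj H') ?v = out_degree (with_proj H) x"
    unfolding f(2) by (rule wf_digraph.out_degree_app_iso_eq[OF H.wf_digraph f(1)]) (use x in simp)
  then have "max_degree H \<le> out_degree (with_proj S) ?v"
    using x(2) out_degree_subdivision_ge[OF S(2) finH' v] by simp
  also have "\<dots> \<le> card {e \<in> M. ?v \<in> e}"
  proof -
    have "finite M"
      by (rule finite_subset[OF M]) (simp add: complete_edges_def)
    moreover have "inj_on (\<lambda>(a, b). {a, b}) (out_arcs (with_proj S) ?v)"
      by (auto simp: inj_on_def out_arcs_def doubleton_eq_iff)
    moreover have "(\<lambda>(a, b). {a, b}) ` out_arcs (with_proj S) ?v \<subseteq> {e \<in> M. ?v \<in> e}"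
      using S(3) by (auto simp: out_arcs_def subgraph_def edge_graph_def)
    ultimately show ?thesis unfolding out_degree_def by (intro card_inj_on_le) auto
  qed
  finally have "max_degree H \<le> card {e \<in> M. ?v \<in> e}" .
  moreover have "?v < n"
  proof -
    have "?v \<in> pverts S" using subdivision_verts_subset[OF S(2)] v by simp
    then show ?thesis using S(3) by (auto simp: subgraph_def edge_graph_def)
  qed
  ultimately show thesis using that by blast
qed

lemma contains_subdivision_mono:
  assumes "contains_subdivision (edge_graph n M) H" "M \<subseteq> M'" "M' \<subseteq> complete_edges n"
  shows "contains_subdivision (edge_graph n M') H"
proof -
  have "subgraph (with_proj S) (with_proj (edge_graph n M'))"
    if "subgraph (with_proj S) (with_proj (edge_graph n M))" for S :: "nat pair_pre_digraph"
    using that assms(2) edge_graph_wf[OF assms(3)]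
    by (auto simp: subgraph_def edge_graph_def compatible_def)
  then show ?thesis using assms(1) unfolding contains_subdivision_def by blast
qed

section \<open>Playing the game\<close>

lemma claims_append [simp]:
  "maker_claims (h @ [(e, F)]) = insert e (maker_claims h)"
  "breaker_claims (h @ [(e, F)]) = F \<union> breaker_claims h"
  by (auto simp: maker_claims_def breaker_claims_def)

lemma claims_Nil [simp]: "maker_claims [] = {}" "breaker_claims [] = {}"
  by (auto simp: maker_claims_def breaker_claims_def)

lemma finite_complete_edges [simp]: "finite (complete_edges n)"
  by (simp add: complete_edges_def)

lemma play_rounds_invariant:
  assumes h: "h \<in> set_pmf (play_rounds X \<sigma> \<tau> k)" and base: "I []"
    and \<sigma>: "\<sigma> \<in> maker_strategies X"
    and step: "\<And>h e F. I h \<Longrightarrow> e \<in> unclaimed X h \<Longrightarrow> F \<in> set_pmf (\<tau> h e) \<Longrightarrow> I (h @ [(e, F)])"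
  shows "I h"
  using h
proof (induction k arbitrary: h)
  case 0
  then show ?case using base by simp
next
  case (Suc k)
  then obtain h0 where h0: "h0 \<in> set_pmf (play_rounds X \<sigma> \<tau> k)"
    "h \<in> set_pmf (if unclaimed X h0 = {} then return_pmf h0
      else do { e \<leftarrow> \<sigma> h0; F \<leftarrow> \<tau> h0 e; return_pmf (h0 @ [(e, F)]) })"
    by auto
  have I0: "I h0" by (rule Suc.IH[OF h0(1)])
  show ?case
  proof (cases "unclaimed X h0 = {}")
    case True
    then show ?thesis using h0 I0 by simp
  next
    case False
    then obtain e F where "e \<in> set_pmf (\<sigma> h0)" "F \<in> set_pmf (\<tau> h0 e)" "h = h0 @ [(e, F)]"
      using h0(2) by auto
    moreover have "set_pmf (\<sigma> h0) \<subseteq> unclaimed X h0"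
      using \<sigma> False by (auto simp: maker_strategies_def)
    ultimately show ?thesis using step I0 by auto
  qed
qed

section \<open>Breaker's degree-bounding strategy\<close>

lemma breaker_moves_nonempty: "finite X \<Longrightarrow> breaker_moves X b h e \<noteq> {}"
proof -
  assume "finite X"
  then have "finite (unclaimed X h - {e})" by (simp add: unclaimed_def)
  then obtain F where "F \<subseteq> unclaimed X h - {e}" "card F = min b (card (unclaimed X h - {e}))"
    by (meson min.cobounded2 obtain_subset_with_card_n)
  then show ?thesis by (auto simp: breaker_moves_def Let_def)
qed

text \<open>The \<open>min\<close> covers a vertex with fewer than \<open>b div 2\<close> free
  edges, all of which Breaker then takes. The guard \<open>card e = 2\<close> is there because a
  strategy must supply a legal move for every history and every \<open>e\<close>.\<close>

definition balanced_move :: "nat set set \<Rightarrow> nat \<Rightarrow> nat set history \<Rightarrow> nat set \<Rightarrow> nat set set \<Rightarrow> bool" where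
  "balanced_move X b h e F \<longleftrightarrow> F \<in> breaker_moves X b h e \<and>
     (card e = 2 \<longrightarrow> (\<forall>v\<in>e. min (b div 2) (card {f \<in> unclaimed X h - {e}. v \<in> f}) \<le> card {f \<in> F. v \<in> f}))"

text \<open>The shares of the two endpoints have at most \<open>b div 2\<close> edges each, so their
  union fits into one move and is filled up to the exact size demanded by
  \<open>breaker_moves\<close>.\<close>

lemma balanced_move_exists:
  assumes X: "finite X"
  shows "\<exists>F. balanced_move X b h e F"
proof (cases "card e = 2")
  case False
  then show ?thesis using breaker_moves_nonempty[OF X, of b h e] unfolding balanced_move_def by blast
next
  case True
  then obtain u v where e: "e = {u, v}" by (auto simp: card_2_iff)
  let ?U = "unclaimed X h - {e}"
  have U: "finite ?U" using X by (simp add: unclaimed_def)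
  have "\<exists>A. A \<subseteq> {f \<in> ?U. w \<in> f} \<and> card A = min (b div 2) (card {f \<in> ?U. w \<in> f})" for w
    by (meson min.cobounded2 obtain_subset_with_card_n)
  then obtain A where A: "\<And>w. A w \<subseteq> {f \<in> ?U. w \<in> f}"
      "\<And>w. card (A w) = min (b div 2) (card {f \<in> ?U. w \<in> f})" by metis
  have AU: "A u \<union> A v \<subseteq> ?U" using A(1) by blast
  have "card (A u \<union> A v) \<le> card (A u) + card (A v)" by (rule card_Un_le)
  also have "\<dots> \<le> b div 2 + b div 2" using A(2) by (intro add_mono) auto
  also have "\<dots> \<le> b" by simp
  finally have "card (A u \<union> A v) \<le> min b (card ?U)" using card_mono[OF U AU] by simp
  then obtain F where F: "A u \<union> A v \<subseteq> F" "F \<subseteq> ?U" "card F = min b (card ?U)"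
    using exists_subset_between[OF _ _ AU U] by (metis min.cobounded2)
  have "min (b div 2) (card {f \<in> ?U. w \<in> f}) \<le> card {f \<in> F. w \<in> f}" if "w \<in> e" for w
  proof -
    have "finite {f \<in> F. w \<in> f}" using F(2) U finite_subset by fastforce
    then have "card (A w) \<le> card {f \<in> F. w \<in> f}"
      by (rule card_mono) (use F(1) A(1)[of w] that e in auto)
    then show ?thesis using A(2) by simp
  qed
  then show ?thesis using F by (auto simp: balanced_move_def breaker_moves_def Let_def)
qed

definition balanced_strategy :: "nat set set \<Rightarrow> nat \<Rightarrow> nat set history \<Rightarrow> nat set \<Rightarrow> nat set set" where
  "balanced_strategy X b h e = (SOME F. balanced_move X b h e F)"

lemma balanced_strategy: "finite X \<Longrightarrow> balanced_move X b h e (balanced_strategy X b h e)"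
  unfolding balanced_strategy_def by (rule someI_ex[OF balanced_move_exists])

lemma star_card_le: "card {e \<in> complete_edges n. v \<in> e} \<le> n - 1"
proof (cases "v < n")
  case True
  have "{e \<in> complete_edges n. v \<in> e} \<subseteq> (\<lambda>y. {v, y}) ` ({..<n} - {v})"
  proof
    fix e assume "e \<in> {e \<in> complete_edges n. v \<in> e}"
    then obtain x y where "e = {x, y}" "x \<noteq> y" "v \<in> e" "e \<subseteq> {..<n}"
      by (auto simp: complete_edges_def card_2_iff)
    then show "e \<in> (\<lambda>y. {v, y}) ` ({..<n} - {v})" by auto
  qed
  then have "card {e \<in> complete_edges n. v \<in> e} \<le> card ((\<lambda>y. {v, y}) ` ({..<n} - {v}))"
    by (intro card_mono) auto
  also have "\<dots> \<le> card ({..<n} - {v})" by (rule card_image_le) simp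
  also have "\<dots> = n - 1" using True by simp
  finally show ?thesis .
next
  case False
  then have "{e \<in> complete_edges n. v \<in> e} = {}" by (auto simp: complete_edges_def)
  then show ?thesis by (simp only: card.empty zero_le)
qed

text \<open>
  As long as \<open>v\<close> has an unclaimed edge, each Maker edge at \<open>v\<close> has been answered by \<open>b div 2\<close>
  Breaker edges at \<open>v\<close>.
\<close>

definition degree_bounded :: "nat \<Rightarrow> nat \<Rightarrow> nat \<Rightarrow> nat set history \<Rightarrow> bool" where
  "degree_bounded n b D h \<longleftrightarrow>
     maker_claims h \<subseteq> complete_edges n \<and> breaker_claims h \<subseteq> complete_edges n \<and>
     maker_claims h \<inter> breaker_claims h = {} \<and>
     (\<forall>v. card {e \<in> maker_claims h. v \<in> e} \<le> D \<and>
        ((\<forall>e\<in>unclaimed (complete_edges n) h. v \<notin> e) \<or>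
         b div 2 * card {e \<in> maker_claims h. v \<in> e} \<le> card {e \<in> breaker_claims h. v \<in> e}))"

text \<open>If Maker reached a vertex at which she already has \<open>D\<close> edges, at least
  \<open>D * (b div 2)\<close> Breaker edges and \<open>D + 1\<close> Maker edges would share the at
  most \<open>n - 1\<close> edges there, against \<open>n \<le> D * (b div 2 + 1)\<close>.\<close>

lemma degree_bounded_step:
  assumes inv: "degree_bounded n b D h" and e: "e \<in> unclaimed (complete_edges n) h"
    and F: "balanced_move (complete_edges n) b h e F" and D: "n \<le> D * (b div 2 + 1)"
  shows "degree_bounded n b D (h @ [(e, F)])"
proof -
  let ?X = "complete_edges n" and ?k = "b div 2"
  let ?U = "unclaimed ?X h - {e}"
  have FU: "F \<subseteq> ?U" using F by (auto simp: balanced_move_def breaker_moves_def Let_def)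
  have e2: "card e = 2" using e by (auto simp: unclaimed_def complete_edges_def)
  have sub: "maker_claims h \<subseteq> ?X" "breaker_claims h \<subseteq> ?X" "maker_claims h \<inter> breaker_claims h = {}"
    using inv by (auto simp: degree_bounded_def)
  have finM: "finite (maker_claims h)" and finB: "finite (breaker_claims h)" and finF: "finite F"
    using sub finite_subset[OF FU] finite_subset[OF _ finite_complete_edges]
    by (auto simp: unclaimed_def)
  have eX: "e \<in> ?X" "e \<notin> maker_claims h" "e \<notin> breaker_claims h" using e by (auto simp: unclaimed_def)
  have un: "unclaimed ?X (h @ [(e, F)]) = ?U - F" by (auto simp: unclaimed_def)
  have "card {f \<in> insert e (maker_claims h). v \<in> f} \<le> D \<and>
        ((\<forall>f\<in>?U - F. v \<notin> f) \<or>
         ?k * card {f \<in> insert e (maker_claims h). v \<in> f} \<le> card {f \<in> F \<union> breaker_claims h. v \<in> f})"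
    for v
  proof -
    let ?M = "{f \<in> maker_claims h. v \<in> f}" and ?B = "{f \<in> breaker_claims h. v \<in> f}"
    have old: "card ?M \<le> D" "(\<forall>f\<in>unclaimed ?X h. v \<notin> f) \<or> ?k * card ?M \<le> card ?B"
      using inv unfolding degree_bounded_def by auto
    have dB: "card {f \<in> F \<union> breaker_claims h. v \<in> f} = card {f \<in> F. v \<in> f} + card ?B"
    proof -
      have "{f \<in> F \<union> breaker_claims h. v \<in> f} = {f \<in> F. v \<in> f} \<union> ?B" by auto
      then show ?thesis using FU finF finB by (simp, subst card_Un_disjoint) (auto simp: unclaimed_def)
    qed
    show ?thesis
    proof (cases "v \<in> e")
      case False
      then have ins: "{f \<in> insert e (maker_claims h). v \<in> f} = ?M" by auto
      from old(2) have "(\<forall>f\<in>?U - F. v \<notin> f) \<or> ?k * card ?M \<le> card {f \<in> F. v \<in> f} + card ?B"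
        by (meson DiffD1 trans_le_add2)
      then show ?thesis unfolding ins dB using old(1) by blast
    next
      case True
      then have ins: "{f \<in> insert e (maker_claims h). v \<in> f} = insert e ?M" by auto
      have cM: "card (insert e ?M) = Suc (card ?M)" using finM eX by simp
      \<comment> \<open>\<open>e\<close> itself is an unclaimed edge at \<open>v\<close>, so the
        first alternative of the invariant fails.\<close>
      have kM: "?k * card ?M \<le> card ?B" using old(2) e True by auto
      have "card (insert e ?M \<union> ?B) = card (insert e ?M) + card ?B"
        using finM finB sub(3) eX by (intro card_Un_disjoint) auto
      moreover have "card (insert e ?M \<union> ?B) \<le> card {f \<in> ?X. v \<in> f}"
        by (rule card_mono) (use sub eX True in auto)
      ultimately have tot: "Suc (card ?M) + card ?B \<le> n - 1" using star_card_le[of n v] cM by simp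
      have lt: "card ?M < D"
      proof (rule ccontr)
        assume "\<not> card ?M < D"
        then have "D * (?k + 1) \<le> card ?M * (?k + 1)" by (intro mult_le_mono1) simp
        also have "\<dots> = ?k * card ?M + card ?M" by (simp add: algebra_simps)
        finally show False using D kM tot by linarith
      qed
      have bal: "min ?k (card {f \<in> ?U. v \<in> f}) \<le> card {f \<in> F. v \<in> f}"
        using F e2 True unfolding balanced_move_def by blast
      have new: "(\<forall>f\<in>?U - F. v \<notin> f) \<or>
         ?k * Suc (card ?M) \<le> card {f \<in> F. v \<in> f} + card ?B"
      proof (cases "?k \<le> card {f \<in> ?U. v \<in> f}")
        case True
        then have "?k \<le> card {f \<in> F. v \<in> f}"
          using bal by simp
        then show ?thesis using kM by simp
      next
        case False
        \<comment> \<open>Too few edges at \<open>v\<close> were free for a full answer, so Breaker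
          takes all of them and \<open>v\<close> is closed for Maker.\<close>
        then have "card {f \<in> ?U. v \<in> f} \<le> card {f \<in> F. v \<in> f}"
          using bal by simp
        moreover have "finite {f \<in> ?U. v \<in> f}" by (simp add: unclaimed_def)
        ultimately have "{f \<in> F. v \<in> f} = {f \<in> ?U. v \<in> f}"
          using FU by (intro card_seteq) auto
        then show ?thesis by blast
      qed
      from lt new show ?thesis unfolding ins cM dB Suc_le_eq by blast
    qed
  qed
  then show ?thesis
    unfolding degree_bounded_def un claims_append using sub eX FU by (auto simp: unclaimed_def)
qed

text \<open>The strict bound by \<open>real b + 1\<close> holds for both roundings of
  \<open>2 n / (max_degree H - 1)\<close> and for every larger bias, so it serves the exact
  statement and the thresholds alike.\<close>

lemma balanced_strategy_wins:
  assumes H: "pair_graph H" "2 \<le> max_degree H"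
    and b: "2 * real n / (real (max_degree H) - 1) < real b + 1"
    and \<sigma>: "\<sigma> \<in> maker_strategies (complete_edges n)"
    and M: "M \<in> set_pmf (final_maker_claims (complete_edges n) \<sigma>
              (\<lambda>h e. return_pmf (balanced_strategy (complete_edges n) b h e)))"
  shows "\<not> subdivision_win H n M"
proof
  assume win: "subdivision_win H n M"
  define D where "D = max_degree H - 1"
  have D: "real D = real (max_degree H) - 1" "0 < D" "D < max_degree H"
    using H(2) by (simp_all add: D_def of_nat_diff)
  have D': "n \<le> D * (b div 2 + 1)"
  proof -
    have "2 * real n < (real b + 1) * real D"
      using b D(2) unfolding D(1)[symmetric] by (simp add: pos_divide_less_eq)
    also have "\<dots> = real ((b + 1) * D)" by (simp add: algebra_simps)
    finally have "2 * n < (b + 1) * D" by linarith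
    \<comment> \<open>For odd \<open>b\<close> the two sides agree; for even \<open>b\<close> one
      unit is given away.\<close>
    also have "\<dots> \<le> (2 * (b div 2 + 1)) * D" by (intro mult_le_mono1) presburger
    finally show ?thesis by (simp add: algebra_simps)
  qed
  obtain h where h: "M = maker_claims h" "h \<in> set_pmf (play_rounds (complete_edges n) \<sigma>
      (\<lambda>h e. return_pmf (balanced_strategy (complete_edges n) b h e)) (card (complete_edges n)))"
    using M unfolding final_maker_claims_def by auto
  have "degree_bounded n b D h"
  proof (rule play_rounds_invariant[OF h(2) _ \<sigma>])
    show "degree_bounded n b D []" by (auto simp: degree_bounded_def)
  next
    fix h e F assume "degree_bounded n b D h" "e \<in> unclaimed (complete_edges n) h"
      "F \<in> set_pmf (return_pmf (balanced_strategy (complete_edges n) b h e))"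
    then show "degree_bounded n b D (h @ [(e, F)])"
      using degree_bounded_step[OF _ _ balanced_strategy D'] by auto
  qed
  then have dM: "M \<subseteq> complete_edges n" "\<And>v. card {e \<in> M. v \<in> e} \<le> D"
    unfolding degree_bounded_def h(1) by auto
  obtain v where "max_degree H \<le> card {e \<in> M. v \<in> e}"
    using contains_subdivision_degree[OF H(1) _ dM(1)] win H(2) unfolding subdivision_win_def
    by (metis less_le_trans pos2)
  then show False using dM(2)[of v] D(3) by (meson leD le_trans)
qed

lemma balanced_strategy_move:
  "balanced_strategy (complete_edges n) b h e \<in> breaker_moves (complete_edges n) b h e"
  using balanced_strategy[OF finite_complete_edges] by (auto simp: balanced_move_def)

lemma breaker_wins:
  assumes "pair_graph H" "2 \<le> max_degree H"
    and "2 * real n / (real (max_degree H) - 1) < real b + 1"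
  shows "breaker_has_winning_strategy (complete_edges n) b (subdivision_win H n)"
  unfolding breaker_has_winning_strategy_def
  using balanced_strategy_move balanced_strategy_wins[OF assms]
  by (intro exI[of _ "balanced_strategy (complete_edges n) b"]) blast

section \<open>Winning probabilities under optimal play\<close>

lemma winning_strategy_prob_zero:
  assumes "breaker_has_winning_strategy X b W"
  obtains \<tau> where "\<tau> \<in> breaker_strategies X b"
    "\<And>\<sigma>. \<sigma> \<in> maker_strategies X \<Longrightarrow> maker_win_prob X W \<sigma> \<tau> = 0"
proof -
  obtain t where t: "\<And>h e. t h e \<in> breaker_moves X b h e"
      "\<And>\<sigma> M. \<sigma> \<in> maker_strategies X \<Longrightarrow>
         M \<in> set_pmf (final_maker_claims X \<sigma> (\<lambda>h e. return_pmf (t h e))) \<Longrightarrow> \<not> W M"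
    using assms unfolding breaker_has_winning_strategy_def by blast
  show thesis
  proof (rule that)
    show "(\<lambda>h e. return_pmf (t h e)) \<in> breaker_strategies X b"
      using t(1) by (auto simp: breaker_strategies_def)
    fix \<sigma> assume "\<sigma> \<in> maker_strategies X"
    then show "maker_win_prob X W \<sigma> (\<lambda>h e. return_pmf (t h e)) = 0"
      unfolding maker_win_prob_def using t(2) by (subst measure_pmf_zero_iff) auto
  qed
qed

lemma random_maker_strategy: "finite X \<Longrightarrow> random_maker X \<in> maker_strategies X"
  by (auto simp: maker_strategies_def random_maker_def unclaimed_def)

lemma maker_win_prob_bounds: "0 \<le> maker_win_prob X W \<sigma> \<tau>" "maker_win_prob X W \<sigma> \<tau> \<le> 1"
  by (simp_all add: maker_win_prob_def)

lemma breaker_strategies_nonempty: "finite X \<Longrightarrow> breaker_strategies X b \<noteq> {}"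
proof -
  assume X: "finite X"
  define \<tau> where "\<tau> h e = return_pmf (SOME F. F \<in> breaker_moves X b h e)" for h e
  have "(SOME F. F \<in> breaker_moves X b h e) \<in> breaker_moves X b h e" for h e
    by (rule some_in_eq[THEN iffD2]) (rule breaker_moves_nonempty[OF X])
  then have "\<tau> \<in> breaker_strategies X b"
    unfolding breaker_strategies_def \<tau>_def by auto
  then show ?thesis by auto
qed

lemma maker_strategies_nonempty: "finite X \<Longrightarrow> maker_strategies X \<noteq> {}"
  using random_maker_strategy by blast

lemma bdd_below_win_prob: "bdd_below ((\<lambda>\<tau>. maker_win_prob X W \<sigma> \<tau>) ` B)"
  using maker_win_prob_bounds(1) by (intro bdd_belowI2)

text \<open>Random play is one of the strategies open to clever Maker. So a lower bound for random
  Maker and an upper bound for clever Maker settle both games at once.\<close>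

lemma random_clever_le_clever_clever:
  assumes X: "finite X"
  shows "0 \<le> random_clever_prob X b W"
    "random_clever_prob X b W \<le> clever_clever_prob X b W" "clever_clever_prob X b W \<le> 1"
proof -
  note ne = breaker_strategies_nonempty[OF X, of b]
  have le1: "(INF \<tau>\<in>breaker_strategies X b. maker_win_prob X W \<sigma> \<tau>) \<le> 1" for \<sigma>
  proof -
    obtain \<tau> where "\<tau> \<in> breaker_strategies X b" using ne by auto
    then show ?thesis
      by (rule cINF_lower2[OF bdd_below_win_prob _ maker_win_prob_bounds(2)])
  qed
  show "0 \<le> random_clever_prob X b W"
    unfolding random_clever_prob_def by (rule cINF_greatest[OF ne maker_win_prob_bounds(1)])
  show "random_clever_prob X b W \<le> clever_clever_prob X b W"
    unfolding random_clever_prob_def clever_clever_prob_def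
    by (rule cSUP_upper[OF random_maker_strategy[OF X] bdd_aboveI2]) (rule le1)
  show "clever_clever_prob X b W \<le> 1"
    unfolding clever_clever_prob_def by (rule cSUP_least[OF maker_strategies_nonempty[OF X] le1])
qed

lemma clever_clever_prob_zero:
  assumes X: "finite X" and "breaker_has_winning_strategy X b W"
  shows "clever_clever_prob X b W = 0"
proof -
  obtain \<tau> where \<tau>: "\<tau> \<in> breaker_strategies X b"
    "\<And>\<sigma>. \<sigma> \<in> maker_strategies X \<Longrightarrow> maker_win_prob X W \<sigma> \<tau> = 0"
    using winning_strategy_prob_zero[OF assms(2)] by blast
  have "clever_clever_prob X b W \<le> 0"
    unfolding clever_clever_prob_def
  proof (rule cSUP_least[OF maker_strategies_nonempty[OF X]])
    fix \<sigma> assume "\<sigma> \<in> maker_strategies X"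
    then have "maker_win_prob X W \<sigma> \<tau> \<le> 0" using \<tau>(2) by simp
    then show "(INF \<tau>\<in>breaker_strategies X b. maker_win_prob X W \<sigma> \<tau>) \<le> 0"
      by (rule cINF_lower2[OF bdd_below_win_prob \<tau>(1)])
  qed
  then show ?thesis using random_clever_le_clever_clever[OF X, of b W] by linarith
qed

section \<open>Random Maker against an arbitrary Breaker\<close>

lemma prob_bind_le:
  assumes "\<And>x. x \<in> set_pmf p \<Longrightarrow> measure_pmf.prob (f x) A \<le> g x" "integrable (measure_pmf p) g"
  shows "measure_pmf.prob (bind_pmf p f) A \<le> measure_pmf.expectation p g"
proof -
  have "measure_pmf.prob (bind_pmf p f) A = measure_pmf.expectation p (\<lambda>x. measure_pmf.prob (f x) A)"
    unfolding measure_pmf_bind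
    by (subst measure_pmf.measure_bind[where N = "count_space UNIV"]) (auto simp: measure_pmf_in_subprob_space)
  also have "\<dots> \<le> measure_pmf.expectation p g"
  proof (rule integral_mono_AE)
    show "integrable (measure_pmf p) (\<lambda>x. measure_pmf.prob (f x) A)"
      by (rule measure_pmf.integrable_const_bound[where B = 1]) auto
    show "AE x in measure_pmf p. measure_pmf.prob (f x) A \<le> g x"
      using assms(1) by (auto simp: AE_measure_pmf_iff)
  qed (rule assms(2))
  finally show ?thesis .
qed

lemma prob_bind_const_le:
  assumes "\<And>x. x \<in> set_pmf p \<Longrightarrow> measure_pmf.prob (f x) A \<le> c"
  shows "measure_pmf.prob (bind_pmf p f) A \<le> c"
  using prob_bind_le[OF assms, of p] by simp

text \<open>A round consumes at most \<open>b + 1\<close> elements. The assumption on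
  \<open>t\<close> says that the first \<open>t - 1\<close> rounds cannot exhaust the board, so all
  \<open>t\<close> rounds are really played.\<close>

lemma random_round_invariant:
  assumes X: "finite X" and \<tau>: "\<tau> \<in> breaker_strategies X b" and t: "t * (b + 1) < card X + b + 1"
    and h: "h \<in> set_pmf (play_rounds X (random_maker X) \<tau> t)"
  shows "maker_claims h \<subseteq> X \<and> card (maker_claims h) = t \<and> card X \<le> card (unclaimed X h) + t * (b + 1)"
  using t h
proof (induction t arbitrary: h)
  case 0
  then show ?case by (simp add: unclaimed_def)
next
  case (Suc t)
  then obtain h0 where h0: "h0 \<in> set_pmf (play_rounds X (random_maker X) \<tau> t)"
    "h \<in> set_pmf (if unclaimed X h0 = {} then return_pmf h0
      else do { e \<leftarrow> random_maker X h0; F \<leftarrow> \<tau> h0 e; return_pmf (h0 @ [(e, F)]) })"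
    by auto
  have t: "t * (b + 1) < card X" using Suc.prems(1) by simp
  then have IH: "maker_claims h0 \<subseteq> X" "card (maker_claims h0) = t"
      "card X \<le> card (unclaimed X h0) + t * (b + 1)"
    using Suc.IH[OF _ h0(1)] by auto
  have ne: "unclaimed X h0 \<noteq> {}"
  proof
    assume "unclaimed X h0 = {}"
    then show False using IH(3) t by simp
  qed
  have finU: "finite (unclaimed X h0)" using X by (simp add: unclaimed_def)
  obtain e F where eF: "e \<in> set_pmf (random_maker X h0)" "F \<in> set_pmf (\<tau> h0 e)" "h = h0 @ [(e, F)]"
    using h0(2) ne by auto
  have e: "e \<in> unclaimed X h0" using eF(1) ne finU by (simp add: random_maker_def)
  have "F \<in> breaker_moves X b h0 e" using eF(2) \<tau> by (auto simp: breaker_strategies_def)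
  then have F: "card F \<le> b" "F \<subseteq> unclaimed X h0 - {e}"
    by (simp_all add: breaker_moves_def Let_def)
  have un: "unclaimed X h = unclaimed X h0 - insert e F" using eF(3) by (auto simp: unclaimed_def)
  have finF: "finite (insert e F)" using F(2) finU finite_subset by auto
  have "card (insert e F) \<le> b + 1"
    using F(1) finF by (simp add: card_insert_if)
  moreover have "card (unclaimed X h0) - card (insert e F) \<le> card (unclaimed X h)"
    unfolding un by (rule diff_card_le_card_Diff[OF finF])
  ultimately have "card (unclaimed X h0) \<le> card (unclaimed X h) + (b + 1)" by linarith
  moreover have "card (maker_claims h) = Suc t"
    using eF(3) e IH(1,2) X finite_subset[OF IH(1)] by (simp add: unclaimed_def)
  moreover have "maker_claims h \<subseteq> X" using eF(3) e IH(1) by (simp add: unclaimed_def)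
  ultimately show ?case using IH(3) by simp
qed

text \<open>The one feature of a binomial random graph with edge probability \<open>c\<close> that
  survives an adaptive Breaker; all first-moment arguments rest on it alone.\<close>

definition spread :: "real \<Rightarrow> 'e set pmf \<Rightarrow> bool" where
  "spread c p \<longleftrightarrow> (\<forall>S. finite S \<longrightarrow> measure_pmf.prob p {M. S \<subseteq> M} \<le> c ^ card S)"

text \<open>The first two terms of the binomial expansion; it closes the induction over rounds
  below.\<close>

lemma power_add_first_order:
  fixes x p :: real
  assumes "0 \<le> x" "0 \<le> p"
  shows "x ^ k + real k * p * x ^ (k - 1) \<le> (x + p) ^ k"
proof (induction k)
  case 0
  show ?case by simp
next
  case (Suc k)
  show ?case
  proof (cases k)
    case 0
    then show ?thesis by simp
  next
    case (Suc j)
    have "x ^ Suc k + real (Suc k) * p * x ^ (Suc k - 1) \<le>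
        (x + p) * (x ^ k + real k * p * x ^ (k - 1))"
      using assms Suc by (simp add: algebra_simps power2_eq_square)
    also have "\<dots> \<le> (x + p) * (x + p) ^ k"
      using Suc.IH assms by (intro mult_left_mono) auto
    finally show ?thesis by simp
  qed
qed

text \<open>\<open>S\<close> is complete after a round if it was complete before, or if exactly one
  element \<open>s\<close> was missing and Maker picks it. At least \<open>u\<close> elements are
  still free, so the latter has conditional probability at most \<open>1 / u\<close> whatever
  Breaker did. With \<open>x = t / u\<close>, summing over \<open>s\<close> gives
  \<open>x ^ k + k * (1 / u) * x ^ (k - 1)\<close>.\<close>

lemma random_maker_contains:
  assumes X: "finite X" and \<tau>: "\<tau> \<in> breaker_strategies X b"
    and T: "T * (b + 1) + u \<le> card X" "0 < u" and t: "t \<le> T" and S: "finite S"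
  shows "measure_pmf.prob (play_rounds X (random_maker X) \<tau> t) {h. S \<subseteq> maker_claims h} \<le>
     (real t / real u) ^ card S"
  using t S
proof (induction t arbitrary: S)
  case 0
  then show ?case by (cases "S = {}") (auto simp: measure_return_pmf indicator_def card_gt_0_iff power_0_left)
next
  case (Suc t)
  let ?p = "play_rounds X (random_maker X) \<tau> t"
  let ?A = "\<lambda>S. {h. S \<subseteq> maker_claims h}"
  \<comment> \<open>Upper bound, as a function of the history, for the probability that the next
    round leaves \<open>S\<close> complete.\<close>
  let ?g = "\<lambda>h. indicator (?A S) h + (\<Sum>s\<in>S. indicator (?A (S - {s})) h * (1 / real u)) :: real"
  let ?K = "\<lambda>h. if unclaimed X h = {} then return_pmf h
      else do { e \<leftarrow> random_maker X h; F \<leftarrow> \<tau> h e; return_pmf (h @ [(e, F)]) }"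
  have step: "measure_pmf.prob (?K h) (?A S) \<le> ?g h" if h: "h \<in> set_pmf ?p" for h
  proof (cases "S \<subseteq> maker_claims h")
    case True
    have "measure_pmf.prob (?K h) (?A S) \<le> 1" by simp
    also have "1 \<le> ?g h" using True by (simp add: sum_nonneg)
    finally show ?thesis .
  next
    case notin: False
    have "Suc t * (b + 1) \<le> T * (b + 1)" using Suc.prems(1) by (rule mult_le_mono1)
    then have tX: "Suc t * (b + 1) + u \<le> card X" using T(1) by linarith
    have "t * (b + 1) < card X + b + 1" using tX by simp
    then have "card X \<le> card (unclaimed X h) + t * (b + 1)"
      using random_round_invariant[OF X \<tau> _ h] by blast
    then have u: "u \<le> card (unclaimed X h)" using tX by simp
    have finU: "finite (unclaimed X h)" using X by (simp add: unclaimed_def)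
    have ne: "unclaimed X h \<noteq> {}" using u T(2) by auto
    have K: "?K h = do { e \<leftarrow> random_maker X h; F \<leftarrow> \<tau> h e; return_pmf (h @ [(e, F)]) }"
      using ne by simp
    show ?thesis
    proof (cases "\<exists>s\<in>S. S - {s} \<subseteq> maker_claims h")
      case True
      then obtain s where s: "s \<in> S" "S - {s} \<subseteq> maker_claims h" by blast
      then have sm: "s \<notin> maker_claims h" using notin by auto
      have "measure_pmf.prob (?K h) (?A S) \<le> measure_pmf.expectation (random_maker X h) (indicator {s})"
        unfolding K
      proof (rule prob_bind_le)
        fix e
        show "measure_pmf.prob (\<tau> h e \<bind> (\<lambda>F. return_pmf (h @ [(e, F)]))) (?A S) \<le> indicator {s} e"
        proof (rule prob_bind_const_le)
          fix F
          show "measure_pmf.prob (return_pmf (h @ [(e, F)])) (?A S) \<le> indicator {s} e"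
            using s sm by (auto simp: measure_return_pmf indicator_def)
        qed
      qed (auto intro!: measure_pmf.integrable_const_bound[where B = 1])
      also have "\<dots> = pmf (random_maker X h) s" by (simp add: pmf.rep_eq)
      also have "\<dots> \<le> 1 / real (card (unclaimed X h))"
        unfolding random_maker_def using ne finU by (simp add: pmf_of_set indicator_def)
      also have "\<dots> \<le> 1 / real u" using u T(2) by (intro divide_left_mono) auto
      also have "\<dots> = indicator (?A (S - {s})) h * (1 / real u)" using s by simp
      also have "\<dots> \<le> (\<Sum>s\<in>S. indicator (?A (S - {s})) h * (1 / real u))"
        by (rule member_le_sum[OF s(1)]) (use Suc.prems in auto)
      also have "\<dots> \<le> ?g h" by simp
      finally show ?thesis .
    next
      case False
      \<comment> \<open>At least two elements are missing, and one move cannot supply both.\<close>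
      have "measure_pmf.prob (?K h) (?A S) \<le> 0"
        unfolding K
      proof (intro prob_bind_const_le)
        fix e F
        have "\<not> S \<subseteq> insert e (maker_claims h)" using False notin by blast
        then show "measure_pmf.prob (return_pmf (h @ [(e, F)])) (?A S) \<le> 0"
          by (auto simp: measure_return_pmf indicator_def)
      qed
      also have "0 \<le> ?g h" by (simp add: sum_nonneg)
      finally show ?thesis .
    qed
  qed
  have int: "integrable (measure_pmf ?p) (indicator B :: _ \<Rightarrow> real)" for B
    by (rule measure_pmf.integrable_const_bound[where B = 1]) auto
  have "measure_pmf.prob (play_rounds X (random_maker X) \<tau> (Suc t)) (?A S) \<le>
      measure_pmf.expectation ?p ?g"
    unfolding play_rounds.simps
    by (rule prob_bind_le[OF step]) (auto intro!: Bochner_Integration.integrable_add Bochner_Integration.integrable_sum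
        Bochner_Integration.integrable_divide int)
  also have "\<dots> = measure_pmf.prob ?p (?A S) + (\<Sum>s\<in>S. measure_pmf.prob ?p (?A (S - {s})) * (1 / real u))"
    by (subst Bochner_Integration.integral_add)
      (auto intro!: Bochner_Integration.integrable_sum Bochner_Integration.integrable_divide int
        simp: Bochner_Integration.integral_sum int)
  also have "\<dots> \<le> (real t / real u) ^ card S +
      (\<Sum>s\<in>S. (real t / real u) ^ (card S - 1) * (1 / real u))"
  proof (intro add_mono sum_mono mult_right_mono)
    fix s assume "s \<in> S"
    then show "measure_pmf.prob ?p (?A (S - {s})) \<le> (real t / real u) ^ (card S - 1)"
      using Suc.IH[of "S - {s}"] Suc.prems by simp
  qed (use Suc in auto)
  also have "\<dots> = (real t / real u) ^ card S + real (card S) * (1 / real u) * (real t / real u) ^ (card S - 1)"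
    by simp
  also have "\<dots> \<le> (real t / real u + 1 / real u) ^ card S"
    by (rule power_add_first_order) auto
  also have "real t / real u + 1 / real u = real (Suc t) / real u" by (simp add: add_divide_distrib)
  finally show ?case .
qed

text \<open>Maker's edge set only grows, so a history that already wins stays winning. This
  justifies analysing the game at an early round; the proof bounds the probability of the
  complement.\<close>

lemma prob_maker_mono:
  assumes X: "finite X" and \<sigma>: "\<sigma> \<in> maker_strategies X" and k: "k \<le> k'"
    and W: "\<And>M M'. W M \<Longrightarrow> M \<subseteq> M' \<Longrightarrow> M' \<subseteq> X \<Longrightarrow> W M'"
  shows "measure_pmf.prob (play_rounds X \<sigma> \<tau> k) {h. W (maker_claims h)} \<le>
     measure_pmf.prob (play_rounds X \<sigma> \<tau> k') {h. W (maker_claims h)}"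
  using k
proof (induction k' rule: dec_induct)
  case base
  show ?case by simp
next
  case (step k')
  let ?p = "play_rounds X \<sigma> \<tau> k'"
  let ?A = "{h. W (maker_claims h)}"
  have "measure_pmf.prob (play_rounds X \<sigma> \<tau> (Suc k')) (- ?A) \<le>
     measure_pmf.expectation ?p (indicator (- ?A))"
    unfolding play_rounds.simps
  proof (rule prob_bind_le)
    fix h assume h: "h \<in> set_pmf ?p"
    have sub: "maker_claims h \<subseteq> X"
      by (rule play_rounds_invariant[OF h _ \<sigma>]) (auto simp: unclaimed_def)
    let ?K = "if unclaimed X h = {} then return_pmf h
      else do { e \<leftarrow> \<sigma> h; F \<leftarrow> \<tau> h e; return_pmf (h @ [(e, F)]) }"
    show "measure_pmf.prob ?K (- ?A) \<le> indicator (- ?A) h"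
    proof (cases "W (maker_claims h)")
      case True
      have "W (maker_claims h')" if h': "h' \<in> set_pmf ?K" for h'
      proof (cases "unclaimed X h = {}")
        case True
        then show ?thesis using h' \<open>W (maker_claims h)\<close> by simp
      next
        case False
        then obtain e F where "e \<in> set_pmf (\<sigma> h)" "h' = h @ [(e, F)]" using h' by auto
        moreover have "set_pmf (\<sigma> h) \<subseteq> unclaimed X h"
          using \<sigma> False by (auto simp: maker_strategies_def)
        ultimately show ?thesis using W[OF True, of "maker_claims h'"] sub by (auto simp: unclaimed_def)
      qed
      then have "measure_pmf.prob ?K (- ?A) = 0" by (subst measure_pmf_zero_iff) blast
      then show ?thesis by simp
    next
      case False
      then show ?thesis by simp
    qed
  qed (auto intro!: measure_pmf.integrable_const_bound[where B = 1])
  then have "measure_pmf.prob (play_rounds X \<sigma> \<tau> (Suc k')) (- ?A) \<le> measure_pmf.prob ?p (- ?A)" by simp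
  then have "measure_pmf.prob ?p ?A \<le> measure_pmf.prob (play_rounds X \<sigma> \<tau> (Suc k')) ?A"
    by (simp add: measure_pmf.prob_compl[simplified] Compl_eq_Diff_UNIV)
  then show ?case using step.IH by linarith
qed

section \<open>Properties holding with high probability\<close>

text \<open>The error \<open>\<psi>\<close> is uniform over all spread distributions. This matters
  because Breaker's strategy, and with it \<open>p\<close>, may be chosen afresh for each
  \<open>n\<close>.\<close>

definition whp :: "real \<Rightarrow> (nat \<Rightarrow> nat set set \<Rightarrow> bool) \<Rightarrow> bool" where
  "whp C E \<longleftrightarrow> (\<exists>\<psi>. \<psi> \<longlonglongrightarrow> 0 \<and>
     (\<forall>n p. 0 < n \<longrightarrow> spread (C / real n) p \<longrightarrow>
        measure_pmf.prob p {M. M \<subseteq> complete_edges n \<and> \<not> E n M} \<le> \<psi> n))"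

lemma whpI:
  assumes "\<psi> \<longlonglongrightarrow> 0" "\<And>n p. 0 < n \<Longrightarrow> spread (C / real n) p \<Longrightarrow>
     measure_pmf.prob p {M. M \<subseteq> complete_edges n \<and> \<not> E n M} \<le> \<psi> n"
  shows "whp C E"
  using assms unfolding whp_def by blast

lemma whp_eventually_mono:
  assumes "whp C E" "eventually (\<lambda>n. \<forall>M. M \<subseteq> complete_edges n \<longrightarrow> E n M \<longrightarrow> E' n M) sequentially"
  shows "whp C E'"
proof -
  obtain \<psi> where \<psi>: "\<psi> \<longlonglongrightarrow> 0" "\<And>n p. 0 < n \<Longrightarrow> spread (C / real n) p \<Longrightarrow>
        measure_pmf.prob p {M. M \<subseteq> complete_edges n \<and> \<not> E n M} \<le> \<psi> n"
    using assms(1) unfolding whp_def by blast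
  obtain N where N: "\<And>n M. N \<le> n \<Longrightarrow> M \<subseteq> complete_edges n \<Longrightarrow> E n M \<Longrightarrow> E' n M"
    using assms(2) unfolding eventually_sequentially by blast
  show ?thesis
  proof (rule whpI)
    \<comment> \<open>The finitely many small \<open>n\<close> get the trivial bound 1.\<close>
    show "(\<lambda>n. if N \<le> n then \<psi> n else 1) \<longlonglongrightarrow> 0"
      by (rule Lim_transform_eventually[OF \<psi>(1)])
        (use eventually_ge_at_top[of N] in \<open>rule eventually_mono\<close>, auto)
    fix n :: nat and p :: "nat set set pmf" assume np: "0 < n" "spread (C / real n) p"
    show "measure_pmf.prob p {M. M \<subseteq> complete_edges n \<and> \<not> E' n M} \<le> (if N \<le> n then \<psi> n else 1)"
    proof (cases "N \<le> n")
      case True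
      have "measure_pmf.prob p {M. M \<subseteq> complete_edges n \<and> \<not> E' n M} \<le>
          measure_pmf.prob p {M. M \<subseteq> complete_edges n \<and> \<not> E n M}"
        by (rule measure_pmf.finite_measure_mono) (use N[OF True] in auto)
      then show ?thesis using \<psi>(2)[OF np] True by simp
    qed simp
  qed
qed

lemma whp_mono: "whp C E \<Longrightarrow> (\<And>n M. M \<subseteq> complete_edges n \<Longrightarrow> E n M \<Longrightarrow> E' n M) \<Longrightarrow> whp C E'"
  by (rule whp_eventually_mono) auto

lemma whp_conj:
  assumes "whp C E" "whp C E'"
  shows "whp C (\<lambda>n M. E n M \<and> E' n M)"
proof -
  obtain \<psi> where \<psi>: "\<psi> \<longlonglongrightarrow> 0" "\<And>n p. 0 < n \<Longrightarrow> spread (C / real n) p \<Longrightarrow>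
        measure_pmf.prob p {M. M \<subseteq> complete_edges n \<and> \<not> E n M} \<le> \<psi> n"
    using assms(1) unfolding whp_def by blast
  obtain \<psi>' where \<psi>': "\<psi>' \<longlonglongrightarrow> 0" "\<And>n p. 0 < n \<Longrightarrow> spread (C / real n) p \<Longrightarrow>
        measure_pmf.prob p {M. M \<subseteq> complete_edges n \<and> \<not> E' n M} \<le> \<psi>' n"
    using assms(2) unfolding whp_def by blast
  show ?thesis
  proof (rule whpI)
    show "(\<lambda>n. \<psi> n + \<psi>' n) \<longlonglongrightarrow> 0" using tendsto_add[OF \<psi>(1) \<psi>'(1)] by simp
    fix n :: nat and p :: "nat set set pmf" assume np: "0 < n" "spread (C / real n) p"
    have "measure_pmf.prob p {M. M \<subseteq> complete_edges n \<and> \<not> (E n M \<and> E' n M)} \<le>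
        measure_pmf.prob p ({M. M \<subseteq> complete_edges n \<and> \<not> E n M} \<union> {M. M \<subseteq> complete_edges n \<and> \<not> E' n M})"
      by (rule measure_pmf.finite_measure_mono) auto
    also have "\<dots> \<le> measure_pmf.prob p {M. M \<subseteq> complete_edges n \<and> \<not> E n M} +
        measure_pmf.prob p {M. M \<subseteq> complete_edges n \<and> \<not> E' n M}"
      by (rule measure_subadditive) (auto simp: measure_pmf.emeasure_eq_measure)
    also have "\<dots> \<le> \<psi> n + \<psi>' n" using \<psi>(2)[OF np] \<psi>'(2)[OF np] by simp
    finally show "measure_pmf.prob p {M. M \<subseteq> complete_edges n \<and> \<not> (E n M \<and> E' n M)} \<le> \<psi> n + \<psi>' n" .
  qed
qed

section \<open>First-moment estimates\<close>

lemma spread_many_edges: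
  assumes p: "spread c p" and A: "finite A"
  shows "measure_pmf.prob p {M. r \<le> card (M \<inter> A)} \<le> real (card A choose r) * c ^ r"
proof -
  let ?S = "{S. S \<subseteq> A \<and> card S = r}"
  \<comment> \<open>Union bound over all \<open>r\<close>-element subsets of
    \<open>A\<close>.\<close>
  have "{M. r \<le> card (M \<inter> A)} \<subseteq> (\<Union>S\<in>?S. {M. S \<subseteq> M})"
  proof
    fix M assume "M \<in> {M. r \<le> card (M \<inter> A)}"
    then obtain S where "S \<subseteq> M \<inter> A" "card S = r"
      by (metis mem_Collect_eq obtain_subset_with_card_n)
    then show "M \<in> (\<Union>S\<in>?S. {M. S \<subseteq> M})" by auto
  qed
  then have "measure_pmf.prob p {M. r \<le> card (M \<inter> A)} \<le> measure_pmf.prob p (\<Union>S\<in>?S. {M. S \<subseteq> M})"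
    by (rule measure_pmf.finite_measure_mono) simp
  also have "\<dots> \<le> (\<Sum>S\<in>?S. measure_pmf.prob p {M. S \<subseteq> M})"
    by (rule measure_pmf.finite_measure_subadditive_finite) (use A in auto)
  also have "\<dots> \<le> (\<Sum>S\<in>?S. c ^ r)"
  proof (rule sum_mono)
    fix S assume "S \<in> ?S"
    then have "finite S" "card S = r" using A finite_subset by auto
    then show "measure_pmf.prob p {M. S \<subseteq> M} \<le> c ^ r" using p unfolding spread_def by blast
  qed
  also have "\<dots> = real (card A choose r) * c ^ r"
    using n_subsets[OF A, of r] by simp
  finally show ?thesis .
qed

text \<open>A single term of the exponential series; it replaces Stirling's formula.\<close>

lemma power_le_exp_fact: "real r ^ r \<le> exp (real r) * fact r"
proof -
  have "(\<Sum>i\<in>{r}. real r ^ i / fact i) \<le> exp (real r)"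
    unfolding exp_def
    using sum_le_suminf[OF summable_exp_generic[of "real r"], of "{r}"]
    by (simp add: divide_inverse mult.commute scaleR_conv_of_real)
  then show ?thesis by (simp add: field_simps)
qed

lemma binomial_le_exp:
  assumes "0 < r"
  shows "real (N choose r) \<le> (exp 1 * real N / real r) ^ r"
proof -
  have "real (N choose r) * fact r \<le> real N ^ r"
    using binomial_fact_pow[of N r] by (metis of_nat_fact of_nat_le_iff of_nat_mult of_nat_power)
  then have "real (N choose r) \<le> real N ^ r / fact r" by (simp add: field_simps)
  also have "\<dots> \<le> real N ^ r * (exp (real r) / real r ^ r)"
  proof -
    have "1 / fact r \<le> exp (real r) / real r ^ r"
      using power_le_exp_fact[of r] assms by (simp add: field_simps)
    then have "real N ^ r * (1 / fact r) \<le> real N ^ r * (exp (real r) / real r ^ r)"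
      by (rule mult_left_mono) simp
    then show ?thesis by simp
  qed
  also have "\<dots> = (exp 1 * real N / real r) ^ r"
    by (simp add: power_mult_distrib power_divide exp_of_nat_mult[symmetric])
  finally show ?thesis .
qed

lemma spread_many_edges_exp:
  assumes p: "spread c p" and A: "finite A" and c: "0 \<le> c" and r: "0 < r"
    and N: "real (card A) \<le> N"
  shows "measure_pmf.prob p {M. r \<le> card (M \<inter> A)} \<le> (exp 1 * N * c / real r) ^ r"
proof -
  have "measure_pmf.prob p {M. r \<le> card (M \<inter> A)} \<le> real (card A choose r) * c ^ r"
    by (rule spread_many_edges[OF p A])
  also have "\<dots> \<le> (exp 1 * real (card A) / real r) ^ r * c ^ r"
    using binomial_le_exp[OF r] c by (intro mult_right_mono) auto
  also have "\<dots> = (exp 1 * real (card A) * c / real r) ^ r"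
    by (simp add: power_mult_distrib[symmetric])
  also have "\<dots> \<le> (exp 1 * N * c / real r) ^ r"
    using N c by (intro power_mono divide_right_mono mult_right_mono mult_left_mono) auto
  finally show ?thesis .
qed

lemma card_pairs: "finite U \<Longrightarrow> finite {e. e \<subseteq> U \<and> card e = 2} \<and>
    card {e. e \<subseteq> U \<and> card e = 2} \<le> card U * card U"
proof -
  assume U: "finite U"
  have "card {e. e \<subseteq> U \<and> card e = 2} = card U choose 2" by (rule n_subsets[OF U])
  also have "\<dots> \<le> card U ^ 2" 
    using binomial_fact_pow[of "card U" 2] by (simp add: numeral_eq_Suc)
  finally show ?thesis using U by (simp add: power2_eq_square)
qed

lemma inner_edges_pairs:
  assumes "M \<subseteq> complete_edges n"
  shows "inner_edges M U = M \<inter> {e. e \<subseteq> U \<and> card e = 2}"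
  using assms by (auto simp: inner_edges_def complete_edges_def)

abbreviation locally_sparse :: "real \<Rightarrow> real \<Rightarrow> nat \<Rightarrow> nat set set \<Rightarrow> bool" where
  "locally_sparse \<beta> \<eta> n M \<equiv> \<forall>U. U \<subseteq> {..<n} \<longrightarrow> real (card U) \<le> \<beta> * real n \<longrightarrow>
     real (card (inner_edges M U)) \<le> (1 + \<eta>) * real (card U)"

text \<open>With \<open>y = e C u / n\<close>, a fixed set of size \<open>u\<close> is too dense
  with probability at most \<open>y ^ ((1 + \<eta>) u)\<close>, and there are at most
  \<open>(e n / u) ^ u\<close> such sets. The product is \<open>(K * y ^ \<eta>) ^ u\<close>, since
  \<open>e n / u * y = K\<close>; it decays geometrically as soon as \<open>y\<close> is bounded by
  a small constant, which is what \<open>\<beta>\<close> achieves.\<close>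

lemma whp_locally_sparse:
  assumes C: "0 < C" and \<eta>: "0 < \<eta>" "\<eta> \<le> 1"
  shows "\<exists>\<beta>>0. whp C (\<lambda>n M. locally_sparse \<beta> \<eta> n M)"
proof -
  define K where "K = exp 1 * C * exp 1"
  \<comment> \<open>The value of \<open>y\<close> at which \<open>K * y powr \<eta>\<close> equals
    1/4.\<close>
  define z where "z = (1 / (4 * K)) powr (1 / \<eta>)"
  define \<beta> where "\<beta> = min 1 z / (exp 1 * C)"
  have K: "0 < K" using C by (simp add: K_def)
  have z: "0 < z" unfolding z_def using K by simp
  have \<beta>: "0 < \<beta>" unfolding \<beta>_def using C z by simp
  define \<psi> where "\<psi> n = 4 * K * (exp 1 * C / real n) powr \<eta>" for n :: nat
  have "whp C (\<lambda>n M. locally_sparse \<beta> \<eta> n M)"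
  proof (rule whpI)
    show "\<psi> \<longlonglongrightarrow> 0"
      unfolding \<psi>_def using C \<eta> by real_asymp
    fix n :: nat and p :: "nat set set pmf" assume n: "0 < n" and p: "spread (C / real n) p"
    \<comment> \<open>The least integer exceeding \<open>(1 + \<eta>) * u\<close>.\<close>
    define r where "r u = nat \<lfloor>(1 + \<eta>) * real u\<rfloor> + 1" for u
    have r1: "(1 + \<eta>) * real u \<le> real (r u)" "0 < r u" for u
      unfolding r_def by linarith+
    have r2: "r u \<le> k" if "(1 + \<eta>) * real u < real k" for u k
    proof -
      have "\<lfloor>(1 + \<eta>) * real u\<rfloor> < int k" using that by (simp add: floor_less_iff)
      moreover have "0 \<le> \<lfloor>(1 + \<eta>) * real u\<rfloor>" using \<eta> by simp
      ultimately show ?thesis unfolding r_def by linarith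
    qed
    define I where "I = {u. 0 < u \<and> u \<le> n \<and> real u \<le> \<beta> * real n}"
    have finI: "finite I" unfolding I_def by (rule finite_subset[of _ "{..n}"]) auto
    let ?F = "\<lambda>u. {U. U \<subseteq> {..<n} \<and> card U = u}"
    let ?A = "\<lambda>U. {M :: nat set set. r (card U) \<le> card (M \<inter> {e. e \<subseteq> U \<and> card e = 2})}"
    let ?bad = "{M. M \<subseteq> complete_edges n \<and> \<not> (locally_sparse \<beta> \<eta> n M)}"
    have "?bad \<subseteq> (\<Union>u\<in>I. \<Union>U\<in>?F u. ?A U)"
    proof
      fix M assume "M \<in> ?bad"
      then obtain U where U: "M \<subseteq> complete_edges n" "U \<subseteq> {..<n}" "real (card U) \<le> \<beta> * real n"
        "(1 + \<eta>) * real (card U) < real (card (inner_edges M U))" by auto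
      have "card U \<noteq> 0"
      proof
        assume "card U = 0"
        then have "U = {}" using U(2) finite_subset by fastforce
        then have "inner_edges M U = {}"
          using U(1) by (auto simp: inner_edges_def complete_edges_def)
        then show False using U(4) \<open>card U = 0\<close> by simp
      qed
      moreover have "card U \<le> n" using card_mono[OF _ U(2)] by simp
      ultimately have "card U \<in> I" using U(3) unfolding I_def by simp
      moreover have "M \<in> ?A U" using r2[OF U(4)] inner_edges_pairs[OF U(1)] by simp
      ultimately show "M \<in> (\<Union>u\<in>I. \<Union>U\<in>?F u. ?A U)" using U(2) by blast
    qed
    then have "measure_pmf.prob p ?bad \<le> measure_pmf.prob p (\<Union>u\<in>I. \<Union>U\<in>?F u. ?A U)"
      by (rule measure_pmf.finite_measure_mono) simp
    also have "\<dots> \<le> (\<Sum>u\<in>I. measure_pmf.prob p (\<Union>U\<in>?F u. ?A U))"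
      by (rule measure_pmf.finite_measure_subadditive_finite[OF finI]) simp
    also have "\<dots> \<le> (\<Sum>u\<in>I. \<psi> n * (1 / 2) ^ u)"
    proof (rule sum_mono)
      fix u assume "u \<in> I"
      then have u: "0 < u" "u \<le> n" "real u \<le> \<beta> * real n" by (auto simp: I_def)
      define y where "y = exp 1 * C * real u / real n"
      have "y \<le> exp 1 * C * (\<beta> * real n) / real n"
        unfolding y_def using u C by (intro divide_right_mono mult_left_mono) auto
      also have "\<dots> = min 1 z" using n C by (simp add: \<beta>_def)
      finally have y: "y \<le> 1" "y \<le> z" "0 < y" using u n C by (simp_all add: y_def)
      have A: "measure_pmf.prob p (?A U) \<le> y ^ u * (y powr \<eta>) ^ u"
        if U: "U \<in> ?F u" for U
      proof -
        have finU: "finite U" using U finite_subset by auto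
        have cU: "card U = u" using U by simp
        have "measure_pmf.prob p (?A U) \<le> (exp 1 * real (u * u) * (C / real n) / real (r u)) ^ r u"
        proof -
          have "real (card {e. e \<subseteq> U \<and> card e = 2}) \<le> real (u * u)"
            using card_pairs[OF finU] cU by (metis of_nat_le_iff)
          then show ?thesis
            unfolding cU
            by (intro spread_many_edges_exp p r1(2)) (use card_pairs[OF finU] C in auto)
        qed
        also have "\<dots> \<le> y ^ r u"
        proof (rule power_mono)
          have "real u \<le> (1 + \<eta>) * real u" using \<eta> by (simp add: distrib_right)
          then have ur: "real u \<le> real (r u)" using r1(1)[of u] by linarith
          have "exp 1 * real (u * u) * (C / real n) / real (r u) = y * (real u / real (r u))"
            unfolding y_def by simp
          also have "\<dots> \<le> y * 1" using ur y u by (intro mult_left_mono) (auto simp: r_def)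
          finally show "exp 1 * real (u * u) * (C / real n) / real (r u) \<le> y" by simp
        qed (use C in auto)
        also have "\<dots> = y powr real (r u)" using y by (simp add: powr_realpow)
        also have "\<dots> \<le> y powr ((1 + \<eta>) * real u)"
          by (rule powr_mono'[OF r1(1)]) (use y in auto)
        also have "\<dots> = y ^ u * (y powr \<eta>) ^ u"
          using y by (simp add: powr_realpow[symmetric] powr_powr powr_add[symmetric] algebra_simps)
        finally show ?thesis .
      qed
      define x where "x = K * y powr \<eta>"
      have x14: "x \<le> 1 / 4"
      proof -
        have "y powr \<eta> \<le> z powr \<eta>" using y \<eta> by (intro powr_mono2) auto
        also have "\<dots> = 1 / (4 * K)" unfolding z_def using \<eta> K by (simp add: powr_powr)
        finally show ?thesis unfolding x_def using K by (simp add: field_simps)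
      qed
      have x0: "0 \<le> x" unfolding x_def using K by simp
      have "measure_pmf.prob p (\<Union>U\<in>?F u. ?A U) \<le> (\<Sum>U\<in>?F u. measure_pmf.prob p (?A U))"
        by (rule measure_pmf.finite_measure_subadditive_finite) auto
      also have "\<dots> \<le> (\<Sum>U\<in>?F u. y ^ u * (y powr \<eta>) ^ u)"
        by (rule sum_mono) (rule A)
      also have "\<dots> = real (n choose u) * (y ^ u * (y powr \<eta>) ^ u)"
        using n_subsets[of "{..<n}" u] by simp
      also have "\<dots> \<le> (exp 1 * real n / real u) ^ u * (y ^ u * (y powr \<eta>) ^ u)"
        using binomial_le_exp[OF u(1)] y by (intro mult_right_mono) auto
      also have "\<dots> = ((exp 1 * real n / real u * y) * y powr \<eta>) ^ u"
        by (simp only: power_mult_distrib mult.assoc)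
      also have "exp 1 * real n / real u * y = K" unfolding K_def y_def using u n by simp
      also have "(K * y powr \<eta>) ^ u = x ^ u" unfolding x_def ..
      \<comment> \<open>One factor \<open>x\<close> is split off: it carries the power of
        \<open>n\<close> that makes the whole sum vanish, while the rest is geometric. Its
        dependence on \<open>u\<close> is crudely bounded by \<open>2 ^ u\<close>.\<close>
      also have "\<dots> = x * x ^ (u - 1)" using u(1) by (cases u) auto
      also have "\<dots> \<le> x * (1 / 4) ^ (u - 1)"
        using x14 x0 by (intro mult_left_mono power_mono) auto
      also have "\<dots> = 4 * x * (1 / 4) ^ u" using u(1) by (cases u) auto
      also have "\<dots> \<le> 4 * (K * (exp 1 * C / real n) powr \<eta> * 2 ^ u) * (1 / 4) ^ u"
      proof -
        have "y powr \<eta> = (exp 1 * C / real n) powr \<eta> * real u powr \<eta>"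
          unfolding y_def using C n u by (simp add: powr_mult[symmetric])
        also have "real u powr \<eta> \<le> real u powr 1" using u \<eta> by (intro powr_mono) auto
        also have "real u powr 1 \<le> 2 ^ u" using u of_nat_less_two_power[of u, where 'a = real] by simp
        finally have "y powr \<eta> \<le> (exp 1 * C / real n) powr \<eta> * 2 ^ u" by (simp add: mult_left_mono)
        then have "x \<le> K * ((exp 1 * C / real n) powr \<eta> * 2 ^ u)"
          unfolding x_def using K by (intro mult_left_mono) auto
        then show ?thesis by simp
      qed
      also have "\<dots> = \<psi> n * (2 ^ u * (1 / 4) ^ u)" unfolding \<psi>_def by simp
      also have "(2 ^ u * (1 / 4) ^ u :: real) = (1 / 2) ^ u" by (simp add: power_mult_distrib[symmetric])
      finally show "measure_pmf.prob p (\<Union>U\<in>?F u. ?A U) \<le> \<psi> n * (1 / 2) ^ u" .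
    qed
    also have "\<dots> = \<psi> n * (\<Sum>u\<in>I. (1 / 2) ^ u)" by (simp add: sum_distrib_left)
    also have "\<dots> \<le> \<psi> n * 1"
    proof (rule mult_left_mono)
      have "(\<Sum>u\<in>I. (1 / 2 :: real) ^ u) \<le> (\<Sum>u\<in>{1..n}. (1 / 2) ^ u)"
        by (rule sum_mono2) (auto simp: I_def)
      also have "\<dots> \<le> 1" by (simp add: sum_gp)
      finally show "(\<Sum>u\<in>I. (1 / 2 :: real) ^ u) \<le> 1" .
      show "0 \<le> \<psi> n" unfolding \<psi>_def using K by simp
    qed
    finally show "measure_pmf.prob p ?bad \<le> \<psi> n" by simp
  qed
  then show ?thesis using \<beta> by blast
qed

lemma finite_graph_complete: "M \<subseteq> complete_edges n \<Longrightarrow> finite_graph M {..<n}"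
  by unfold_locales (auto simp: complete_edges_def)

lemma choose_le_power: "n choose k \<le> n ^ k"
proof -
  have "(n choose k) * 1 \<le> (n choose k) * fact k" by (intro mult_left_mono) simp_all
  then show ?thesis using binomial_fact_pow[of n k] by linarith
qed

abbreviation few_touching :: "real \<Rightarrow> real \<Rightarrow> nat \<Rightarrow> nat set set \<Rightarrow> bool" where
  "few_touching \<theta> \<rho> n M \<equiv> \<forall>X. X \<subseteq> {..<n} \<longrightarrow> real (card X) \<le> \<theta> * real n \<longrightarrow>
     real (card (touching_edges M X)) \<le> \<rho> * real n"

text \<open>There are at most \<open>2 ^ n\<close> sets \<open>X\<close>, and each has at most
  \<open>\<theta> * n * n\<close> potential edges. For small \<open>\<theta>\<close> the probability
  that more than \<open>\<rho> * n\<close> of them are present is at most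
  \<open>(1 / 4) ^ n\<close>.\<close>

lemma whp_few_touching:
  assumes C: "0 < C" and \<rho>: "0 < \<rho>"
  shows "\<exists>\<theta>>0. whp C (\<lambda>n M. few_touching \<theta> \<rho> n M)"
proof -
  define z :: real where "z = (1 / 4) powr (1 / \<rho>)"
  \<comment> \<open>Makes \<open>e * \<theta> * C / \<rho>\<close>, the base of the tail bound,
    equal to \<open>z\<close>, where \<open>z powr \<rho>\<close> is 1/4.\<close>
  define \<theta> where "\<theta> = \<rho> * z / (exp 1 * C)"
  have z: "0 < z" "z \<le> 1" using \<rho> powr_mono2[of "1 / \<rho>" "1 / 4" 1] by (simp_all add: z_def)
  have \<theta>: "0 < \<theta>" unfolding \<theta>_def using C z \<rho> by simp
  have "whp C (\<lambda>n M. few_touching \<theta> \<rho> n M)"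
  proof (rule whpI)
    show "(\<lambda>n. (1 / 2 :: real) ^ n) \<longlonglongrightarrow> 0" by real_asymp
    fix n :: nat and p :: "nat set set pmf" assume n: "0 < n" and p: "spread (C / real n) p"
    define r where "r = nat \<lfloor>\<rho> * real n\<rfloor> + 1"
    have r1: "\<rho> * real n \<le> real r" "0 < r" unfolding r_def by linarith+
    have r2: "r \<le> k" if "\<rho> * real n < real k" for k
    proof -
      have "\<lfloor>\<rho> * real n\<rfloor> < int k" using that by (simp add: floor_less_iff)
      moreover have "0 \<le> \<lfloor>\<rho> * real n\<rfloor>" using \<rho> by simp
      ultimately show ?thesis unfolding r_def by linarith
    qed
    let ?F = "{X. X \<subseteq> {..<n} \<and> real (card X) \<le> \<theta> * real n}"
    let ?E = "\<lambda>X. {e \<in> complete_edges n. e \<inter> X \<noteq> {}}"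
    let ?A = "\<lambda>X. {M. r \<le> card (M \<inter> ?E X)}"
    let ?bad = "{M. M \<subseteq> complete_edges n \<and> \<not> (few_touching \<theta> \<rho> n M)}"
    have F: "finite ?F" "card ?F \<le> 2 ^ n"
    proof -
      have sub: "?F \<subseteq> Pow {..<n}" by auto
      show "finite ?F" by (rule finite_subset[OF sub]) simp
      have "card ?F \<le> card (Pow {..<n})" by (rule card_mono[OF _ sub]) simp
      then show "card ?F \<le> 2 ^ n" by (simp add: card_Pow)
    qed
    have "?bad \<subseteq> (\<Union>X\<in>?F. ?A X)"
    proof
      fix M assume "M \<in> ?bad"
      then obtain X where X: "M \<subseteq> complete_edges n" "X \<in> ?F"
        "\<rho> * real n < real (card (touching_edges M X))" by auto
      have "touching_edges M X = M \<inter> ?E X" using X(1) by (auto simp: touching_edges_def)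
      then have "M \<in> ?A X" using r2[OF X(3)] by simp
      then show "M \<in> (\<Union>X\<in>?F. ?A X)" using X(2) by blast
    qed
    then have "measure_pmf.prob p ?bad \<le> measure_pmf.prob p (\<Union>X\<in>?F. ?A X)"
      by (rule measure_pmf.finite_measure_mono) simp
    also have "\<dots> \<le> (\<Sum>X\<in>?F. measure_pmf.prob p (?A X))"
      by (rule measure_pmf.finite_measure_subadditive_finite[OF F(1)]) simp
    also have "\<dots> \<le> (\<Sum>X\<in>?F. (1 / 4) ^ n)"
    proof (rule sum_mono)
      fix X assume X: "X \<in> ?F"
      have finX: "finite X" using X finite_subset by auto
      have "?E X \<subseteq> (\<lambda>(x, y). {x, y}) ` (X \<times> {..<n})"
      proof
        fix e assume e: "e \<in> ?E X"
        then obtain x where x: "x \<in> X" "x \<in> e" by blast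
        then obtain y where y: "e = {x, y}"
          using finite_graph.edge_obtain[OF finite_graph_complete[OF order_refl], of e n x] e by blast
        moreover have "y < n" using e y by (auto simp: complete_edges_def)
        ultimately show "e \<in> (\<lambda>(x, y). {x, y}) ` (X \<times> {..<n})" using x by force
      qed
      then have "card (?E X) \<le> card ((\<lambda>(x, y). {x, y}) ` (X \<times> {..<n}))"
        by (intro card_mono) (use finX in auto)
      also have "\<dots> \<le> card (X \<times> {..<n})" by (rule card_image_le) (use finX in auto)
      also have "\<dots> = card X * n" by (simp add: card_cartesian_product)
      finally have "real (card (?E X)) \<le> real (card X) * real n"
        by (metis of_nat_le_iff of_nat_mult)
      also have "\<dots> \<le> \<theta> * real n * real n" using X by (intro mult_right_mono) auto
      finally have "measure_pmf.prob p (?A X) \<le>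
          (exp 1 * (\<theta> * real n * real n) * (C / real n) / real r) ^ r"
        by (intro spread_many_edges_exp p r1(2)) (use C in auto)
      also have "\<dots> \<le> z ^ r"
      proof (rule power_mono)
        have "exp 1 * (\<theta> * real n * real n) * (C / real n) / real r = \<rho> * real n * z / real r"
          unfolding \<theta>_def using n C by simp
        also have "\<dots> \<le> real r * z / real r"
          using r1 z by (intro divide_right_mono mult_right_mono) auto
        also have "\<dots> = z" using r1(2) by simp
        finally show "exp 1 * (\<theta> * real n * real n) * (C / real n) / real r \<le> z" .
      qed (use C \<theta> in auto)
      also have "\<dots> = z powr real r" using z by (simp add: powr_realpow)
      also have "\<dots> \<le> z powr (\<rho> * real n)"
        by (rule powr_mono'[OF r1(1)]) (use z in auto)
      also have "\<dots> = (1 / 4) powr real n" unfolding z_def using \<rho> by (simp add: powr_powr)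
      also have "\<dots> = (1 / 4) ^ n" by (rule powr_realpow) simp
      finally show "measure_pmf.prob p (?A X) \<le> (1 / 4) ^ n" .
    qed
    also have "\<dots> = real (card ?F) * (1 / 4) ^ n" by simp
    also have "\<dots> \<le> 2 ^ n * (1 / 4) ^ n"
      using of_nat_mono[OF F(2), where 'a = real] by (intro mult_right_mono) simp_all
    also have "\<dots> = (1 / 2) ^ n" by (simp add: power_mult_distrib[symmetric])
    finally show "measure_pmf.prob p ?bad \<le> (1 / 2) ^ n" .
  qed
  then show ?thesis using \<theta> by blast
qed

text \<open>The counting version of short cycles: a nonempty set that spans at least as many edges
  as it has vertices contains one.\<close>

definition cyclic_sets :: "nat \<Rightarrow> nat \<Rightarrow> nat set set \<Rightarrow> nat set set" where
  "cyclic_sets n q M = {U. U \<subseteq> {..<n} \<and> U \<noteq> {} \<and> card U \<le> q \<and> card U \<le> card (inner_edges M U)}"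

text \<open>The expected number of cyclic sets of bounded size is bounded, so Markov's inequality applies.\<close>

lemma whp_few_cyclic:
  assumes C: "0 < C" and \<theta>: "0 < \<theta>"
  shows "whp C (\<lambda>n M. real (card (\<Union> (cyclic_sets n q M))) \<le> \<theta> * real n)"
proof (rule whpI)
  \<comment> \<open>Bounds the expected number of cyclic sets: \<open>n ^ u\<close> vertex sets of
    size \<open>u\<close>, at most \<open>(u * u) ^ u\<close> choices of \<open>u\<close> edges,
    each present with probability at most \<open>(C / n) ^ u\<close>. The powers of \<open>n\<close>
    cancel.\<close>
  define K where "K = (\<Sum>u\<in>{1..q}. (real u ^ 2 * C) ^ u)"
  show "(\<lambda>n. real q * K / (\<theta> * real n)) \<longlonglongrightarrow> 0" using \<theta> by real_asymp
  fix n :: nat and p :: "nat set set pmf" assume n: "0 < n" and p: "spread (C / real n) p"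
  let ?F = "\<lambda>u. {U. U \<subseteq> {..<n} \<and> card U = u}"
  let ?A = "\<lambda>U. {M :: nat set set. card U \<le> card (M \<inter> {e. e \<subseteq> U \<and> card e = 2})}"
  define g where "g M = real q * (\<Sum>u\<in>{1..q}. \<Sum>U\<in>?F u. indicator (?A U) M)" for M
  have int: "integrable (measure_pmf p) (indicator B :: _ \<Rightarrow> real)" for B
    by (rule measure_pmf.integrable_const_bound[where B = 1]) auto
  have gle: "real (card (\<Union> (cyclic_sets n q M))) \<le> g M" if M: "M \<subseteq> complete_edges n" for M
  proof -
    let ?B = "cyclic_sets n q M"
    have finB: "finite ?B" by (rule finite_subset[of _ "Pow {..<n}"]) (auto simp: cyclic_sets_def)
    have "card (\<Union>?B) \<le> (\<Sum>U\<in>?B. card U)" by (rule card_Union_le_sum_card)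
    also have "\<dots> \<le> (\<Sum>U\<in>?B. q)" by (rule sum_mono) (auto simp: cyclic_sets_def)
    finally have 1: "real (card (\<Union>?B)) \<le> real q * real (card ?B)"
      by (metis mult.commute of_nat_id of_nat_le_iff of_nat_mult sum_constant)
    have "?B \<subseteq> (\<Union>u\<in>{1..q}. {U \<in> ?F u. M \<in> ?A U})"
    proof
      fix U assume U: "U \<in> ?B"
      then have "card U \<noteq> 0" using finite_subset by (fastforce simp: cyclic_sets_def)
      then show "U \<in> (\<Union>u\<in>{1..q}. {U \<in> ?F u. M \<in> ?A U})"
        using U inner_edges_pairs[OF M, of U] by (auto simp: cyclic_sets_def Suc_le_eq)
    qed
    then have "card ?B \<le> card (\<Union>u\<in>{1..q}. {U \<in> ?F u. M \<in> ?A U})"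
      by (intro card_mono) auto
    also have "\<dots> \<le> (\<Sum>u\<in>{1..q}. card {U \<in> ?F u. M \<in> ?A U})" by (rule card_UN_le) simp
    finally have "real (card ?B) \<le> real (\<Sum>u\<in>{1..q}. card {U \<in> ?F u. M \<in> ?A U})"
      by (rule of_nat_mono)
    also have "\<dots> = (\<Sum>u\<in>{1..q}. real (card {U \<in> ?F u. M \<in> ?A U}))" by (rule of_nat_sum)
    also have "\<dots> = (\<Sum>u\<in>{1..q}. \<Sum>U\<in>?F u. indicator (?A U) M)"
    proof (rule sum.cong[OF refl])
      fix u
      have "(\<Sum>U\<in>?F u. indicator (?A U) M :: real) = (\<Sum>U\<in>{U \<in> ?F u. M \<in> ?A U}. 1)"
        by (rule sum.mono_neutral_cong_right) (auto simp: indicator_def)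
      then show "real (card {U \<in> ?F u. M \<in> ?A U}) = (\<Sum>U\<in>?F u. indicator (?A U) M)" by simp
    qed
    finally have "real q * real (card ?B) \<le> g M" unfolding g_def by (rule mult_left_mono) simp
    then show ?thesis using 1 by linarith
  qed
  have intg: "integrable (measure_pmf p) g"
    unfolding g_def by (intro Bochner_Integration.integrable_mult_right Bochner_Integration.integrable_sum int)
  have Eg: "measure_pmf.expectation p g \<le> real q * K"
  proof -
    have "measure_pmf.expectation p g =
        real q * (\<Sum>u\<in>{1..q}. \<Sum>U\<in>?F u. measure_pmf.prob p (?A U))"
      unfolding g_def
      by (simp add: Bochner_Integration.integral_sum int Bochner_Integration.integrable_sum)
    also have "\<dots> \<le> real q * K"
      unfolding K_def
    proof (intro mult_left_mono sum_mono)
      fix u assume u: "u \<in> {1..q}"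
      have "measure_pmf.prob p (?A U) \<le> real u ^ (2 * u) * (C / real n) ^ u" if U: "U \<in> ?F u" for U
      proof -
        have finU: "finite U" using U finite_subset by auto
        have cU: "card U = u" using U by simp
        let ?E = "{e. e \<subseteq> U \<and> card e = 2}"
        have "measure_pmf.prob p (?A U) \<le> real (card ?E choose u) * (C / real n) ^ u"
          unfolding cU by (rule spread_many_edges[OF p]) (use card_pairs[OF finU] in auto)
        also have "real (card ?E choose u) \<le> real u ^ (2 * u)"
        proof -
          have "card ?E choose u \<le> card ?E ^ u"
            by (rule choose_le_power)
          also have "\<dots> \<le> (u * u) ^ u" using card_pairs[OF finU] cU by (intro power_mono) auto
          also have "\<dots> = u ^ (2 * u)" by (simp add: power_mult power2_eq_square)
          finally show ?thesis by (metis of_nat_le_iff of_nat_power)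
        qed
        finally show ?thesis using C by (simp add: mult_right_mono)
      qed
      then have "(\<Sum>U\<in>?F u. measure_pmf.prob p (?A U)) \<le> (\<Sum>U\<in>?F u. real u ^ (2 * u) * (C / real n) ^ u)"
        by (rule sum_mono)
      also have "\<dots> = real (n choose u) * (real u ^ (2 * u) * (C / real n) ^ u)"
        using n_subsets[of "{..<n}" u] by simp
      also have "\<dots> \<le> real n ^ u * (real u ^ (2 * u) * (C / real n) ^ u)"
      proof (rule mult_right_mono)
        have "n choose u \<le> n ^ u"
          by (rule choose_le_power)
        then show "real (n choose u) \<le> real n ^ u" by (metis of_nat_le_iff of_nat_power)
      qed (use C in auto)
      also have "\<dots> = (real u ^ 2 * C) ^ u"
        using n by (simp add: power_mult power_mult_distrib power_divide)
      finally show "(\<Sum>U\<in>?F u. measure_pmf.prob p (?A U)) \<le> (real u ^ 2 * C) ^ u" .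
    qed simp
    finally show ?thesis .
  qed
  let ?bad = "{M. M \<subseteq> complete_edges n \<and> \<not> real (card (\<Union> (cyclic_sets n q M))) \<le> \<theta> * real n}"
  have "?bad \<subseteq> {M \<in> space (measure_pmf p). \<theta> * real n \<le> g M}"
  proof
    fix M assume "M \<in> ?bad"
    then show "M \<in> {M \<in> space (measure_pmf p). \<theta> * real n \<le> g M}"
      using gle[of M] by simp
  qed
  then have "measure_pmf.prob p ?bad \<le> measure_pmf.prob p {M \<in> space (measure_pmf p). \<theta> * real n \<le> g M}"
    by (rule measure_pmf.finite_measure_mono) simp
  also have "\<dots> \<le> measure_pmf.expectation p g / (\<theta> * real n)"
  proof (rule integral_Markov_inequality_measure[where A = "{}", OF intg])
    have "0 \<le> g M" for M unfolding g_def by (intro mult_nonneg_nonneg sum_nonneg) simp_all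
    then show "AE M in measure_pmf p. 0 \<le> g M" by simp
  qed (use n \<theta> in simp_all)
  also have "\<dots> \<le> real q * K / (\<theta> * real n)"
    using Eg \<theta> n by (intro divide_right_mono) auto
  finally show "measure_pmf.prob p ?bad \<le> real q * K / (\<theta> * real n)" .
qed

section \<open>Vertices at bounded distance\<close>

definition near :: "'v set set \<Rightarrow> 'v set \<Rightarrow> nat \<Rightarrow> 'v set" where
  "near G X r = {y. \<exists>x\<in>X. linked G UNIV r x y}"

lemma linked_1: "linked G S (Suc 0) x y \<longleftrightarrow> x = y \<and> x \<in> S"
proof
  assume "linked G S (Suc 0) x y"
  then obtain p where "p \<noteq> []" "hd p = x" "last p = y" "set p \<subseteq> S" "length p \<le> Suc 0"
    unfolding linked_def by auto
  then show "x = y \<and> x \<in> S" by (cases p) auto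
qed (auto intro: linked_refl)

lemma near_Suc: "near G X (Suc (Suc r)) \<subseteq> near G X (Suc r) \<union> neighborhood G (near G X (Suc r))"
proof
  fix y assume "y \<in> near G X (Suc (Suc r))"
  then obtain x where x: "x \<in> X" "linked G UNIV (Suc (Suc r)) x y" by (auto simp: near_def)
  from linked_unstep[OF x(2)] consider "x = y" |
    z where "linked G UNIV (Suc r) x z" "{z, y} \<in> G" by blast
  then show "y \<in> near G X (Suc r) \<union> neighborhood G (near G X (Suc r))"
  proof cases
    case 1
    have "linked G UNIV (Suc r) x x" by (rule linked_refl) simp_all
    then show ?thesis using x(1) 1 unfolding near_def by blast
  next
    case 2
    then have "z \<in> near G X (Suc r)" using x(1) unfolding near_def by blast
    then show ?thesis using 2(2) unfolding neighborhood_def by blast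
  qed
qed

lemma (in finite_graph) card_neighborhood_le: "card (neighborhood G X) \<le> card (touching_edges G X)"
proof -
  define par where "par y = (SOME x. x \<in> X \<and> {x, y} \<in> G)" for y
  have par: "par y \<in> X \<and> {par y, y} \<in> G" if "y \<in> neighborhood G X" for y
    unfolding par_def by (rule someI_ex) (use that in \<open>auto simp: neighborhood_def\<close>)
  show ?thesis
  proof (rule card_inj_on_le[where f = "\<lambda>y. {par y, y}"])
    show "inj_on (\<lambda>y. {par y, y}) (neighborhood G X)"
      by (rule inj_onI) (use par in \<open>auto simp: doubleton_eq_iff neighborhood_def\<close>)
    show "(\<lambda>y. {par y, y}) ` neighborhood G X \<subseteq> touching_edges G X"
      using par by (auto simp: touching_edges_def)
  qed simp
qed

lemma near_subset:
  assumes "M \<subseteq> complete_edges n" "X \<subseteq> {..<n}"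
  shows "near M X (Suc r) \<subseteq> {..<n}"
proof -
  interpret finite_graph M "{..<n}" by (rule finite_graph_complete[OF assms(1)])
  show ?thesis
  proof (induction r)
    case 0
    then show ?case using assms(2) by (auto simp: near_def linked_1)
  next
    case (Suc r)
    then show ?case using near_Suc[of M X r] neighborhood_subset by blast
  qed
qed

abbreviation small_near :: "real \<Rightarrow> real \<Rightarrow> nat \<Rightarrow> nat \<Rightarrow> nat set set \<Rightarrow> bool" where
  "small_near \<theta> \<zeta> r n M \<equiv> \<forall>X. X \<subseteq> {..<n} \<longrightarrow> real (card X) \<le> \<theta> * real n \<longrightarrow>
     real (card (near M X r)) \<le> \<zeta> * real n"

text \<open>One more step adds at most the neighbours of the set reached so far, whose number is at
  most that of the edges touching it. So a bound on touching edges is applied once per step, with a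
  target chosen small enough for the next.\<close>

lemma whp_small_near:
  assumes C: "0 < C" and \<zeta>: "0 < \<zeta>"
  shows "\<exists>\<theta>>0. whp C (\<lambda>n M. small_near \<theta> \<zeta> (Suc r) n M)"
  using \<zeta>
proof (induction r arbitrary: \<zeta>)
  case 0
  have near1: "near M X (Suc 0) = X" for M :: "nat set set" and X by (auto simp: near_def linked_1)
  have "whp C (\<lambda>n M. small_near \<zeta> \<zeta> (Suc 0) n M)"
    unfolding near1 by (rule whpI[of "\<lambda>_. 0"]) auto
  then show ?case using 0 by blast
next
  case (Suc r)
  obtain \<theta>1 where \<theta>1: "0 < \<theta>1" "whp C (\<lambda>n M. few_touching \<theta>1 (\<zeta> / 2) n M)"
    using whp_few_touching[OF C, of "\<zeta> / 2"] Suc.prems by auto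
  define \<zeta>' where "\<zeta>' = min \<theta>1 (\<zeta> / 2)"
  have "0 < \<zeta>'" using \<theta>1 Suc.prems by (simp add: \<zeta>'_def)
  then obtain \<theta> where \<theta>: "0 < \<theta>" "whp C (\<lambda>n M. small_near \<theta> \<zeta>' (Suc r) n M)"
    using Suc.IH by blast
  have "whp C (\<lambda>n M. small_near \<theta> \<zeta> (Suc (Suc r)) n M)"
  proof (rule whp_mono[OF whp_conj[OF \<theta>1(2) \<theta>(2)]], intro allI impI, elim conjE)
    fix n M X
    assume M: "M \<subseteq> complete_edges n" and X: "X \<subseteq> {..<n}" "real (card X) \<le> \<theta> * real n"
      and 1: "few_touching \<theta>1 (\<zeta> / 2) n M"
      and 2: "small_near \<theta> \<zeta>' (Suc r) n M"
    interpret finite_graph M "{..<n}" by (rule finite_graph_complete[OF M])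
    let ?Y = "near M X (Suc r)"
    have Y: "?Y \<subseteq> {..<n}" by (rule near_subset[OF M X(1)])
    have cY: "real (card ?Y) \<le> \<zeta>' * real n" using 2 X by blast
    have "\<zeta>' * real n \<le> \<theta>1 * real n" "\<zeta>' * real n \<le> \<zeta> / 2 * real n"
      unfolding \<zeta>'_def by (intro mult_right_mono; simp)+
    then have cY': "real (card ?Y) \<le> \<theta>1 * real n" "real (card ?Y) \<le> \<zeta> / 2 * real n"
      using cY by linarith+
    then have "real (card (touching_edges M ?Y)) \<le> \<zeta> / 2 * real n" using 1 Y by blast
    moreover have "card (neighborhood M ?Y) \<le> card (touching_edges M ?Y)"
      by (rule card_neighborhood_le)
    moreover have "card (near M X (Suc (Suc r))) \<le> card (?Y \<union> neighborhood M ?Y)"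
      by (rule card_mono[OF _ near_Suc]) (use Y finite_subset in auto)
    moreover have "card (?Y \<union> neighborhood M ?Y) \<le> card ?Y + card (neighborhood M ?Y)"
      by (rule card_Un_le)
    ultimately show "real (card (near M X (Suc (Suc r)))) \<le> \<zeta> * real n" using cY'(2) by linarith
  qed
  then show ?case using \<theta>(1) by blast
qed

section \<open>A dense core\<close>

text \<open>
  The core is a minimal set spanning at least \<open>c w + \<kappa> w\<^sup>2 / n\<close> edges, \<open>w\<close> being its size. The quadratic
  term is superadditive, which is what forces edges across every cut.
\<close>

lemma dense_core:
  fixes c \<kappa> :: real
  assumes M: "M \<subseteq> complete_edges n" and n: "0 < n" and c: "0 < c" and \<kappa>: "0 < \<kappa>"
    and dense: "(c + \<kappa>) * real n \<le> real (card M)"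
  obtains W where "W \<subseteq> {..<n}" "W \<noteq> {}" "finite_graph (inner_edges M W) W"
    "c * real (card W) \<le> real (card (inner_edges M W))"
    "\<And>U. U \<subseteq> W \<Longrightarrow> U \<noteq> {} \<Longrightarrow> c * real (card U) < real (card (touching_edges (inner_edges M W) U))"
    "\<And>U. U \<subseteq> W \<Longrightarrow> U \<noteq> {} \<Longrightarrow> U \<noteq> W \<Longrightarrow>
       real (card (inner_edges (inner_edges M W) U)) + 2 * \<kappa> * real (card U) * (real (card W) - real (card U)) / real n
         \<le> real (card (touching_edges (inner_edges M W) U))"
proof -
  define g where "g w = c * w + \<kappa> * w ^ 2 / real n" for w :: real
  define P where "P W \<longleftrightarrow> W \<subseteq> {..<n} \<and> W \<noteq> {} \<and> g (card W) \<le> card (inner_edges M W)" for W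
  have finM: "finite M" using M finite_subset finite_complete_edges by blast
  have "inner_edges M {..<n} = M" using M by (auto simp: inner_edges_def complete_edges_def)
  \<comment> \<open>For the whole vertex set the quadratic term is \<open>\<kappa> * n\<close>, so
    the required value is exactly \<open>(c + \<kappa>) * n\<close>.\<close>
  then have "P {..<n}"
    unfolding P_def g_def using n dense by (auto simp: power2_eq_square algebra_simps)
  then have "\<exists>W. P W \<and> (\<forall>W'. P W' \<longrightarrow> card W \<le> card W')"
    by (rule ex_has_least_nat)
  then obtain W where W: "P W" "\<And>W'. P W' \<Longrightarrow> card W \<le> card W'" by blast
  have Wn: "W \<subseteq> {..<n}" "W \<noteq> {}" "g (card W) \<le> card (inner_edges M W)" using W(1) by (auto simp: P_def)
  have finW: "finite W" using Wn finite_subset by blast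
  let ?G = "inner_edges M W"
  have fg: "finite_graph ?G W"
    by unfold_locales (use finW M in \<open>auto simp: inner_edges_def complete_edges_def\<close>)
  have small: "real (card (inner_edges M U)) < g (card U)" if "U \<subset> W" "U \<noteq> {}" for U
  proof (rule ccontr)
    assume "\<not> real (card (inner_edges M U)) < g (card U)"
    then have "P U" using that Wn by (auto simp: P_def)
    then have "card W \<le> card U" by (rule W(2))
    then show False using psubset_card_mono[OF finW that(1)] by simp
  qed
  have touch: "card (touching_edges ?G U) + card (inner_edges M (W - U)) = card ?G" if "U \<subseteq> W" for U
  proof -
    have "touching_edges ?G U \<inter> inner_edges M (W - U) = {}"
      by (auto simp: touching_edges_def inner_edges_def)
    moreover have "touching_edges ?G U \<union> inner_edges M (W - U) = ?G"
      by (auto simp: touching_edges_def inner_edges_def)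
    moreover have "finite (touching_edges ?G U)" "finite (inner_edges M (W - U))"
      using finM by (auto simp: touching_edges_def inner_edges_def)
    ultimately show ?thesis by (metis card_Un_disjoint)
  qed
  have w0: "0 < real (card W)" using Wn finW by (simp add: card_gt_0_iff)
  have gW: "c * real (card W) < real (card ?G)"
    using Wn(3) w0 n \<kappa> unfolding g_def by (auto intro: less_le_trans[rotated])
  \<comment> \<open>Removing \<open>U\<close> leaves a smaller set, which by minimality misses its
    required count; the edges touching \<open>U\<close> make up the difference.\<close>
  have cut: "g (real (card W)) - g (real (card W) - real (card U)) < real (card (touching_edges ?G U))"
    if U: "U \<subseteq> W" "U \<noteq> {}" "U \<noteq> W" for U
  proof -
    have "W - U \<subset> W" "W - U \<noteq> {}" using U by auto
    then have "real (card (inner_edges M (W - U))) < g (card (W - U))" by (rule small)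
    moreover have "card (W - U) = card W - card U"
      using U finW finite_subset by (metis card_Diff_subset)
    ultimately have "real (card (inner_edges M (W - U))) < g (real (card W) - real (card U))"
      using card_mono[OF finW U(1)] by (simp add: of_nat_diff)
    moreover have "real (card (touching_edges ?G U)) + real (card (inner_edges M (W - U))) = real (card ?G)"
      using touch[OF U(1)] by (metis of_nat_add)
    ultimately show ?thesis using Wn(3) by linarith
  qed
  have uw: "card U < card W" "0 < card U" if "U \<subseteq> W" "U \<noteq> {}" "U \<noteq> W" for U
    using psubset_card_mono[OF finW, of U] that finW finite_subset by (auto simp: card_gt_0_iff)
  show thesis
  proof (rule that[OF Wn(1,2) fg])
    show "c * real (card W) \<le> real (card ?G)" using gW by simp
    fix U assume U: "U \<subseteq> W" "U \<noteq> {}"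
    show "c * real (card U) < real (card (touching_edges ?G U))"
    proof (cases "U = W")
      case True
      have "e \<noteq> {}" if "e \<in> M" for e using M that by (auto simp: complete_edges_def)
      then have "touching_edges ?G W = ?G" by (auto simp: touching_edges_def inner_edges_def)
      then show ?thesis using gW True by simp
    next
      case False
      define a b where "a = real (card U)" and "b = real (card W) - real (card U)"
      have ab: "0 < a" "0 < b" "real (card W) = a + b" using uw[OF U False] by (auto simp: a_def b_def)
      have "g (a + b) - g b = c * a + \<kappa> * (a ^ 2 + 2 * a * b) / real n"
        unfolding g_def by (simp add: power2_sum algebra_simps diff_divide_distrib[symmetric] add_divide_distrib[symmetric])
      moreover have "0 \<le> \<kappa> * (a ^ 2 + 2 * a * b) / real n" using ab \<kappa> by simp
      moreover have "g (a + b) - g b < real (card (touching_edges ?G U))"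
        using cut[OF U False] by (simp only: a_def b_def add_diff_eq add_diff_cancel_left')
      ultimately show ?thesis unfolding a_def by linarith
    qed
    assume False: "U \<noteq> W"
    define a b where "a = real (card U)" and "b = real (card W) - real (card U)"
    have ab: "0 < a" "0 < b" "real (card W) = a + b" using uw[OF U False] by (auto simp: a_def b_def)
    \<comment> \<open>The mixed term of the square: the surplus of edges that must cross between
      \<open>U\<close> and \<open>W - U\<close>.\<close>
    have "g (a + b) - g b - g a = 2 * \<kappa> * a * b / real n"
      unfolding g_def by (simp add: power2_sum algebra_simps diff_divide_distrib[symmetric] add_divide_distrib[symmetric])
    moreover have "g (a + b) - g b < real (card (touching_edges ?G U))"
      using cut[OF U False] by (simp only: a_def b_def add_diff_eq add_diff_cancel_left')
    moreover have "real (card (inner_edges M U)) < g a" using small[of U] U False by (auto simp: a_def)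
    moreover have "card (inner_edges ?G U) = card (inner_edges M U)"
      using U by (intro arg_cong[where f = card]) (auto simp: inner_edges_def)
    ultimately have "real (card (inner_edges ?G U)) + 2 * \<kappa> * a * b / real n \<le> real (card (touching_edges ?G U))"
      by linarith
    then show "real (card (inner_edges ?G U)) + 2 * \<kappa> * real (card U) * (real (card W) - real (card U)) / real n
         \<le> real (card (touching_edges ?G U))" by (simp add: a_def b_def)
  qed
qed

section \<open>Branch vertices and their first trees\<close>

context finite_graph begin

lemma edges_at_le_neighbors: "card {e \<in> G. v \<in> e} \<le> card (neighborhood G {v})"
proof -
  have "{e \<in> G. v \<in> e} \<subseteq> (\<lambda>y. {v, y}) ` neighborhood G {v}"
  proof
    fix e assume "e \<in> {e \<in> G. v \<in> e}"
    then have e: "e \<in> G" "v \<in> e" by auto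
    then obtain y where "e = {v, y}" "v \<noteq> y" using edge_obtain by blast
    then show "e \<in> (\<lambda>y. {v, y}) ` neighborhood G {v}" using e by (auto simp: neighborhood_def)
  qed
  then have "card {e \<in> G. v \<in> e} \<le> card ((\<lambda>y. {v, y}) ` neighborhood G {v})"
    by (rule card_mono[rotated]) simp
  also have "\<dots> \<le> card (neighborhood G {v})" by (rule card_image_le) simp
  finally show ?thesis .
qed

lemma sum_degrees: "A \<subseteq> W \<Longrightarrow> (\<Sum>v\<in>A. card {e \<in> G. v \<in> e}) = (\<Sum>e\<in>G. card (e \<inter> A))"
proof -
  assume A: "A \<subseteq> W"
  have finA: "finite A" using A finite_sub by blast
  have "(\<Sum>v\<in>A. card {e \<in> G. v \<in> e}) = (\<Sum>v\<in>A. \<Sum>e\<in>G. if v \<in> e then 1 else 0)"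
    by (rule sum.cong) (simp_all add: sum.If_cases finite_G Int_def)
  also have "\<dots> = (\<Sum>e\<in>G. \<Sum>v\<in>A. if v \<in> e then 1 else 0)" by (rule sum.swap)
  also have "\<dots> = (\<Sum>e\<in>G. card (e \<inter> A))"
    by (rule sum.cong) (simp_all add: sum.If_cases finA Int_def conj_commute)
  finally show ?thesis .
qed

text \<open>Handshaking: vertices outside \<open>Z\<close> contribute at most \<open>D\<close> each,
  and the degrees in \<open>Z\<close> sum to at most twice the edges touching \<open>Z\<close>. An
  average degree above \<open>D\<close> thus forces \<open>Z\<close> to touch many edges.\<close>

lemma many_high_degree_vertices:
  assumes Z: "Z = {v \<in> W. D + 1 \<le> card (neighborhood G {v})}"
  shows "2 * card G \<le> D * card W + 2 * card (touching_edges G Z)"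
proof -
  have ZW: "Z \<subseteq> W" using Z by auto
  have "(\<Sum>e\<in>G. card (e \<inter> W)) = (\<Sum>e\<in>G. 2)"
    by (rule sum.cong) (use edge_subset edge_card in \<open>auto simp: Int_absorb2\<close>)
  then have "2 * card G = (\<Sum>v\<in>W. card {e \<in> G. v \<in> e})" using sum_degrees[of W] by simp
  also have "\<dots> = (\<Sum>v\<in>W - Z. card {e \<in> G. v \<in> e}) + (\<Sum>v\<in>Z. card {e \<in> G. v \<in> e})"
    by (rule sum.subset_diff[OF ZW finite_W])
  also have "(\<Sum>v\<in>W - Z. card {e \<in> G. v \<in> e}) \<le> (\<Sum>v\<in>W - Z. D)"
  proof (rule sum_mono)
    fix v assume "v \<in> W - Z"
    then have "card (neighborhood G {v}) \<le> D" using Z by auto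
    then show "card {e \<in> G. v \<in> e} \<le> D" using edges_at_le_neighbors[of v] by linarith
  qed
  also have "\<dots> \<le> D * card W" using card_mono[OF finite_W, of "W - Z"] by simp
  also have "(\<Sum>v\<in>Z. card {e \<in> G. v \<in> e}) = (\<Sum>e\<in>G. card (e \<inter> Z))" by (rule sum_degrees[OF ZW])
  also have "\<dots> = (\<Sum>e\<in>touching_edges G Z. card (e \<inter> Z))"
    by (rule sum.mono_neutral_right[OF finite_G]) (auto simp: touching_edges_def)
  also have "\<dots> \<le> (\<Sum>e\<in>touching_edges G Z. 2)"
  proof (rule sum_mono)
    fix e assume "e \<in> touching_edges G Z"
    then have "e \<in> G" by (simp add: touching_edges_def)
    then have "card e = 2" "finite e" using edge_card edge_subset finite_sub by auto
    then show "card (e \<inter> Z) \<le> 2" by (metis card_mono inf_le1)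
  qed
  also have "\<dots> = 2 * card (touching_edges G Z)" by simp
  finally show ?thesis by simp
qed

text \<open>An edge that leaves \<open>U\<close> ends in the neighbourhood of \<open>U\<close>.
  Hence a large cut forces a neighbourhood that touches many edges.\<close>

lemma cut_le_touching: "card (touching_edges G U) \<le> card (inner_edges G U) + card (touching_edges G (neighborhood G U))"
proof -
  have "touching_edges G U \<subseteq> inner_edges G U \<union> touching_edges G (neighborhood G U)"
  proof
    fix e assume "e \<in> touching_edges G U"
    then obtain x where x: "e \<in> G" "x \<in> e" "x \<in> U" by (auto simp: touching_edges_def)
    then obtain y where "e = {x, y}" using edge_obtain by blast
    then show "e \<in> inner_edges G U \<union> touching_edges G (neighborhood G U)"
      using x by (cases "y \<in> U") (auto simp: inner_edges_def touching_edges_def neighborhood_def)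
  qed
  then have "card (touching_edges G U) \<le> card (inner_edges G U \<union> touching_edges G (neighborhood G U))"
    by (rule card_mono[rotated]) simp
  then show ?thesis using card_Un_le order_trans by blast
qed

text \<open>The centres are chosen greedily, each far from the earlier spiders and from the set
  \<open>B\<close> of vertices on short cycles. Being outside \<open>B\<close> makes a centre's
  spider acyclic, and the distance makes it disjoint from the others. \<open>A x\<close> will be the
  arcs leaving \<open>x\<close>.\<close>

lemma spiders_exist:
  assumes V: "finite V" and A: "\<And>x. x \<in> V \<Longrightarrow> finite (A x) \<and> card (A x) \<le> D"
    and Adisj: "\<And>x y. x \<in> V \<Longrightarrow> y \<in> V \<Longrightarrow> x \<noteq> y \<Longrightarrow> A x \<inter> A y = {}"
    and Q: "1 \<le> Q" and B: "B \<subseteq> W"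
    and dens: "\<And>U. U \<subseteq> W \<Longrightarrow> U \<noteq> {} \<Longrightarrow> 3 * card U < 2 * card (touching_edges G U)"
    and cyc: "\<And>U. U \<subseteq> W \<Longrightarrow> U \<noteq> {} \<Longrightarrow> card U \<le> D * Q + 1 \<Longrightarrow> card U \<le> card (inner_edges G U) \<Longrightarrow> U \<subseteq> B"
    and choose: "\<And>X. X \<subseteq> W \<Longrightarrow> card X \<le> card B + card V * (D * Q + 1) \<Longrightarrow>
        \<exists>v\<in>W. D \<le> card (neighborhood G {v}) \<and> v \<notin> near G X (Suc Q)"
  shows "\<exists>v u T. inj_on v V \<and> v ` V \<subseteq> W \<and> (\<forall>x\<in>V. \<forall>a\<in>A x. {v x, u a} \<in> G) \<and>
    tree_family (\<Union>x\<in>V. A x) (v ` V) Q Q u T"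
proof -
  define P where "P V v u T \<longleftrightarrow> inj_on v V \<and> v ` V \<subseteq> W \<and> (\<forall>x\<in>V. \<forall>a\<in>A x. {v x, u a} \<in> G) \<and>
      tree_family (\<Union>x\<in>V. A x) (v ` V) Q Q u T \<and>
      card (v ` V \<union> (\<Union>a\<in>(\<Union>x\<in>V. A x). T a)) \<le> card V * (D * Q + 1)" for V v u T
  have "\<exists>v u T. P F v u T" if "finite F" "F \<subseteq> V" for F
    using that
  proof (induction F rule: finite_induct)
    case empty
    show ?case by (simp add: P_def tree_family_def)
  next
    case (insert x F)
    then obtain v u T where "P F v u T" by auto
    then have P: "inj_on v F" "v ` F \<subseteq> W" "\<And>y a. y \<in> F \<Longrightarrow> a \<in> A y \<Longrightarrow> {v y, u a} \<in> G"
      "tree_family (\<Union>y\<in>F. A y) (v ` F) Q Q u T"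
      "card (v ` F \<union> (\<Union>a\<in>(\<Union>y\<in>F. A y). T a)) \<le> card F * (D * Q + 1)"
      unfolding P_def by blast+
    let ?I = "\<Union>y\<in>F. A y"
    let ?Y = "v ` F \<union> (\<Union>a\<in>?I. T a)"
    have T: "T a \<subseteq> W" "T a \<inter> v ` F = {}" "card (T a) = Q" "Q \<le> card (inner_edges G (T a)) + 1"
      "\<And>z. z \<in> T a \<Longrightarrow> linked G (T a) Q (u a) z" if "a \<in> ?I" for a
      using P(4) that unfolding tree_family_def by blast+
    have Tdisj: "T a \<inter> T b = {}" if "a \<in> ?I" "b \<in> ?I" "a \<noteq> b" for a b
      using P(4) that unfolding tree_family_def by blast
    have YW: "?Y \<subseteq> W" using P(2) T(1) by blast
    have xV: "x \<in> V" using insert by auto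
    have Ax: "finite (A x)" "card (A x) \<le> D" using A[OF xV] by auto
    have AxI: "A x \<inter> ?I = {}" using Adisj insert by blast
    let ?X = "B \<union> ?Y"
    have "card ?X \<le> card B + card ?Y" by (rule card_Un_le)
    also have "\<dots> \<le> card B + card F * (D * Q + 1)" using P(5) by simp
    also have "\<dots> \<le> card B + card V * (D * Q + 1)"
      using card_mono[OF V, of F] insert by (intro add_left_mono mult_le_mono1) auto
    finally have "\<exists>v\<in>W. D \<le> card (neighborhood G {v}) \<and> v \<notin> near G ?X (Suc Q)"
      using B YW by (intro choose) auto
    then obtain w where w: "w \<in> W" "D \<le> card (neighborhood G {w})" "w \<notin> near G ?X (Suc Q)"
      by blast
    have wX: "w \<notin> ?X"
      using w(3) linked_refl[of w UNIV "Suc Q" G] unfolding near_def by auto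
    have "card (A x) \<le> card (neighborhood G {w})" using Ax w by linarith
    then obtain f where f: "f ` A x \<subseteq> neighborhood G {w}" "inj_on f (A x)"
      using card_le_inj[OF Ax(1), of "neighborhood G {w}"] by auto
    have fG: "{w, f a} \<in> G" if "a \<in> A x" for a using f(1) that by (auto simp: neighborhood_def)
    have AD: "card (A x) * Q + 1 \<le> D * Q + 1" using Ax by simp
    \<comment> \<open>A small set through \<open>w\<close> with too many edges would lie inside
      \<open>B\<close>, but \<open>w\<close> does not.\<close>
    have sp: "card (inner_edges G U) < card U"
      if "U \<subseteq> W" "w \<in> U" "card U \<le> card (A x) * Q + 1" for U
    proof (rule ccontr)
      assume "\<not> card (inner_edges G U) < card U"
      moreover have "card U \<le> D * Q + 1" using that(3) AD by linarith
      ultimately have "U \<subseteq> B"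
        by (intro cyc[OF that(1)]) (use that(2) in auto)
      then show False using that(2) wX by blast
    qed
    obtain S where S:
      "\<And>a. a \<in> A x \<Longrightarrow> f a \<in> S a \<and> S a \<subseteq> W \<and> w \<notin> S a \<and> card (S a) = Q \<and>
         Q \<le> card (inner_edges G (S a)) + 1"
      "\<And>a z. a \<in> A x \<Longrightarrow> z \<in> S a \<Longrightarrow> linked G (S a) Q (f a) z"
      "\<And>a b. a \<in> A x \<Longrightarrow> b \<in> A x \<Longrightarrow> a \<noteq> b \<Longrightarrow> S a \<inter> S b = {}"
      using spider_exists[OF Ax(1) w(1) f(2) fG Q dens sp] by blast
    \<comment> \<open>A common vertex would give a walk of at most \<open>Q\<close> vertices to the
      root \<open>f a\<close> and one more to \<open>w\<close>; this is why the centre must avoid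
      \<open>near\<close> with \<open>Suc Q\<close>.\<close>
    have SX: "S a \<inter> ?X = {}" if a: "a \<in> A x" for a
    proof (rule ccontr)
      assume "S a \<inter> ?X \<noteq> {}"
      then obtain z where z: "z \<in> S a" "z \<in> ?X" by blast
      have "linked G UNIV Q (f a) z" by (rule linked_mono[OF S(2)[OF a z(1)]]) auto
      then have "linked G UNIV (Suc Q) z w"
        using fG[OF a] by (intro linked_step[OF linked_sym]) (auto simp: insert_commute)
      then show False using w(3) z(2) unfolding near_def by blast
    qed
    define v' where "v' = v(x := w)"
    define u' where "u' a = (if a \<in> A x then f a else u a)" for a
    define T' where "T' a = (if a \<in> A x then S a else T a)" for a
    have v'F: "v' ` F = v ` F" "v' x = w" "\<And>y. y \<in> F \<Longrightarrow> v' y = v y"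
      using insert by (auto simp: v'_def)
    have old: "u' a = u a" "T' a = T a" if "a \<in> ?I" for a using AxI that by (auto simp: u'_def T'_def)
    have new: "u' a = f a" "T' a = S a" if "a \<in> A x" for a using that by (auto simp: u'_def T'_def)
    have Iins: "(\<Union>y\<in>insert x F. A y) = A x \<union> ?I" by auto
    have vins: "v' ` insert x F = insert w (v ` F)" using v'F by auto
    have "inj_on v' (insert x F)"
    proof -
      have "inj_on v' F" using P(1) v'F(3) by (simp cong: inj_on_cong)
      moreover have "v' x \<notin> v' ` (F - {x})" using wX v'F(1,2) by blast
      ultimately show ?thesis unfolding inj_on_insert by blast
    qed
    moreover have "v' ` insert x F \<subseteq> W" unfolding vins using w P(2) by auto
    moreover have "\<forall>y\<in>insert x F. \<forall>a\<in>A y. {v' y, u' a} \<in> G"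
    proof (intro ballI)
      fix y a assume "y \<in> insert x F" "a \<in> A y"
      then consider "y = x" | "y \<in> F" by blast
      then show "{v' y, u' a} \<in> G"
      proof cases
        case 1
        then show ?thesis using fG new(1) v'F(2) \<open>a \<in> A y\<close> by simp
      next
        case 2
        then have "a \<in> ?I" using \<open>a \<in> A y\<close> by blast
        then show ?thesis using P(3)[OF 2 \<open>a \<in> A y\<close>] old(1) v'F(3)[OF 2] by simp
      qed
    qed
    moreover have "tree_family (\<Union>y\<in>insert x F. A y) (v' ` insert x F) Q Q u' T'"
      unfolding Iins vins tree_family_def
    proof (intro conjI ballI impI)
      fix a assume a: "a \<in> A x \<union> ?I"
      have "T' a \<subseteq> W \<and> T' a \<inter> insert w (v ` F) = {} \<and> card (T' a) = Q \<and>
        Q \<le> card (inner_edges G (T' a)) + 1 \<and> (\<forall>z\<in>T' a. linked G (T' a) Q (u' a) z)"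
      proof (cases "a \<in> A x")
        case True
        have "S a \<inter> insert w (v ` F) = {}" using S(1)[OF True] SX[OF True] by blast
        then show ?thesis unfolding new[OF True] using S(1,2)[OF True] by blast
      next
        case False
        then have aI: "a \<in> ?I" using a by blast
        then have "w \<notin> T a" using wX by blast
        then show ?thesis unfolding old[OF aI] using T[OF aI] by blast
      qed
      then show "T' a \<subseteq> W" "T' a \<inter> insert w (v ` F) = {}" "card (T' a) = Q"
        "Q \<le> card (inner_edges G (T' a)) + 1" "\<And>z. z \<in> T' a \<Longrightarrow> linked G (T' a) Q (u' a) z"
        by blast+
    next
      fix a b assume ab: "a \<in> A x \<union> ?I" "b \<in> A x \<union> ?I" "a \<noteq> b"
      have mix: "S a \<inter> T b = {}" if "a \<in> A x" "b \<in> ?I" for a b using SX[OF that(1)] that(2) by blast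
      consider "a \<in> A x" "b \<in> A x" | "a \<in> A x" "b \<in> ?I" | "a \<in> ?I" "b \<in> A x" | "a \<in> ?I" "b \<in> ?I"
        using ab by blast
      then show "T' a \<inter> T' b = {}"
      proof cases
        case 1
        then show ?thesis using S(3) ab(3) new(2) by simp
      next
        case 2
        then show ?thesis using mix new(2) old(2) by simp
      next
        case 3
        then show ?thesis using mix[of b a] new(2) old(2) by (simp add: Int_commute)
      next
        case 4
        then show ?thesis using Tdisj ab(3) old(2) by simp
      qed
    qed
    moreover have "card (v' ` insert x F \<union> (\<Union>a\<in>(\<Union>y\<in>insert x F. A y). T' a)) \<le>
        card (insert x F) * (D * Q + 1)"
    proof -
      have "v' ` insert x F \<union> (\<Union>a\<in>(\<Union>y\<in>insert x F. A y). T' a) = ?Y \<union> ({w} \<union> (\<Union>a\<in>A x. S a))"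
        unfolding vins Iins using old(2) new(2) by auto
      also have "card \<dots> \<le> card ?Y + card ({w} \<union> (\<Union>a\<in>A x. S a))" by (rule card_Un_le)
      also have "card ({w} \<union> (\<Union>a\<in>A x. S a)) \<le> 1 + card (\<Union>a\<in>A x. S a)"
        using card_Un_le[of "{w}"] by simp
      also have "card (\<Union>a\<in>A x. S a) \<le> (\<Sum>a\<in>A x. card (S a))" by (rule card_UN_le[OF Ax(1)])
      also have "\<dots> = card (A x) * Q" using S(1) by simp
      also have "\<dots> \<le> D * Q" using Ax(2) by simp
      also have "card ?Y + (1 + D * Q) \<le> card F * (D * Q + 1) + (D * Q + 1)" using P(5) by simp
      also have "\<dots> = card (insert x F) * (D * Q + 1)" using insert by simp
      finally show ?thesis by simp
    qed
    ultimately show ?case unfolding P_def by blast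
  qed
  from this[OF V order_refl] show ?thesis unfolding P_def by blast
qed

end

section \<open>Choosing the stages and embedding the subdivision\<close>

lemma grown_size_step:
  assumes "8 \<le> Q"
  shows "17 / 16 * real (grown_size Q t) \<le> real (grown_size Q (Suc t))"
    "real (grown_size Q (Suc t)) \<le> 2 * real (grown_size Q t)"
proof -
  have "8 \<le> grown_size Q t" using assms grown_size_mono[of 0 t Q] by simp
  \<comment> \<open>For sizes of at least 8, rounding down loses at most half of the eighth.\<close>
  then have "grown_size Q t \<le> 16 * (grown_size Q t div 8)" by presburger
  moreover have "grown_size Q t div 8 \<le> grown_size Q t" by simp
  ultimately show "17 / 16 * real (grown_size Q t) \<le> real (grown_size Q (Suc t))"
    "real (grown_size Q (Suc t)) \<le> 2 * real (grown_size Q t)"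
    unfolding grown_size.simps(2) of_nat_add by linarith+
qed

lemma grown_size_exponential:
  assumes "8 \<le> Q"
  shows "(17 / 16) ^ t \<le> real (grown_size Q t)"
proof (induction t)
  case 0
  then show ?case using assms by simp
next
  case (Suc t)
  then show ?case using grown_size_step(1)[OF assms, of t] by simp
qed

text \<open>A stage at most doubles the size, so the first size that reaches \<open>a\<close>
  overshoots by at most a factor 2. Minimality makes the chosen stage monotone in
  \<open>a\<close>.\<close>

lemma grown_size_reaches:
  assumes Q: "8 \<le> Q" "real Q \<le> a"
  obtains t where "a \<le> real (grown_size Q t)" "real (grown_size Q t) \<le> 2 * a"
    "\<And>s. a \<le> real (grown_size Q s) \<Longrightarrow> t \<le> s"
proof -
  obtain k where "a < (17 / 16) ^ k" using real_arch_pow[of "17 / 16" a] by auto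
  then have ex: "a \<le> real (grown_size Q k)" using grown_size_exponential[OF Q(1), of k] by linarith
  define t where "t = (LEAST t. a \<le> real (grown_size Q t))"
  have t: "a \<le> real (grown_size Q t)" unfolding t_def by (rule LeastI[of _ k]) (rule ex)
  have least: "t \<le> s" if "a \<le> real (grown_size Q s)" for s unfolding t_def by (rule Least_le) (rule that)
  have "real (grown_size Q t) \<le> 2 * a"
  proof (cases t)
    case 0
    then show ?thesis using Q by simp
  next
    case (Suc s)
    then have "\<not> a \<le> real (grown_size Q s)" using least[of s] by auto
    then show ?thesis using grown_size_step(2)[OF Q(1), of s] Suc by simp
  qed
  then show thesis using that t least by blast
qed

text \<open>Connection \<open>k\<close> uses the first stage whose trees have size at least
  \<open>a k = a0 * \<rho> ^ k\<close>. The choice of \<open>\<rho>\<close> makes all trees of the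
  following stage together at most \<open>\<gamma> * a k / 8\<close>, and by \<open>big\<close> the
  branch vertices and all paths take at most another eighth, so the forbidden set stays below the
  \<open>\<gamma> * a k / 2\<close> that \<open>route_all\<close> tolerates.\<close>

lemma embed_from_spiders:
  fixes H :: "'a pair_pre_digraph" and v :: "'a \<Rightarrow> nat" and \<gamma> \<eta> a0 \<rho> :: real
  assumes H: "pair_graph H" and fg: "finite_graph G W" and GM: "G \<subseteq> M" and M: "M \<subseteq> complete_edges n"
    and W: "W \<subseteq> {..<n}"
    and inj: "inj_on v (pverts H)" and vW: "v ` pverts H \<subseteq> W"
    and vu: "\<And>x y. (x, y) \<in> parcs H \<Longrightarrow> {v x, u (x, y)} \<in> G"
    and fam: "finite_graph.tree_family G W (parcs H) (v ` pverts H) Q Q u T"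
    and dens: "\<And>U. U \<subseteq> W \<Longrightarrow> U \<noteq> {} \<Longrightarrow> 3 * card U < 2 * card (touching_edges G U)"
    and sparse: "\<And>U. U \<subseteq> W \<Longrightarrow> card U \<le> m0 \<Longrightarrow> card (inner_edges G U) \<le> (1 + \<eta>) * card U"
    and expand: "\<And>U. U \<subseteq> W \<Longrightarrow> U \<noteq> {} \<Longrightarrow> 2 * card U \<le> card W \<Longrightarrow>
        \<gamma> * card U \<le> card (neighborhood G U)"
    and \<eta>: "0 \<le> \<eta>" "20 * \<eta> * card (parcs H) \<le> 1"
    and \<gamma>: "0 < \<gamma>" and q: "parcs H \<noteq> {}"
    and Q: "20 * (card (pverts H) + card (parcs H)) \<le> Q"
    and \<rho>: "\<rho> = \<gamma> / (16 * real (card (parcs H)))" "\<rho> \<le> 1"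
    and a0: "0 < a0" "real Q \<le> a0 * \<rho> ^ card (parcs H)"
      "4 * real (card (parcs H)) * a0 \<le> real m0"
    and K: "real (card W) \<le> \<gamma> * (a0 * \<rho> ^ card (parcs H)) * real K"
    and big: "\<And>N. (17 / 16) ^ N \<le> 2 * a0 \<Longrightarrow>
        real (card (pverts H)) + real (card (parcs H)) * real (2 * (Q + N) + 2 * K + 2) \<le>
        \<gamma> * (a0 * \<rho> ^ card (parcs H)) / 8"
  shows "contains_subdivision (edge_graph n M) H"
proof -
  interpret H: pair_graph H by (rule H)
  interpret finite_graph G W by (rule fg)
  let ?I = "parcs H" and ?V0 = "v ` pverts H"
  let ?q = "card ?I"
  have finI: "finite ?I" by (rule H.pair_finite_arcs)
  have q1: "1 \<le> ?q" using q finI by (simp add: Suc_le_eq card_gt_0_iff)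
  have "20 * 1 \<le> 20 * (card (pverts H) + card (parcs H))" using q1 by (intro mult_le_mono2) simp
  then have Q8: "8 \<le> Q" "1 \<le> Q" using Q by simp_all
  have \<rho>0: "0 < \<rho>" using \<rho>(1) \<gamma> q1 by simp
  define a where "a k = a0 * \<rho> ^ k" for k
  have a_pos: "0 < a k" for k unfolding a_def using a0 \<rho>0 by simp
  have a_anti: "a k \<le> a j" if "j \<le> k" for j k
    unfolding a_def using that \<rho>0 \<rho>(2) a0(1) by (intro mult_left_mono power_decreasing) auto
  have aq: "a ?q \<le> a k" if "k \<le> ?q" for k by (rule a_anti[OF that])
  have Qa: "real Q \<le> a k" if "k \<le> ?q" for k
    using a0(2) aq[OF that] unfolding a_def by linarith
  have "\<exists>t. a k \<le> real (grown_size Q t) \<and> real (grown_size Q t) \<le> 2 * a k \<and>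
      (\<forall>s. a k \<le> real (grown_size Q s) \<longrightarrow> t \<le> s)" if "k \<le> ?q" for k
    using grown_size_reaches[OF Q8(1) Qa[OF that]] by metis
  then obtain tm where tm: "\<And>k. k \<le> ?q \<Longrightarrow> a k \<le> real (grown_size Q (tm k))"
    "\<And>k. k \<le> ?q \<Longrightarrow> real (grown_size Q (tm k)) \<le> 2 * a k"
    "\<And>k s. k \<le> ?q \<Longrightarrow> a k \<le> real (grown_size Q s) \<Longrightarrow> tm k \<le> s"
    by metis
  have tm_anti: "tm k \<le> tm j" if "j \<le> k" "k \<le> ?q" for j k
    using tm(3)[OF that(2), of "tm j"] tm(1)[of j] a_anti[OF that(1)] that by linarith
  \<comment> \<open>The chosen stages decrease with \<open>k\<close>, so this is the last stage
    needed; exponential growth makes it logarithmic in \<open>a0\<close>.\<close>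
  define N where "N = tm 0"
  have tmN: "tm k \<le> N" if "k \<le> ?q" for k unfolding N_def by (rule tm_anti[OF _ that]) simp
  have V0W: "?V0 \<subseteq> W" by (rule vW)
  have cV0: "card ?V0 \<le> card (pverts H)" by (rule card_image_le[OF H.pair_finite_verts])
  have sizeN: "2 * card ?I * grown_size Q N \<le> m0"
  proof -
    have "real (2 * card ?I * grown_size Q N) \<le> 2 * real ?q * (2 * a 0)"
      unfolding of_nat_mult N_def using tm(2)[of 0] by (intro mult_mono) auto
    also have "\<dots> \<le> real m0" using a0(3) by (simp add: a_def)
    finally show ?thesis by linarith
  qed
  have Q': "20 * (card ?V0 + card ?I) \<le> Q"
    by (rule order_trans[OF _ Q]) (use cV0 in simp)
  obtain TT where TT: "\<And>t. t \<le> N \<Longrightarrow> tree_family ?I ?V0 (grown_size Q t) (Q + t) u (TT t)"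
     "\<And>i t t'. i \<in> ?I \<Longrightarrow> t \<le> t' \<Longrightarrow> t' \<le> N \<Longrightarrow> TT t i \<subseteq> TT t' i"
    using grow_family[OF finI V0W fam dens sparse \<eta> Q' Q8(2) sizeN] by blast
  have TTf: "TT t i \<subseteq> W" "TT t i \<inter> ?V0 = {}" "card (TT t i) = grown_size Q t"
      "\<And>x. x \<in> TT t i \<Longrightarrow> linked G (TT t i) (Q + t) (u i) x"
    if "t \<le> N" "i \<in> ?I" for t i
    using TT(1)[OF that(1)] that(2) unfolding tree_family_def by blast+
  have TTd: "TT t i \<inter> TT t j = {}" if "t \<le> N" "i \<in> ?I" "j \<in> ?I" "i \<noteq> j" for t i j
    using TT(1)[OF that(1)] that(2-4) unfolding tree_family_def by blast
  \<comment> \<open>One arc per edge, oriented along \<open>v\<close>. No arc of \<open>E\<close> is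
    the reverse of another, which keeps sources and targets apart.\<close>
  define E where "E = {(x, y) \<in> parcs H. v x < v y}"
  have EI: "E \<subseteq> ?I" unfolding E_def by auto
  obtain es where es: "set es = E" "distinct es"
    using finite_distinct_list[OF finite_subset[OF EI finI]] by blast
  define m where "m = length es"
  have m: "m \<le> ?q" unfolding m_def using es card_mono[OF finI EI] by (metis distinct_card)
  define src where "src k = es ! k" for k
  \<comment> \<open>The tree of an arc hangs off its tail, so the path for an edge joins the trees
    of its two opposite arcs.\<close>
  define dst where "dst k = prod.swap (es ! k)" for k
  have esE: "es ! k \<in> E" if "k < m" for k using that es(1) unfolding m_def by auto
  have NQ: "(17 / 16) ^ N \<le> 2 * a0"
    using grown_size_exponential[OF Q8(1), of N] tm(2)[of 0] unfolding N_def a_def by simp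
  have route: "\<exists>P. (\<forall>k<m. P k \<noteq> [] \<and> hd (P k) = u (src k) \<and> last (P k) = u (dst k) \<and> walk G (P k) \<and>
       distinct (P k) \<and> set (P k) \<subseteq> W - ?V0) \<and>
     (\<forall>j<m. \<forall>k<m. j \<noteq> k \<longrightarrow> set (P j) \<inter> set (P k) = {})"
  proof (rule route_all[where \<gamma> = \<gamma> and a = a and c = "\<lambda>k. 2 * a k" and S = "\<lambda>k. TT (tm k)" and r = "Q + N"
        and K = K and I = ?I])
    fix k i assume ki: "k \<le> m" "i \<in> ?I"
    then have kq: "k \<le> ?q" using m by simp
    show "TT (tm k) i \<subseteq> W - ?V0 \<and> a k \<le> real (card (TT (tm k) i)) \<and> real (card (TT (tm k) i)) \<le> 2 * a k"
      using TTf(1-3)[OF tmN[OF kq] ki(2)] tm(1,2)[OF kq] by auto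
    show "linked G (TT (tm k) i) (Q + N) (u i) x" if "x \<in> TT (tm k) i" for x
      by (rule linked_mono[OF TTf(4)[OF tmN[OF kq] ki(2) that]]) (use tmN[OF kq] in auto)
    show "TT (tm k) i \<subseteq> TT (tm j) i" if "j \<le> k" for j
      by (rule TT(2)[OF ki(2) tm_anti[OF that kq] tmN]) (use that kq in simp)
    show "TT (tm k) i \<inter> TT (tm k) j = {}" if "j \<in> ?I" "i \<noteq> j" for j
      by (rule TTd[OF tmN[OF kq] ki(2) that])
  next
    fix k assume k: "k < m"
    show "src k \<in> ?I \<and> dst k \<in> ?I"
      using esE[OF k] H.arcs_symmetric unfolding src_def dst_def E_def by auto
    show "0 < a k" by (rule a_pos)
    have kq: "k < ?q" "Suc k \<le> ?q" using k m by auto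
    have aqk: "a ?q \<le> a k" by (rule aq) (use kq in simp)
    have "\<gamma> * a ?q * real K \<le> \<gamma> * a k * real K"
      using aqk \<gamma> by (intro mult_right_mono mult_left_mono) auto
    then show "real (card W) \<le> \<gamma> * a k * real K" using K unfolding a_def by linarith
    have "real (card ?V0) + real m * real (2 * (Q + N) + 2 * K + 2) \<le>
        real (card (pverts H)) + real ?q * real (2 * (Q + N) + 2 * K + 2)"
      using cV0 m by (intro add_mono mult_right_mono) auto
    also have "\<dots> \<le> \<gamma> * a ?q / 8" unfolding a_def by (rule big[OF NQ])
    also have "\<dots> \<le> \<gamma> * a k / 8" using aqk \<gamma> by simp
    finally have "real (card ?V0) + real m * real (2 * (Q + N) + 2 * K + 2) \<le> \<gamma> * a k / 8" .
    moreover have "real ?q * (2 * a (Suc k)) = \<gamma> * a k / 8"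
    proof -
      have "a (Suc k) = a k * \<rho>" by (simp add: a_def)
      then show ?thesis using q unfolding \<rho>(1) by (simp add: finI)
    qed
    moreover have "0 < \<gamma> * a k" using \<gamma> a_pos by simp
    ultimately show "real (card ?V0) + real m * real (2 * (Q + N) + 2 * K + 2) + real ?q * (2 * a (Suc k)) \<le> \<gamma> * a k / 2"
      by linarith
    fix j assume j: "j < m"
    obtain x y x' y' where xy: "es ! j = (x, y)" "es ! k = (x', y')" by (metis surj_pair)
    have "v x < v y" "v x' < v y'" using esE[OF j] esE[OF k] xy unfolding E_def by auto
    then show "src j \<noteq> dst k" unfolding src_def dst_def xy by auto
    assume "j \<noteq> k"
    then have "es ! j \<noteq> es ! k" using es(2) j k nth_eq_iff_index_eq unfolding m_def by blast
    then show "src j \<noteq> src k \<and> dst j \<noteq> dst k" unfolding src_def dst_def xy by auto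
  qed (use expand \<gamma> finI V0W in auto)
  from route obtain P where "(\<forall>k<m. P k \<noteq> [] \<and> hd (P k) = u (src k) \<and> last (P k) = u (dst k) \<and>
       walk G (P k) \<and> distinct (P k) \<and> set (P k) \<subseteq> W - ?V0) \<and>
     (\<forall>j<m. \<forall>k<m. j \<noteq> k \<longrightarrow> set (P j) \<inter> set (P k) = {})" ..
  then have P: "\<And>k. k < m \<Longrightarrow> P k \<noteq> [] \<and> hd (P k) = u (src k) \<and> last (P k) = u (dst k) \<and>
       walk G (P k) \<and> distinct (P k) \<and> set (P k) \<subseteq> W - ?V0"
    "\<And>j k. j < m \<Longrightarrow> k < m \<Longrightarrow> j \<noteq> k \<Longrightarrow> set (P j) \<inter> set (P k) = {}" by simp_all
  define idx where "idx e = (SOME k. k < m \<and> es ! k = e)" for e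
  have idx: "idx e < m \<and> es ! idx e = e" if "e \<in> E" for e
    unfolding idx_def by (rule someI_ex) (use that es(1) in \<open>auto simp: m_def in_set_conv_nth\<close>)
  show ?thesis
  proof (rule contains_subdivisionI[OF H inj _ M E_def, where P = "\<lambda>e. P (idx e)"])
    show "?V0 \<subseteq> {..<n}" using vW W by blast
    fix x y assume xy: "(x, y) \<in> E"
    define k where "k = idx (x, y)"
    have k: "k < m" "es ! k = (x, y)" using idx[OF xy] by (auto simp: k_def)
    have arcs: "(x, y) \<in> parcs H" "(y, x) \<in> parcs H"
      using xy H.arcs_symmetric unfolding E_def by auto
    have pk: "P k \<noteq> []" "hd (P k) = u (x, y)" "last (P k) = u (y, x)" "walk G (P k)" "distinct (P k)"
      "set (P k) \<subseteq> W - ?V0"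
      using P(1)[OF k(1)] unfolding src_def dst_def k(2) by auto
    have "walk G (v x # P k @ [v y])"
      using pk vu[OF arcs(1)] vu[OF arcs(2)] by (auto simp: walk_Cons walk_append insert_commute)
    then have "walk M (v x # P k @ [v y])" using GM by (rule walk_mono)
    then show "walk M (v x # P (idx (x, y)) @ [v y]) \<and> distinct (P (idx (x, y))) \<and>
        set (P (idx (x, y))) \<subseteq> {..<n} - ?V0"
      using pk W unfolding k_def by blast
  next
    fix e f assume "e \<in> E" "f \<in> E" "e \<noteq> f"
    then show "set (P (idx e)) \<inter> set (P (idx f)) = {}"
      using P(2)[of "idx e" "idx f"] idx[of e] idx[of f] by metis
  qed
qed

section \<open>Expansion of the core and the choice of constants\<close>

lemma eventually_log_small:
  fixes A B L l :: real
  assumes "0 < B" "0 < l" "0 \<le> L"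
  shows "eventually (\<lambda>n. \<forall>N. (17 / 16) ^ N \<le> B * real n \<longrightarrow> A + L * real N \<le> l * real n) sequentially"
proof -
  \<comment> \<open>The largest admissible \<open>N\<close> is logarithmic in \<open>n\<close>,
    hence negligible against a linear term.\<close>
  have "eventually (\<lambda>n. A + L * (ln (B * real n) / ln (17 / 16)) \<le> l * real n) sequentially"
    using assms by real_asymp
  then show ?thesis
  proof (eventually_elim, intro allI impI)
    fix n N
    assume 1: "A + L * (ln (B * real n) / ln (17 / 16)) \<le> l * real n" and 2: "(17 / 16) ^ N \<le> B * real n"
    have "ln ((17 / 16 :: real) ^ N) \<le> ln (B * real n)"
      using 2 by (intro ln_mono) (auto intro: less_le_trans[rotated])
    then have "real N * ln (17 / 16) \<le> ln (B * real n)" by (simp add: ln_realpow)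
    then have "real N \<le> ln (B * real n) / ln (17 / 16)" by (simp add: pos_le_divide_eq)
    then have "L * real N \<le> L * (ln (B * real n) / ln (17 / 16))" using assms(3) by (rule mult_left_mono)
    then show "A + L * real N \<le> l * real n" using 1 by linarith
  qed
qed

lemma out_arcs_le_max_degree:
  assumes "pair_graph H" "x \<in> pverts H"
  shows "card {a \<in> parcs H. fst a = x} \<le> max_degree H"
proof -
  interpret pair_graph H by (rule assms)
  have "out_degree (with_proj H) x = card {a \<in> parcs H. fst a = x}"
    by (simp add: out_degree_def out_arcs_def)
  moreover have "out_degree (with_proj H) x \<le> max_degree H"
    unfolding max_degree_def using pair_finite_verts assms(2) by (intro Max_ge) auto
  ultimately show ?thesis by simp
qed

lemma parcs_nonempty:
  assumes "0 < max_degree H"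
  shows "parcs H \<noteq> {}"
proof
  assume "parcs H = {}"
  then have "out_degree (with_proj H) x = 0" for x by (simp add: out_degree_def out_arcs_def)
  then have "insert 0 (out_degree (with_proj H) ` pverts H) = {0}" by auto
  then have "max_degree H = 0" unfolding max_degree_def by (simp only: Max_singleton)
  then show False using assms by simp
qed

lemma touching_mono: "G \<subseteq> M \<Longrightarrow> finite M \<Longrightarrow> card (touching_edges G X) \<le> card (touching_edges M X)"
  by (rule card_mono) (auto simp: touching_edges_def)

text \<open>Small \<open>U\<close>: with fewer than \<open>card U / 4\<close> neighbours, more than
  \<open>3 / 2 * card U\<close> edges would lie in a set of at most \<open>5 / 4 * card U\<close>
  vertices, although sparsity allows only \<open>1 + 1 / 20\<close> per vertex. Large
  \<open>U\<close>: the crossing surplus of the core is linear in \<open>n\<close>, more than a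
  neighbourhood of at most \<open>\<theta> * n\<close> vertices can touch.\<close>

lemma core_expands:
  fixes \<beta> \<theta> \<kappa> \<eta> :: real
  assumes fg: "finite_graph G W" and n: "0 < n"
    and \<beta>: "0 < \<beta>" "\<beta> * real n < real (card W)" and \<kappa>: "0 < \<kappa>" and \<theta>: "0 < \<theta>" and \<eta>: "\<eta> \<le> 1 / 20"
    and dens: "\<And>U. U \<subseteq> W \<Longrightarrow> U \<noteq> {} \<Longrightarrow> 3 * card U < 2 * card (touching_edges G U)"
    and cut: "\<And>U. U \<subseteq> W \<Longrightarrow> U \<noteq> {} \<Longrightarrow> U \<noteq> W \<Longrightarrow>
       real (card (inner_edges G U)) + 2 * \<kappa> * real (card U) * (real (card W) - real (card U)) / real n
         \<le> real (card (touching_edges G U))"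
    and sparse: "\<And>U. U \<subseteq> W \<Longrightarrow> real (card U) \<le> \<beta> * real n \<Longrightarrow>
       real (card (inner_edges G U)) \<le> (1 + \<eta>) * real (card U)"
    and touch: "\<And>X. X \<subseteq> W \<Longrightarrow> real (card X) \<le> \<theta> * real n \<Longrightarrow>
       real (card (touching_edges G X)) \<le> \<kappa> * \<beta>\<^sup>2 / 4 * real n"
    and Wn: "real (card W) \<le> real n"
    and U: "U \<subseteq> W" "U \<noteq> {}" "2 * card U \<le> card W"
  shows "min (1 / 4) \<theta> * real (card U) \<le> real (card (neighborhood G U))"
proof -
  interpret finite_graph G W by (rule fg)
  let ?X = "neighborhood G U"
  have finU: "finite U" using U finite_sub by blast
  have u0: "0 < real (card U)" using U finU by (simp add: card_gt_0_iff)
  have XU: "U \<inter> ?X = {}" by (auto simp: neighborhood_def)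
  show ?thesis
  proof (cases "real (card U) \<le> \<beta> * real n / 2")
    case True
    have "real (card U) / 4 \<le> real (card ?X)"
    proof (rule ccontr)
      assume "\<not> real (card U) / 4 \<le> real (card ?X)"
      then have small: "real (card ?X) < real (card U) / 4" by simp
      have "card (U \<union> ?X) = card U + card ?X" using XU finU by (intro card_Un_disjoint) auto
      then have c: "real (card (U \<union> ?X)) = real (card U) + real (card ?X)" by simp
      have "e \<subseteq> U \<union> ?X" if eU: "e \<in> touching_edges G U" for e
      proof -
        obtain x where x: "e \<in> G" "x \<in> e" "x \<in> U" using eU by (auto simp: touching_edges_def)
        then obtain y where "e = {x, y}" using edge_obtain by blast
        then show ?thesis using x by (auto simp: neighborhood_def)
      qed
      then have "card (inner_edges G ?X) + card (touching_edges G U) \<le> card (inner_edges G (U \<union> ?X))"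
        by (intro inner_Un_touching XU)
      then have "real (card (touching_edges G U)) \<le> real (card (inner_edges G (U \<union> ?X)))" by linarith
      also have "\<dots> \<le> (1 + \<eta>) * real (card (U \<union> ?X))"
        using U(1) neighborhood_subset c small True by (intro sparse) auto
      also have "\<dots> \<le> (1 + 1 / 20) * real (card (U \<union> ?X))" using \<eta> by (intro mult_right_mono) auto
      also have "\<dots> \<le> 3 / 2 * real (card U)" unfolding c using small u0 by simp
      finally have "real (2 * card (touching_edges G U)) \<le> real (3 * card U)" by simp
      then show False using dens[OF U(1,2)] by linarith
    qed
    moreover have "min (1 / 4) \<theta> * real (card U) \<le> 1 / 4 * real (card U)" by (intro mult_right_mono) auto
    ultimately show ?thesis by linarith
  next
    case False
    have UW: "U \<noteq> W" using U u0 by auto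
    have "\<theta> * real n < real (card ?X)"
    proof (rule ccontr)
      assume "\<not> \<theta> * real n < real (card ?X)"
      then have t: "real (card (touching_edges G ?X)) \<le> \<kappa> * \<beta>\<^sup>2 / 4 * real n"
        by (intro touch neighborhood_subset) simp
      have "card (touching_edges G U) \<le> card (inner_edges G U) + card (touching_edges G ?X)"
        by (rule cut_le_touching)
      then have up: "2 * \<kappa> * real (card U) * (real (card W) - real (card U)) / real n
         \<le> \<kappa> * \<beta>\<^sup>2 / 4 * real n"
        using cut[OF U(1,2) UW] t by linarith
      have "\<kappa> * \<beta>\<^sup>2 / 2 * real n < 2 * \<kappa> * real (card U) * (real (card W) - real (card U)) / real n"
      proof -
        \<comment> \<open>Both sides of the cut exceed \<open>\<beta> * n / 2\<close>, as
          \<open>U\<close> has at most half of \<open>W\<close>. The surplus is thus twice what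
          \<open>touch\<close> permits.\<close>
        have "(\<beta> * real n / 2) * (\<beta> * real n / 2) < real (card U) * (real (card W) - real (card U))"
        proof (rule mult_strict_mono)
          show "\<beta> * real n / 2 < real (card U)" using False by simp
          show "\<beta> * real n / 2 < real (card W) - real (card U)" using U(3) \<beta>(2) by linarith
        qed (use \<beta> n u0 in auto)
        then have "2 * \<kappa> * ((\<beta> * real n / 2) * (\<beta> * real n / 2)) / real n <
            2 * \<kappa> * (real (card U) * (real (card W) - real (card U))) / real n"
          using \<kappa> n by (intro divide_strict_right_mono mult_strict_left_mono) auto
        moreover have "2 * \<kappa> * ((\<beta> * real n / 2) * (\<beta> * real n / 2)) / real n = \<kappa> * \<beta>\<^sup>2 / 2 * real n"
          using n by (simp add: power2_eq_square)
        ultimately show ?thesis by (simp only: mult.assoc)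
      qed
      from less_le_trans[OF this up] have "\<kappa> * \<beta>\<^sup>2 * real n < 0"
        by (simp add: mult_ac)
      moreover have "0 < \<kappa> * \<beta>\<^sup>2 * real n" using \<kappa> \<beta> n by simp
      ultimately show False by linarith
    qed
    moreover have "min (1 / 4) \<theta> * real (card U) \<le> \<theta> * real n"
    proof (rule mult_mono)
      have "card U \<le> card W" by (rule card_mono[OF finite_W U(1)])
      then show "real (card U) \<le> real n" using Wn by linarith
    qed (use \<theta> in auto)
    ultimately show ?thesis by linarith
  qed
qed

text \<open>The constants are fixed in the order of their dependence: \<open>Q\<close> and
  \<open>\<eta>\<close> from \<open>H\<close>, then the sparsity range \<open>\<beta>\<close>, then
  the thresholds \<open>\<theta>1\<close>, \<open>\<theta>2\<close>, \<open>\<theta>3\<close>, then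
  the expansion rate and the tree sizes. Given the five random properties, the rest is deterministic
  for large \<open>n\<close>.\<close>

lemma whp_contains_subdivision:
  fixes H :: "'a pair_pre_digraph" and C c \<kappa> \<xi> :: real
  assumes H: "pair_graph H" and \<Delta>: "4 \<le> max_degree H" and C: "0 < C" and \<kappa>: "0 < \<kappa>" and \<xi>: "0 < \<xi>"
    and c: "c = (real (max_degree H) - 1) / 2 + \<xi>"
  shows "whp C (\<lambda>n M. (c + \<kappa>) * real n \<le> real (card M) \<longrightarrow> contains_subdivision (edge_graph n M) H)"
proof -
  interpret H: pair_graph H by (rule H)
  define D where "D = max_degree H"
  define q where "q = card (parcs H)"
  define h where "h = card (pverts H)"
  have qne: "parcs H \<noteq> {}" using parcs_nonempty \<Delta> by force
  have q1: "1 \<le> q" unfolding q_def using qne H.pair_finite_arcs by (simp add: Suc_le_eq card_gt_0_iff)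
  \<comment> \<open>Twenty times the defect of the forest, as the growth step demands.\<close>
  define Q where "Q = 20 * (h + q)"
  have Q1: "1 \<le> Q" using q1 by (simp add: Q_def)
  define \<eta> :: real where "\<eta> = 1 / (20 * real q)"
  have \<eta>: "0 < \<eta>" "\<eta> \<le> 1 / 20" "\<eta> \<le> 1" "20 * \<eta> * real q \<le> 1"
    using q1 by (auto simp: \<eta>_def field_simps)
  obtain \<beta> where \<beta>: "0 < \<beta>" and w1: "whp C (\<lambda>n M. locally_sparse \<beta> \<eta> n M)"
    using whp_locally_sparse[OF C \<eta>(1,3)] by blast
  \<comment> \<open>Half of the cut \<open>\<kappa> * \<beta>\<^sup>2 / 2 * n\<close> that the
    quadratic term guarantees for large sets.\<close>
  have "0 < \<kappa> * \<beta>\<^sup>2 / 4" using \<kappa> \<beta> by simp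
  then obtain \<theta>1 where \<theta>1: "0 < \<theta>1" and w2: "whp C (\<lambda>n M. few_touching \<theta>1 (\<kappa> * \<beta>\<^sup>2 / 4) n M)"
    using whp_few_touching[OF C] by blast
  \<comment> \<open>The degree sum exceeds \<open>(max_degree H - 1) * card W\<close> by at least
    \<open>2 * \<xi> * card W\<close>; high-degree vertices touching only
    \<open>\<xi> * \<beta> / 2 * n\<close> edges could not account for that.\<close>
  have "0 < \<xi> * \<beta> / 2" using \<xi> \<beta> by simp
  then obtain \<theta>2 where \<theta>2: "0 < \<theta>2" and w3: "whp C (\<lambda>n M. few_touching \<theta>2 (\<xi> * \<beta> / 2) n M)"
    using whp_few_touching[OF C] by blast
  \<comment> \<open>Half of \<open>\<theta>3\<close> is reserved for vertices on short cycles and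
    half for earlier spiders; fewer vertices lie near these than have high degree.\<close>
  obtain \<theta>3 where \<theta>3: "0 < \<theta>3" and w4: "whp C (\<lambda>n M. small_near \<theta>3 \<theta>2 (Suc Q) n M)"
    using whp_small_near[OF C \<theta>2, of Q] by blast
  have w5: "whp C (\<lambda>n M. real (card (\<Union> (cyclic_sets n (D * Q + 1) M))) \<le> \<theta>3 / 2 * real n)"
    by (rule whp_few_cyclic[OF C]) (use \<theta>3 in simp)
  define \<gamma> where "\<gamma> = min (1 / 4) \<theta>1"
  have \<gamma>: "0 < \<gamma>" "\<gamma> \<le> 1 / 4" using \<theta>1 by (auto simp: \<gamma>_def)
  define \<rho> where "\<rho> = \<gamma> / (16 * real q)"
  have \<rho>: "0 < \<rho>" "\<rho> \<le> 1" using \<gamma> q1 by (auto simp: \<rho>_def field_simps)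
  \<comment> \<open>Makes \<open>4 * q * a0\<close> equal to \<open>\<beta> * n / 2\<close>, which
    is below the rounded-down sparsity range once \<open>\<beta> * n \<ge> 2\<close>.\<close>
  define \<kappa>0 where "\<kappa>0 = \<beta> / (8 * real q)"
  have \<kappa>0: "0 < \<kappa>0" using \<beta> q1 by (simp add: \<kappa>0_def)
  define \<mu> where "\<mu> = \<kappa>0 * \<rho> ^ q"
  have \<mu>: "0 < \<mu>" using \<kappa>0 \<rho> by (simp add: \<mu>_def)
  \<comment> \<open>A constant number of expansion steps is enough, because even the smallest trees
    used have at least \<open>\<mu> * n\<close> vertices.\<close>
  define K where "K = nat \<lceil>1 / (\<gamma> * \<mu>)\<rceil>"
  have K: "1 \<le> \<gamma> * \<mu> * real K"
  proof -
    have "1 / (\<gamma> * \<mu>) \<le> real K" unfolding K_def by linarith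
    then show ?thesis using \<gamma> \<mu> by (simp add: pos_divide_le_eq mult.commute)
  qed
  have ev1: "eventually (\<lambda>n. \<forall>N. (17 / 16) ^ N \<le> (2 * \<kappa>0) * real n \<longrightarrow>
      (real h + real q * real (2 * Q + 2 * K + 2)) + (2 * real q) * real N \<le> (\<gamma> * \<mu> / 8) * real n) sequentially"
    by (rule eventually_log_small) (use \<kappa>0 \<gamma> \<mu> in auto)
  have ev2: "eventually (\<lambda>n. real Q \<le> \<mu> * real n) sequentially"
    "eventually (\<lambda>n. 2 \<le> \<beta> * real n) sequentially"
    "eventually (\<lambda>n. real (h * (D * Q + 1)) \<le> \<theta>3 / 2 * real n) sequentially"
    using \<mu> \<beta> \<theta>3 by real_asymp+
  note W = whp_conj[OF w1 whp_conj[OF w2 whp_conj[OF w3 whp_conj[OF w4 w5]]]]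
  show ?thesis
  proof (rule whp_eventually_mono[OF W])
    show "\<forall>\<^sub>F n in sequentially. \<forall>M. M \<subseteq> complete_edges n \<longrightarrow>
      locally_sparse \<beta> \<eta> n M \<and>
      few_touching \<theta>1 (\<kappa> * \<beta>\<^sup>2 / 4) n M \<and>
      few_touching \<theta>2 (\<xi> * \<beta> / 2) n M \<and>
      small_near \<theta>3 \<theta>2 (Suc Q) n M \<and>
      real (card (\<Union> (cyclic_sets n (D * Q + 1) M))) \<le> \<theta>3 / 2 * real n \<longrightarrow>
      (c + \<kappa>) * real n \<le> real (card M) \<longrightarrow> contains_subdivision (edge_graph n M) H"
      using ev1 ev2 eventually_gt_at_top[of 0]
    proof (eventually_elim, intro allI impI, elim conjE)
      fix n M
      assume evN: "\<forall>N. (17 / 16) ^ N \<le> (2 * \<kappa>0) * real n \<longrightarrow>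
          (real h + real q * real (2 * Q + 2 * K + 2)) + (2 * real q) * real N \<le> (\<gamma> * \<mu> / 8) * real n"
        and evQ: "real Q \<le> \<mu> * real n" and ev\<beta>: "2 \<le> \<beta> * real n"
        and evh: "real (h * (D * Q + 1)) \<le> \<theta>3 / 2 * real n" and n: "0 < n"
        and M: "M \<subseteq> complete_edges n"
        and e1: "locally_sparse \<beta> \<eta> n M"
        and e2: "few_touching \<theta>1 (\<kappa> * \<beta>\<^sup>2 / 4) n M"
        and e3: "few_touching \<theta>2 (\<xi> * \<beta> / 2) n M"
        and e4: "small_near \<theta>3 \<theta>2 (Suc Q) n M"
        and e5: "real (card (\<Union> (cyclic_sets n (D * Q + 1) M))) \<le> \<theta>3 / 2 * real n"
        and many: "(c + \<kappa>) * real n \<le> real (card M)"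
      have "4 \<le> real (max_degree H)" using \<Delta> by simp
      then have "3 / 2 \<le> (real (max_degree H) - 1) / 2" by simp
      then have c32: "3 / 2 \<le> c" using \<xi> unfolding c by (rule add_increasing2[OF less_imp_le, rotated])
      then have c0: "0 < c" by simp
      obtain W where W: "W \<subseteq> {..<n}" "W \<noteq> {}" "finite_graph (inner_edges M W) W"
        and dW: "c * real (card W) \<le> real (card (inner_edges M W))"
        and dU: "\<And>U. U \<subseteq> W \<Longrightarrow> U \<noteq> {} \<Longrightarrow> c * real (card U) < real (card (touching_edges (inner_edges M W) U))"
        and cut: "\<And>U. U \<subseteq> W \<Longrightarrow> U \<noteq> {} \<Longrightarrow> U \<noteq> W \<Longrightarrow>
         real (card (inner_edges (inner_edges M W) U)) + 2 * \<kappa> * real (card U) * (real (card W) - real (card U)) / real n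
           \<le> real (card (touching_edges (inner_edges M W) U))"
        using dense_core[OF M n c0 \<kappa> many] by blast
      define G where "G = inner_edges M W"
      interpret finite_graph G W unfolding G_def by (rule W(3))
      have finM: "finite M" using M finite_subset finite_complete_edges by blast
      have GM: "G \<subseteq> M" by (auto simp: G_def inner_edges_def)
      have w0: "0 < real (card W)" using W(2) finite_W by (simp add: card_gt_0_iff)
      have Wn: "real (card W) \<le> real n" using card_mono[OF _ W(1)] by simp
      have sub: "U \<subseteq> {..<n}" if "U \<subseteq> W" for U using that W(1) by blast
      have dens: "3 * card U < 2 * card (touching_edges G U)" if "U \<subseteq> W" "U \<noteq> {}" for U
      proof -
        have "3 / 2 * real (card U) \<le> c * real (card U)" using c32 by (intro mult_right_mono) auto
        then have "real (3 * card U) < real (2 * card (touching_edges G U))"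
          using dU[OF that] unfolding G_def by simp
        then show ?thesis by linarith
      qed
      have sparse: "real (card (inner_edges G U)) \<le> (1 + \<eta>) * real (card U)"
        if "U \<subseteq> W" "real (card U) \<le> \<beta> * real n" for U
      proof -
        have "inner_edges G U = inner_edges M U" using that by (auto simp: G_def inner_edges_def)
        then show ?thesis using e1 sub[OF that(1)] that(2) by simp
      qed
      \<comment> \<open>Up to that size sparsity allows fewer than 3/2 edges per vertex, against
        \<open>c \<ge> 3 / 2\<close>.\<close>
      have Wbig: "\<beta> * real n < real (card W)"
      proof (rule ccontr)
        assume "\<not> \<beta> * real n < real (card W)"
        then have "real (card (inner_edges G W)) \<le> (1 + \<eta>) * real (card W)" by (intro sparse) auto
        moreover have "card (inner_edges G W) = card G"
          using edge_subset by (intro arg_cong[where f = card]) (auto simp: inner_edges_def)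
        moreover have "(1 + \<eta>) * real (card W) < 3 / 2 * real (card W)"
          using \<eta> w0 by (intro mult_strict_right_mono) auto
        moreover have "3 / 2 * real (card W) \<le> c * real (card W)" using c32 by (intro mult_right_mono) auto
        ultimately show False using dW unfolding G_def by linarith
      qed
      have touchGM: "real (card (touching_edges G X)) \<le> real (card (touching_edges M X))" for X
        using touching_mono[OF GM finM] by simp
      have expand: "\<gamma> * real (card U) \<le> real (card (neighborhood G U))"
        if "U \<subseteq> W" "U \<noteq> {}" "2 * card U \<le> card W" for U
        unfolding \<gamma>_def
      proof (rule core_expands[OF _ n \<beta> Wbig \<kappa> \<theta>1 \<eta>(2) dens _ sparse _ Wn that])
        show "finite_graph G W" by unfold_locales
        show "real (card (touching_edges G X)) \<le> \<kappa> * \<beta>\<^sup>2 / 4 * real n"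
          if "X \<subseteq> W" "real (card X) \<le> \<theta>1 * real n" for X
          using e2 sub[OF that(1)] that(2) touchGM[of X] by (meson order_trans)
      qed (use cut in \<open>auto simp: G_def\<close>)
      \<comment> \<open>Written \<open>D - 1 + 1\<close> to match
        \<open>many_high_degree_vertices\<close> with the bound \<open>D - 1\<close>.\<close>
      define Z where "Z = {v \<in> W. D - 1 + 1 \<le> card (neighborhood G {v})}"
      have Zbig: "\<theta>2 * real n < real (card Z)"
      proof (rule ccontr)
        assume "\<not> \<theta>2 * real n < real (card Z)"
        then have "real (card (touching_edges M Z)) \<le> \<xi> * \<beta> / 2 * real n"
          using e3 sub[of Z] by (auto simp: Z_def)
        then have t: "real (card (touching_edges G Z)) \<le> \<xi> * \<beta> / 2 * real n"
          using touchGM[of Z] by linarith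
        have "2 * card G \<le> (D - 1) * card W + 2 * card (touching_edges G Z)"
          by (rule many_high_degree_vertices[OF Z_def])
        then have "real (2 * card G) \<le> real ((D - 1) * card W + 2 * card (touching_edges G Z))"
          by (rule of_nat_mono)
        moreover have "real (D - 1) = real D - 1" using \<Delta> by (simp add: D_def of_nat_diff)
        ultimately have "2 * real (card G) \<le> (real D - 1) * real (card W) + 2 * real (card (touching_edges G Z))"
          by simp
        moreover have "2 * (c * real (card W)) = (real D - 1) * real (card W) + 2 * \<xi> * real (card W)"
        proof -
          have "2 * c = (real D - 1) + 2 * \<xi>" unfolding c D_def by simp
          then have "(2 * c) * real (card W) = ((real D - 1) + 2 * \<xi>) * real (card W)" by simp
          then show ?thesis by (simp only: distrib_right mult.assoc)
        qed
        ultimately have "2 * \<xi> * real (card W) \<le> 2 * real (card (touching_edges G Z))"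
          using dW unfolding G_def by linarith
        then have "2 * \<xi> * real (card W) \<le> \<xi> * (\<beta> * real n)" using t by simp
        moreover have "\<xi> * (\<beta> * real n) < \<xi> * real (card W)" using Wbig \<xi> by simp
        moreover have "0 < \<xi> * real (card W)" using \<xi> w0 by simp
        ultimately show False by linarith
      qed
      \<comment> \<open>Any nonempty set of at most \<open>D * Q + 1\<close> core vertices not
        contained in \<open>B\<close> spans fewer edges than it has vertices.\<close>
      define B where "B = \<Union> (cyclic_sets n (D * Q + 1) M) \<inter> W"
      have cB: "real (card B) \<le> \<theta>3 / 2 * real n"
      proof -
        have "finite (\<Union> (cyclic_sets n (D * Q + 1) M))"
          by (rule finite_subset[of _ "{..<n}"]) (auto simp: cyclic_sets_def)
        then have "card B \<le> card (\<Union> (cyclic_sets n (D * Q + 1) M))"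
          unfolding B_def by (intro card_mono) auto
        then show ?thesis using e5 by linarith
      qed
      define A where "A x = {a \<in> parcs H. fst a = x}" for x
      have AI: "(\<Union>x\<in>pverts H. A x) = parcs H"
        unfolding A_def using H.in_arcsD1 by fastforce
      have "\<exists>v u T. inj_on v (pverts H) \<and> v ` pverts H \<subseteq> W \<and> (\<forall>x\<in>pverts H. \<forall>a\<in>A x. {v x, u a} \<in> G) \<and>
          tree_family (\<Union>x\<in>pverts H. A x) (v ` pverts H) Q Q u T"
      proof (rule spiders_exist[where D = D and B = B])
        show "finite (pverts H)" by (rule H.pair_finite_verts)
        show "finite (A x) \<and> card (A x) \<le> D" if "x \<in> pverts H" for x
          using out_arcs_le_max_degree[OF H that] H.pair_finite_arcs unfolding A_def D_def by auto
        show "A x \<inter> A y = {}" if "x \<noteq> y" for x y using that by (auto simp: A_def)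
        show "B \<subseteq> W" by (simp add: B_def)
        show "U \<subseteq> B" if U: "U \<subseteq> W" "U \<noteq> {}" "card U \<le> D * Q + 1" "card U \<le> card (inner_edges G U)" for U
        proof -
          have "card (inner_edges G U) \<le> card (inner_edges M U)"
            by (rule card_mono) (use finM GM in \<open>auto simp: inner_edges_def\<close>)
          then have "U \<in> cyclic_sets n (D * Q + 1) M"
            using U sub[OF U(1)] by (simp add: cyclic_sets_def)
          then show ?thesis using U(1) by (auto simp: B_def)
        qed
        show "\<exists>v\<in>W. D \<le> card (neighborhood G {v}) \<and> v \<notin> near G X (Suc Q)"
          if X: "X \<subseteq> W" "card X \<le> card B + card (pverts H) * (D * Q + 1)" for X
        proof -
          have "real (card X) \<le> real (card B) + real (h * (D * Q + 1))"
            using of_nat_mono[OF X(2), where 'a = real] unfolding h_def by simp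
          then have "real (card X) \<le> \<theta>3 * real n" using cB evh by linarith
          then have "real (card (near M X (Suc Q))) \<le> \<theta>2 * real n" using e4 sub[OF X(1)] by blast
          then have lt: "card (near M X (Suc Q)) < card Z" using Zbig by linarith
          have fin: "finite (near M X (Suc Q))"
            by (rule finite_subset[OF near_subset[OF M sub[OF X(1)]]]) simp
          have "\<not> Z \<subseteq> near M X (Suc Q)"
          proof
            assume "Z \<subseteq> near M X (Suc Q)"
            then have "card Z \<le> card (near M X (Suc Q))" by (rule card_mono[OF fin])
            then show False using lt by simp
          qed
          then obtain v where v: "v \<in> Z" "v \<notin> near M X (Suc Q)" by blast
          have "near G X (Suc Q) \<subseteq> near M X (Suc Q)"
            unfolding near_def using linked_mono[OF _ GM order_refl order_refl] by blast
          then show ?thesis using v \<Delta> unfolding Z_def D_def by auto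
        qed
      qed (use Q1 dens in auto)
      then obtain v u T where v: "inj_on v (pverts H)" "v ` pverts H \<subseteq> W"
        "\<And>x a. x \<in> pverts H \<Longrightarrow> a \<in> A x \<Longrightarrow> {v x, u a} \<in> G"
        "tree_family (parcs H) (v ` pverts H) Q Q u T"
        unfolding AI by blast
      show "contains_subdivision (edge_graph n M) H"
      proof (rule embed_from_spiders[OF H _ GM M W(1) v(1,2) _ v(4) dens, where \<eta> = \<eta> and \<gamma> = \<gamma> and \<rho> = \<rho>
            and ?a0.0 = "\<kappa>0 * real n" and K = K and ?m0.0 = "nat \<lfloor>\<beta> * real n\<rfloor>"])
        show "finite_graph G W" by unfold_locales
        show "{v x, u (x, y)} \<in> G" if "(x, y) \<in> parcs H" for x y
          using v(3)[of x "(x, y)"] that H.in_arcsD1 by (auto simp: A_def)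
        show "real (card (inner_edges G U)) \<le> (1 + \<eta>) * real (card U)"
          if "U \<subseteq> W" "card U \<le> nat \<lfloor>\<beta> * real n\<rfloor>" for U
          by (rule sparse[OF that(1)]) (use that(2) ev\<beta> in linarith)
        show "0 \<le> \<eta>" "20 * \<eta> * real (card (parcs H)) \<le> 1" using \<eta> by (auto simp: q_def)
        show "20 * (card (pverts H) + card (parcs H)) \<le> Q" by (simp add: Q_def h_def q_def)
        show "\<rho> = \<gamma> / (16 * real (card (parcs H)))" by (simp add: \<rho>_def q_def)
        show "0 < \<kappa>0 * real n" using \<kappa>0 n by simp
        have \<mu>n: "\<kappa>0 * real n * \<rho> ^ card (parcs H) = \<mu> * real n" by (simp add: \<mu>_def q_def)
        show "real Q \<le> \<kappa>0 * real n * \<rho> ^ card (parcs H)" unfolding \<mu>n by (rule evQ)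
        have "4 * real (card (parcs H)) * (\<kappa>0 * real n) = \<beta> * real n / 2"
          unfolding \<kappa>0_def q_def[symmetric] using q1 by simp
        also have "\<dots> \<le> real (nat \<lfloor>\<beta> * real n\<rfloor>)" using ev\<beta> by linarith
        finally show "4 * real (card (parcs H)) * (\<kappa>0 * real n) \<le> real (nat \<lfloor>\<beta> * real n\<rfloor>)" .
        have "real n * 1 \<le> real n * (\<gamma> * \<mu> * real K)" using K by (intro mult_left_mono) auto
        then show "real (card W) \<le> \<gamma> * (\<kappa>0 * real n * \<rho> ^ card (parcs H)) * real K"
          unfolding \<mu>n using Wn by (simp add: mult_ac)
        fix N assume "(17 / 16) ^ N \<le> 2 * (\<kappa>0 * real n)"
        then have "(real h + real q * real (2 * Q + 2 * K + 2)) + (2 * real q) * real N \<le> (\<gamma> * \<mu> / 8) * real n"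
          using evN by (simp add: mult.assoc)
        then show "real (card (pverts H)) + real (card (parcs H)) * real (2 * (Q + N) + 2 * K + 2)
          \<le> \<gamma> * (\<kappa>0 * real n * \<rho> ^ card (parcs H)) / 8"
          unfolding \<mu>n unfolding h_def[symmetric] q_def[symmetric] by (simp add: algebra_simps)
      qed (use expand \<gamma> \<rho> qne in auto)
    qed
  qed
qed

section \<open>The thresholds\<close>

lemma card_complete_edges: "real (card (complete_edges n)) = real n * (real n - 1) / 2"
proof -
  have "card (complete_edges n) = n choose 2"
    using n_subsets[of "{..<n}" 2] by (simp add: complete_edges_def)
  then show ?thesis by (cases n) (simp_all add: choose_two real_of_nat_div algebra_simps)
qed

text \<open>The game is stopped after \<open>T\<close> rounds, about \<open>c1 * n\<close>, with at
  least \<open>u\<close>, about \<open>\<epsilon> n ^ 2 / 16\<close>, edges unclaimed. Then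
  \<open>T / u\<close> is of order \<open>1 / n\<close>, as spreadness requires. The error is
  uniform in \<open>b\<close> and in Breaker's strategy; the summand 1 in the bias bound admits
  rounding up.\<close>

lemma random_maker_wins:
  fixes H :: "'a pair_pre_digraph" and \<epsilon> :: real
  assumes H: "pair_graph H" and \<Delta>: "4 \<le> max_degree H" and \<epsilon>: "0 < \<epsilon>" "\<epsilon> \<le> 1 / 2"
  shows "\<exists>\<psi>. \<psi> \<longlonglongrightarrow> 0 \<and> (\<forall>\<^sub>F n in sequentially. \<forall>b.
     real b \<le> (1 - \<epsilon>) * real n / (real (max_degree H) - 1) + 1 \<longrightarrow>
     1 - \<psi> n \<le> random_clever_prob (complete_edges n) b (subdivision_win H n))"
proof -
  define d where "d = real (max_degree H) - 1"
  have "4 \<le> real (max_degree H)" using \<Delta> by simp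
  then have d: "3 \<le> d" "0 < d" by (simp_all add: d_def)
  \<comment> \<open>\<open>c1\<close> is \<open>d / 2 + 2 * \<xi>\<close>: one \<open>\<xi>\<close>
    lifts the core density above \<open>d / 2\<close>, the other serves as the coefficient
    \<open>\<kappa>\<close> of the quadratic term.\<close>
  define \<xi> where "\<xi> = d * \<epsilon> / 8"
  define c where "c = d / 2 + \<xi>"
  define c1 where "c1 = c + \<xi>"
  have \<xi>: "0 < \<xi>" using d \<epsilon> by (simp add: \<xi>_def)
  have c1: "c1 = d / 2 * (1 + \<epsilon> / 2)" "0 < c1"
    using d \<epsilon> by (simp_all add: c1_def c_def \<xi>_def algebra_simps add_pos_pos)
  \<comment> \<open>Asymptotically \<open>T / u\<close> is
    \<open>16 * c1 / (\<epsilon> * n)\<close>; the factor 2 absorbs the roundings.\<close>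
  define C where "C = 32 * c1 / \<epsilon>"
  have C: "0 < C" using c1 \<epsilon> by (simp add: C_def)
  obtain \<psi> where \<psi>: "\<psi> \<longlonglongrightarrow> 0" "\<And>n p. 0 < n \<Longrightarrow> spread (C / real n) p \<Longrightarrow>
     measure_pmf.prob p {M. M \<subseteq> complete_edges n \<and>
       \<not> ((c + \<xi>) * real n \<le> real (card M) \<longrightarrow> contains_subdivision (edge_graph n M) H)} \<le> \<psi> n"
    using whp_contains_subdivision[OF H \<Delta> C \<xi> \<xi> c_def[unfolded d_def]] unfolding whp_def by blast
  define T where "T n = nat \<lceil>c1 * real n\<rceil>" for n
  define u where "u n = nat \<lfloor>\<epsilon> * real n ^ 2 / 16\<rfloor>" for n
  have T: "c1 * real n \<le> real (T n)" "real (T n) \<le> c1 * real n + 1" for n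
    unfolding T_def using c1 by (simp_all add: of_nat_nat)
  have u: "\<epsilon> * real n ^ 2 / 16 - 1 \<le> real (u n)" "real (u n) \<le> \<epsilon> * real n ^ 2 / 16" for n
  proof -
    have "0 \<le> \<epsilon> * real n ^ 2 / 16" using \<epsilon> by simp
    then show "\<epsilon> * real n ^ 2 / 16 - 1 \<le> real (u n)" "real (u n) \<le> \<epsilon> * real n ^ 2 / 16"
      unfolding u_def by linarith+
  qed
  have ev1: "\<forall>\<^sub>F n in sequentially. (c1 * real n + 1) * real n \<le> C * (\<epsilon> * real n ^ 2 / 16 - 1)"
  proof -
    have "\<forall>\<^sub>F n in sequentially. real n + C \<le> c1 * real n ^ 2" using c1(2) by real_asymp
    then show ?thesis
    proof eventually_elim
      case (elim n)
      have "C * (\<epsilon> * real n ^ 2 / 16 - 1) = 2 * c1 * real n ^ 2 - C"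
        using \<epsilon> by (simp add: C_def algebra_simps)
      moreover have "(c1 * real n + 1) * real n = c1 * real n ^ 2 + real n"
        by (simp add: algebra_simps power2_eq_square)
      ultimately show ?case using elim by linarith
    qed
  qed
  have ev2: "\<forall>\<^sub>F n in sequentially. 1 < \<epsilon> * real n ^ 2 / 16 - 1" using \<epsilon> by real_asymp
  have ev3: "\<forall>\<^sub>F n in sequentially. (c1 * real n + 1) * ((1 - \<epsilon>) * real n / d + 2) + \<epsilon> * real n ^ 2 / 16
      \<le> real n * (real n - 1) / 2"
  proof -
    define L where "L = 2 * c1 + (1 - \<epsilon>) / d + 1 / 2"
    have "\<forall>\<^sub>F n in sequentially. L * real n + 2 \<le> (\<epsilon> / 8) * real n ^ 2" using \<epsilon> by real_asymp
    then show ?thesis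
    proof eventually_elim
      case (elim n)
      \<comment> \<open>This is \<open>(1 + \<epsilon> / 2) * (1 - \<epsilon>) / 2\<close>. The
        slack \<open>\<epsilon> / 4\<close> covers the reserve \<open>\<epsilon> / 16\<close> and
        all linear terms.\<close>
      have "c1 * ((1 - \<epsilon>) / d) = 1 / 2 - \<epsilon> / 4 - \<epsilon> ^ 2 / 4"
        using d unfolding c1(1) by (simp add: field_simps power2_eq_square)
      then have k: "c1 * ((1 - \<epsilon>) / d) \<le> 1 / 2 - \<epsilon> / 4" by simp
      have "(c1 * real n + 1) * ((1 - \<epsilon>) * real n / d + 2) =
          (c1 * ((1 - \<epsilon>) / d)) * real n ^ 2 + (2 * c1 + (1 - \<epsilon>) / d) * real n + 2"
        by (simp add: algebra_simps power2_eq_square add_divide_distrib diff_divide_distrib)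
      also have "\<dots> \<le> (1 / 2 - \<epsilon> / 4) * real n ^ 2 + (2 * c1 + (1 - \<epsilon>) / d) * real n + 2"
        using k by (intro add_right_mono mult_right_mono) auto
      finally have "(c1 * real n + 1) * ((1 - \<epsilon>) * real n / d + 2) + \<epsilon> * real n ^ 2 / 16 \<le>
          (1 / 2 - \<epsilon> / 4) * real n ^ 2 + \<epsilon> * real n ^ 2 / 16 + (2 * c1 + (1 - \<epsilon>) / d) * real n + 2"
        by linarith
      also have "\<dots> = (1 / 2 - 3 * \<epsilon> / 16) * real n ^ 2 + L * real n + 2 - real n / 2"
        unfolding L_def by (simp add: algebra_simps)
      also have "\<dots> \<le> (1 / 2 - 3 * \<epsilon> / 16) * real n ^ 2 + (\<epsilon> / 8) * real n ^ 2 - real n / 2"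
        using elim by linarith
      also have "\<dots> = (1 / 2 - \<epsilon> / 16) * real n ^ 2 - real n / 2" by (simp add: algebra_simps)
      also have "\<dots> \<le> (1 / 2) * real n ^ 2 - real n / 2"
        using \<epsilon> by (intro diff_right_mono mult_right_mono) auto
      also have "\<dots> = real n * (real n - 1) / 2" by (simp add: algebra_simps power2_eq_square)
      finally show ?case .
    qed
  qed
  have "\<forall>\<^sub>F n in sequentially. \<forall>b. real b \<le> (1 - \<epsilon>) * real n / (real (max_degree H) - 1) + 1 \<longrightarrow>
     1 - \<psi> n \<le> random_clever_prob (complete_edges n) b (subdivision_win H n)"
    using ev1 ev2 ev3 eventually_gt_at_top[of 0]
  proof (eventually_elim, intro allI impI)
    fix n b :: nat
    assume e1: "(c1 * real n + 1) * real n \<le> C * (\<epsilon> * real n ^ 2 / 16 - 1)"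
      and e2: "1 < \<epsilon> * real n ^ 2 / 16 - 1"
      and e3: "(c1 * real n + 1) * ((1 - \<epsilon>) * real n / d + 2) + \<epsilon> * real n ^ 2 / 16
        \<le> real n * (real n - 1) / 2"
      and n: "0 < n" and b: "real b \<le> (1 - \<epsilon>) * real n / (real (max_degree H) - 1) + 1"
    let ?X = "complete_edges n"
    have u0: "0 < u n" using u(1)[of n] e2 by linarith
    have "real (T n * (b + 1) + u n) \<le> real (card ?X)"
    proof -
      have "real (T n) * (real b + 1) \<le> (c1 * real n + 1) * ((1 - \<epsilon>) * real n / d + 2)"
      proof (rule mult_mono[OF T(2)])
        show "real b + 1 \<le> (1 - \<epsilon>) * real n / d + 2" using b unfolding d_def by simp
      qed (use c1(2) in simp_all)
      moreover have "real (T n * (b + 1) + u n) = real (T n) * (real b + 1) + real (u n)"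
        by (simp add: algebra_simps)
      ultimately show ?thesis using u(2)[of n] e3 unfolding card_complete_edges by linarith
    qed
    then have fits: "T n * (b + 1) + u n \<le> card ?X" by (simp only: of_nat_le_iff)
    have TX: "T n \<le> card ?X"
    proof -
      have "T n * 1 \<le> T n * (b + 1)" by (rule mult_le_mono2) simp
      then show ?thesis using fits by linarith
    qed
    show "1 - \<psi> n \<le> random_clever_prob ?X b (subdivision_win H n)"
      unfolding random_clever_prob_def
    proof (rule cINF_greatest[OF breaker_strategies_nonempty])
      fix \<tau> assume \<tau>: "\<tau> \<in> breaker_strategies ?X b"
      let ?R = "play_rounds ?X (random_maker ?X) \<tau>"
      define p where "p = map_pmf maker_claims (?R (T n))"
      have "spread (C / real n) p"
        unfolding spread_def
      proof (intro allI impI)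
        fix S :: "nat set set" assume S: "finite S"
        have "measure_pmf.prob p {M. S \<subseteq> M} = measure_pmf.prob (?R (T n)) {h. S \<subseteq> maker_claims h}"
          unfolding p_def by (simp add: vimage_def)
        also have "\<dots> \<le> (real (T n) / real (u n)) ^ card S"
          by (rule random_maker_contains[OF _ \<tau> fits u0 order_refl S]) simp
        also have "\<dots> \<le> (C / real n) ^ card S"
        proof (rule power_mono)
          have "real (T n) * real n \<le> (c1 * real n + 1) * real n" using T(2) by (rule mult_right_mono) simp
          also have "\<dots> \<le> C * (\<epsilon> * real n ^ 2 / 16 - 1)" by (rule e1)
          also have "\<dots> \<le> C * real (u n)" using u(1) C by (intro mult_left_mono) auto
          finally show "real (T n) / real (u n) \<le> C / real n" using u0 n by (simp add: field_simps)
        qed simp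
        finally show "measure_pmf.prob p {M. S \<subseteq> M} \<le> (C / real n) ^ card S" .
      qed
      note bad = \<psi>(2)[OF n this]
      \<comment> \<open>Exactly \<open>T n\<close> rounds are played, so the edge count required by
        the implication holds with certainty.\<close>
      have supp: "M \<subseteq> ?X \<and> (c + \<xi>) * real n \<le> real (card M)" if Mp: "M \<in> set_pmf p" for M
      proof -
        obtain h where h: "h \<in> set_pmf (?R (T n))" "M = maker_claims h" using Mp by (auto simp: p_def)
        have "T n * (b + 1) < card ?X + b + 1" using fits by linarith
        then have "maker_claims h \<subseteq> ?X \<and> card (maker_claims h) = T n"
          using random_round_invariant[OF _ \<tau> _ h(1)] by auto
        then show ?thesis using h(2) T(1)[of n] by (simp add: c1_def)
      qed
      have "measure_pmf.prob p {M. \<not> subdivision_win H n M} \<le>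
         measure_pmf.prob p ({M. \<not> subdivision_win H n M} \<inter> set_pmf p)"
        by (simp add: measure_Int_set_pmf)
      also have "\<dots> \<le> measure_pmf.prob p {M. M \<subseteq> ?X \<and>
         \<not> ((c + \<xi>) * real n \<le> real (card M) \<longrightarrow> contains_subdivision (edge_graph n M) H)}"
        by (rule measure_pmf.finite_measure_mono) (use supp in \<open>auto simp: subdivision_win_def\<close>)
      also have "\<dots> \<le> \<psi> n" by (rule bad)
      finally have "measure_pmf.prob p {M. \<not> subdivision_win H n M} \<le> \<psi> n" .
      moreover have "measure_pmf.prob p {M. \<not> subdivision_win H n M} =
          1 - measure_pmf.prob p {M. subdivision_win H n M}"
        using measure_pmf.prob_compl[of "{M. subdivision_win H n M}" p]
        by (simp add: Compl_eq_Diff_UNIV[symmetric] Collect_neg_eq)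
      ultimately have "1 - \<psi> n \<le> measure_pmf.prob p {M. subdivision_win H n M}" by linarith
      also have "\<dots> = measure_pmf.prob (?R (T n)) {h. subdivision_win H n (maker_claims h)}"
        unfolding p_def by (simp add: vimage_def)
      also have "\<dots> \<le> measure_pmf.prob (?R (card ?X)) {h. subdivision_win H n (maker_claims h)}"
        by (rule prob_maker_mono[OF _ random_maker_strategy TX])
          (auto simp: subdivision_win_def intro: contains_subdivision_mono)
      also have "\<dots> = maker_win_prob ?X (subdivision_win H n) (random_maker ?X) \<tau>"
        unfolding maker_win_prob_def final_maker_claims_def by (simp add: vimage_def)
      finally show "1 - \<psi> n \<le> maker_win_prob ?X (subdivision_win H n) (random_maker ?X) \<tau>" .
    qed simp
  qed
  then show ?thesis using \<psi>(1) by blast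
qed

text \<open>Both probabilities are squeezed between the bound for random Maker and 1.\<close>

lemma random_clever_prob_tendsto_1:
  assumes H: "pair_graph H" "4 \<le> max_degree H" and \<epsilon>: "0 < \<epsilon>"
    and b: "\<forall>\<^sub>F n in sequentially. real (b n) \<le> (1 - \<epsilon>) * real n / (real (max_degree H) - 1) + 1"
  shows "(\<lambda>n. random_clever_prob (complete_edges n) (b n) (subdivision_win H n)) \<longlonglongrightarrow> 1"
    and "(\<lambda>n. clever_clever_prob (complete_edges n) (b n) (subdivision_win H n)) \<longlonglongrightarrow> 1"
proof -
  \<comment> \<open>A smaller \<open>\<epsilon>\<close> only allows a larger bias, so capping it at
    1/2 loses nothing.\<close>
  let ?\<epsilon> = "min \<epsilon> (1 / 2)"
  have "0 < ?\<epsilon>" "?\<epsilon> \<le> 1 / 2" using \<epsilon> by simp_all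
  note wins = random_maker_wins[OF H this]
  have d: "0 < real (max_degree H) - 1" using H(2) by simp
  obtain \<psi> where \<psi>: "\<psi> \<longlonglongrightarrow> 0" "\<forall>\<^sub>F n in sequentially. \<forall>b.
     real b \<le> (1 - ?\<epsilon>) * real n / (real (max_degree H) - 1) + 1 \<longrightarrow>
     1 - \<psi> n \<le> random_clever_prob (complete_edges n) b (subdivision_win H n)"
    using wins by blast
  have low: "\<forall>\<^sub>F n in sequentially. 1 - \<psi> n \<le> random_clever_prob (complete_edges n) (b n) (subdivision_win H n)"
    using \<psi>(2) b
  proof eventually_elim
    case (elim n)
    have "(1 - \<epsilon>) * real n / (real (max_degree H) - 1) \<le> (1 - ?\<epsilon>) * real n / (real (max_degree H) - 1)"
      using d by (intro divide_right_mono mult_right_mono) auto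
    then show ?case using elim by auto
  qed
  have lim: "(\<lambda>n. 1 - \<psi> n) \<longlonglongrightarrow> 1" using tendsto_diff[OF tendsto_const \<psi>(1), of 1] by simp
  show "(\<lambda>n. random_clever_prob (complete_edges n) (b n) (subdivision_win H n)) \<longlonglongrightarrow> 1"
  proof (rule tendsto_sandwich[OF low _ lim tendsto_const])
    show "\<forall>\<^sub>F n in sequentially. random_clever_prob (complete_edges n) (b n) (subdivision_win H n) \<le> 1"
      using random_clever_le_clever_clever(2,3)[OF finite_complete_edges] order_trans
      by (intro always_eventually) blast
  qed
  show "(\<lambda>n. clever_clever_prob (complete_edges n) (b n) (subdivision_win H n)) \<longlonglongrightarrow> 1"
  proof (rule tendsto_sandwich[OF _ _ lim tendsto_const])
    show "\<forall>\<^sub>F n in sequentially. 1 - \<psi> n \<le> clever_clever_prob (complete_edges n) (b n) (subdivision_win H n)"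
      using low
    proof eventually_elim
      case (elim n)
      then show ?case
        using random_clever_le_clever_clever(2)[OF finite_complete_edges, of n "b n" "subdivision_win H n"]
        by linarith
    qed
    show "\<forall>\<^sub>F n in sequentially. clever_clever_prob (complete_edges n) (b n) (subdivision_win H n) \<le> 1"
      using random_clever_le_clever_clever(3)[OF finite_complete_edges] by (intro always_eventually) blast
  qed
qed

text \<open>Breaker wins outright for all large \<open>n\<close>, so the probabilities are
  eventually equal to 0, not merely small.\<close>

lemma clever_clever_prob_tendsto_0:
  assumes H: "pair_graph H" "4 \<le> max_degree H"
    and b: "\<forall>\<^sub>F n in sequentially. 2 * real n / (real (max_degree H) - 1) < real (b n) + 1"
  shows "(\<lambda>n. random_clever_prob (complete_edges n) (b n) (subdivision_win H n)) \<longlonglongrightarrow> 0"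
    and "(\<lambda>n. clever_clever_prob (complete_edges n) (b n) (subdivision_win H n)) \<longlonglongrightarrow> 0"
proof -
  have H2: "2 \<le> max_degree H" using H(2) by simp
  have z: "\<forall>\<^sub>F n in sequentially. clever_clever_prob (complete_edges n) (b n) (subdivision_win H n) = 0"
    using b
  proof eventually_elim
    case (elim n)
    show ?case
      by (rule clever_clever_prob_zero[OF finite_complete_edges breaker_wins[OF H(1) H2 elim]])
  qed
  then show "(\<lambda>n. clever_clever_prob (complete_edges n) (b n) (subdivision_win H n)) \<longlonglongrightarrow> 0"
    by (rule tendsto_eventually)
  from z have "\<forall>\<^sub>F n in sequentially. random_clever_prob (complete_edges n) (b n) (subdivision_win H n) = 0"
  proof eventually_elim
    case (elim n)
    then show ?case
      using random_clever_le_clever_clever(1,2)[OF finite_complete_edges, of n "b n" "subdivision_win H n"]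
      by linarith
  qed
  then show "(\<lambda>n. random_clever_prob (complete_edges n) (b n) (subdivision_win H n)) \<longlonglongrightarrow> 0"
    by (rule tendsto_eventually)
qed

theorem theorem4:
  fixes H :: "'a pair_pre_digraph"
  assumes "pair_graph H" and "max_degree H \<ge> 4"
  shows
    "(\<forall>n b. is_rounding b (2 * real n / (real (max_degree H) - 1)) \<longrightarrow>
        breaker_has_winning_strategy (complete_edges n) b (subdivision_win H n)) \<and>
     (\<forall>\<epsilon>>0. \<forall>b :: nat \<Rightarrow> nat.
        (\<forall>n. is_rounding (b n) ((1 - \<epsilon>) * real n / (real (max_degree H) - 1))) \<longrightarrow>
        (\<lambda>n. random_clever_prob (complete_edges n) (b n) (subdivision_win H n)) \<longlonglongrightarrow> 1) \<and>
     is_threshold (\<lambda>n b. clever_clever_prob (complete_edges n) b (subdivision_win H n))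
       (\<lambda>n. real n / (real (max_degree H) - 1)) \<and>
     is_threshold (\<lambda>n b. random_clever_prob (complete_edges n) b (subdivision_win H n))
       (\<lambda>n. real n / (real (max_degree H) - 1))"
proof -
  have round: "x < real b + 1" "real b \<le> x + 1" if "is_rounding b x" for b x
    using that unfolding is_rounding_def by linarith+
  have d: "0 < real (max_degree H) - 1" using assms(2) by simp
  \<comment> \<open>Any fixed \<open>\<epsilon>\<close> would do for the lower side of the
    threshold; 1/2 is taken.\<close>
  have small: "\<forall>\<^sub>F n in sequentially. real (b n) \<le> (1 - 1 / 2) * real n / (real (max_degree H) - 1) + 1"
    if "(\<lambda>n. real (b n)) \<in> o(\<lambda>n. real n / (real (max_degree H) - 1))" for b :: "nat \<Rightarrow> nat"
    using landau_o.smallD[OF that, of "1 / 2"]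
  proof (rule eventually_mono)
    fix n assume "norm (real (b n)) \<le> 1 / 2 * norm (real n / (real (max_degree H) - 1))"
    then show "real (b n) \<le> (1 - 1 / 2) * real n / (real (max_degree H) - 1) + 1" using d by simp
  qed simp
  \<comment> \<open>The constant 2 in the definition of \<open>\<omega>\<close> already gives the
    bias from which Breaker's strategy wins.\<close>
  have large: "\<forall>\<^sub>F n in sequentially. 2 * real n / (real (max_degree H) - 1) < real (b n) + 1"
    if "(\<lambda>n. real (b n)) \<in> \<omega>(\<lambda>n. real n / (real (max_degree H) - 1))" for b :: "nat \<Rightarrow> nat"
    using landau_omega.smallD[OF that, of 2]
  proof (rule eventually_mono)
    fix n assume "norm (real (b n)) \<ge> 2 * norm (real n / (real (max_degree H) - 1))"
    then show "2 * real n / (real (max_degree H) - 1) < real (b n) + 1" using d by simp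
  qed simp
  have half: "(0 :: real) < 1 / 2" by simp
  show ?thesis
  proof (intro conjI allI impI)
    fix n b assume "is_rounding b (2 * real n / (real (max_degree H) - 1))"
    then show "breaker_has_winning_strategy (complete_edges n) b (subdivision_win H n)"
      using assms(2) by (intro breaker_wins[OF assms(1)] round(1)) auto
  next
    fix \<epsilon> :: real and b :: "nat \<Rightarrow> nat"
    assume "0 < \<epsilon>" "\<forall>n. is_rounding (b n) ((1 - \<epsilon>) * real n / (real (max_degree H) - 1))"
    then show "(\<lambda>n. random_clever_prob (complete_edges n) (b n) (subdivision_win H n)) \<longlonglongrightarrow> 1"
      using round(2) by (intro random_clever_prob_tendsto_1[OF assms]) auto
  next
    show "is_threshold (\<lambda>n b. clever_clever_prob (complete_edges n) b (subdivision_win H n))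
       (\<lambda>n. real n / (real (max_degree H) - 1))"
      unfolding is_threshold_def
      using random_clever_prob_tendsto_1(2)[OF assms half small] clever_clever_prob_tendsto_0(2)[OF assms large]
      by blast
    show "is_threshold (\<lambda>n b. random_clever_prob (complete_edges n) b (subdivision_win H n))
       (\<lambda>n. real n / (real (max_degree H) - 1))"
      unfolding is_threshold_def
      using random_clever_prob_tendsto_1(1)[OF assms half small] clever_clever_prob_tendsto_0(1)[OF assms large]
      by blast
  qed
qed

end
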